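(* Let $A\in\mathbb R^{d\times d}$ be a rate matrix, $H\in\mathbb R^{d\times m}$ with columns $H^1,\dots,H^m$, and $T\in(0,\infty)$. Let $\mathcal C\subset\mathbb R^d$ be the controllable subspace of the nonlinear model $(A,H)$, i.e. the set of all values $Y_0\in\mathbb R^d$ obtained, as $U$ ranges over $L^2_{\mathcal Z}([0,T];\mathbb R^m)$ and $c$ over $\mathbb R$, from the solution $(Y,V)$ of $$-dY_t=\Big(AY_t+HU_t+\sum_{j=1}^m\mathrm{diag}(H^j)V_t^j\Big)dt-V_t\,dZ_t,\qquad Y_T=c\mathsf 1 .$$ Then $\mathcal C$ is the span of the vector $\mathsf 1$ and all vectors obtained from it by repeatedly applying, in any order and any finite number of times, the operations $g\mapsto Ag$ and $g\mapsto H^j\cdot g$, $j=1,\dots,m$ (where $\cdot$ is the element-wise product of vectors). That is, $$\mathcal C=\mathrm{span}\big\{\mathsf 1,\ H,\ AH,\ A^2H,\ A^3H,\ldots,\ H\cdot H,\ A(H\cdot H),\ H\cdot(AH),\ A^2(H\cdot H),\ldots,\ H\cdot(H\cdot H),\ (AH)\cdot(H\cdot H),\ldots\big\}.$$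
   Context: A rate matrix $A\in\mathbb R^{d\times d}$ has non-negative off-diagonal entries and zero row sums; it is the generator of a Markov process on $\mathbb S=\{1,\dots,d\}$. $\mathsf 1\in\mathbb R^d$ is the vector of all ones; $\mathrm{diag}(H^j)$ is the diagonal matrix formed from $H^j$. $Z$ is an $m$-dimensional Brownian motion under a probability measure $\tilde{\mathsf P}$ on $\Omega$, with generated filtration $\mathcal Z=\{\mathcal Z_t\}_{0\le t\le T}$. $L^2_{\mathcal Z}([0,T];E)$ denotes $\mathcal Z$-adapted $E$-valued processes that are square integrable with respect to $d\tilde{\mathsf P}\,dt$. For each $U$ and $c$ the backward stochastic differential equation has a unique solution $(Y,V)\in L^2_{\mathcal Z}([0,T];\mathbb R^d)\times L^2_{\mathcal Z}([0,T];\mathbb R^{d\times m})$, $V_t^j$ is the $j$-th column of $V_t$, and $Y_0$ is deterministic. *)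

theory Defs
  imports "HOL-Probability.Probability"
begin

section \<open>Brownian motion and its filtration\<close>

definition natural_filtration ::
  "'w measure \<Rightarrow> (real \<Rightarrow> 'w \<Rightarrow> real^'m) \<Rightarrow> real \<Rightarrow> 'w measure" where
  "natural_filtration M Z t =
     sigma (space M) {Z s -` B \<inter> space M | s B. s \<in> {0..t} \<and> B \<in> sets borel}"

locale brownian_motion = prob_space M
  for M :: "'w measure" and Z :: "real \<Rightarrow> 'w \<Rightarrow> real^'m" and T :: real +
  assumes random_variable_Z: "t \<in> {0..T} \<Longrightarrow> Z t \<in> borel_measurable M"
    and start_at_0: "AE \<omega> in M. Z 0 \<omega> = 0"
    and continuous_paths: "AE \<omega> in M. continuous_on {0..T} (\<lambda>t. Z t \<omega>)"
    and gaussian_increments: "0 \<le> s \<Longrightarrow> s < t \<Longrightarrow> t \<le> T \<Longrightarrow>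
      distributed M lborel (\<lambda>\<omega>. Z t \<omega> $ j - Z s \<omega> $ j) (normal_density 0 (sqrt (t - s)))"
    and indep_components: "0 \<le> s \<Longrightarrow> s < t \<Longrightarrow> t \<le> T \<Longrightarrow>
      indep_vars (\<lambda>_. borel) (\<lambda>j \<omega>. Z t \<omega> $ j - Z s \<omega> $ j) UNIV"
    and indep_increments: "0 \<le> s \<Longrightarrow> s < t \<Longrightarrow> t \<le> T \<Longrightarrow>
      indep_set (sets (natural_filtration M Z s))
        {(\<lambda>\<omega>. Z t \<omega> - Z s \<omega>) -` B \<inter> space M | B. B \<in> sets borel}"

text \<open>Processes are jointly measurable functions, not equivalence classes. The \<open>L\<^sup>2\<close>
  condition is with respect to \<open>dt dM\<close> on \<open>[0, T]\<close>.\<close>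

definition L2_adapted ::
  "'w measure \<Rightarrow> (real \<Rightarrow> 'w \<Rightarrow> real^'m) \<Rightarrow> real \<Rightarrow> (real \<Rightarrow> 'w \<Rightarrow> 'e::euclidean_space) set" where
  "L2_adapted M Z T = {X.
     (\<lambda>(t, \<omega>). X t \<omega>) \<in> borel_measurable (restrict_space lborel {0..T} \<Otimes>\<^sub>M M) \<and>
     (\<forall>t\<in>{0..T}. X t \<in> borel_measurable (natural_filtration M Z t)) \<and>
     integrable (restrict_space lborel {0..T} \<Otimes>\<^sub>M M) (\<lambda>(t, \<omega>). (norm (X t \<omega>))\<^sup>2)}"

section \<open>The Ito integral\<close>

text \<open>A simple process on \<open>[a, b]\<close> is given by a partition \<open>a = p 0 \<le> \<dots> \<le> p n = b\<close> and by
  square-integrable values \<open>\<xi> k\<close> on \<open>(p k, p (k + 1)]\<close>, known at time \<open>p k\<close>.\<close>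

definition simple_data ::
  "'w measure \<Rightarrow> (real \<Rightarrow> 'w \<Rightarrow> real^'m) \<Rightarrow> real \<Rightarrow> real \<Rightarrow>
    nat \<Rightarrow> (nat \<Rightarrow> real) \<Rightarrow> (nat \<Rightarrow> 'w \<Rightarrow> real^'m^'d) \<Rightarrow> bool" where
  "simple_data M Z a b n p \<xi> \<longleftrightarrow>
     p 0 = a \<and> p n = b \<and> (\<forall>k<n. p k \<le> p (Suc k)) \<and>
     (\<forall>k<n. \<xi> k \<in> borel_measurable (natural_filtration M Z (p k)) \<and>
            integrable M (\<lambda>\<omega>. (norm (\<xi> k \<omega>))\<^sup>2))"

definition simple_process ::
  "nat \<Rightarrow> (nat \<Rightarrow> real) \<Rightarrow> (nat \<Rightarrow> 'w \<Rightarrow> real^'m^'d) \<Rightarrow> real \<Rightarrow> 'w \<Rightarrow> real^'m^'d" where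
  "simple_process n p \<xi> t \<omega> = (\<Sum>k<n. indicator {p k<..p (Suc k)} t *\<^sub>R \<xi> k \<omega>)"

definition simple_integral ::
  "(real \<Rightarrow> 'w \<Rightarrow> real^'m) \<Rightarrow> nat \<Rightarrow> (nat \<Rightarrow> real) \<Rightarrow> (nat \<Rightarrow> 'w \<Rightarrow> real^'m^'d) \<Rightarrow> 'w \<Rightarrow> real^'d" where
  "simple_integral Z n p \<xi> \<omega> = (\<Sum>k<n. \<xi> k \<omega> *v (Z (p (Suc k)) \<omega> - Z (p k) \<omega>))"

text \<open>The random variable \<open>I\<close> is a version of \<open>\<integral>\<^sub>a\<^sup>b V\<^sub>t dZ\<^sub>t\<close>. It is determined by \<open>V\<close> only up to
  null sets, so the integral is a relation.\<close>

definition has_ito_integral ::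
  "'w measure \<Rightarrow> (real \<Rightarrow> 'w \<Rightarrow> real^'m) \<Rightarrow> real \<Rightarrow> real \<Rightarrow>
    (real \<Rightarrow> 'w \<Rightarrow> real^'m^'d) \<Rightarrow> ('w \<Rightarrow> real^'d) \<Rightarrow> bool" where
  "has_ito_integral M Z a b V I \<longleftrightarrow> I \<in> borel_measurable M \<and>
     (\<exists>n p \<xi>. (\<forall>i::nat. simple_data M Z a b (n i) (p i) (\<xi> i)) \<and>
        (\<lambda>i. \<integral>\<^sup>+(t, \<omega>). ennreal ((norm (V t \<omega> - simple_process (n i) (p i) (\<xi> i) t \<omega>))\<^sup>2)
               \<partial>(restrict_space lborel {a..b} \<Otimes>\<^sub>M M)) \<longlonglongrightarrow> 0 \<and>
        (\<lambda>i. \<integral>\<^sup>+\<omega>. ennreal ((norm (I \<omega> - simple_integral Z (n i) (p i) (\<xi> i) \<omega>))\<^sup>2) \<partial>M)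
          \<longlonglongrightarrow> 0)"

section \<open>The controllable subspace\<close>

definition rate_matrix :: "real^'d^'d \<Rightarrow> bool" where
  "rate_matrix A \<longleftrightarrow> (\<forall>i j. i \<noteq> j \<longrightarrow> A $ i $ j \<ge> 0) \<and> (\<forall>i. (\<Sum>j\<in>UNIV. A $ i $ j) = 0)"

definition diag :: "real^'d \<Rightarrow> real^'d^'d" where
  "diag v = (\<chi> i j. if i = j then v $ i else 0)"

text \<open>The backward equation in integrated form, for each \<open>t\<close> almost surely:
  \<open>Y\<^sub>t = c 1 + \<integral>\<^sub>t\<^sup>T (A Y\<^sub>s + H U\<^sub>s + \<Sum>\<^sub>j diag (H\<^sup>j) V\<^sub>s\<^sup>j) ds - \<integral>\<^sub>t\<^sup>T V\<^sub>s dZ\<^sub>s\<close>.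
  At \<open>t = T\<close> this is the terminal condition. The vector \<open>1 :: real^'d\<close> has all entries one.\<close>

definition bsde_solution ::
  "'w measure \<Rightarrow> (real \<Rightarrow> 'w \<Rightarrow> real^'m) \<Rightarrow> real \<Rightarrow> real^'d^'d \<Rightarrow> real^'m^'d \<Rightarrow>
    (real \<Rightarrow> 'w \<Rightarrow> real^'m) \<Rightarrow> real \<Rightarrow> (real \<Rightarrow> 'w \<Rightarrow> real^'d) \<Rightarrow> (real \<Rightarrow> 'w \<Rightarrow> real^'m^'d) \<Rightarrow> bool" where
  "bsde_solution M Z T A H U c Y V \<longleftrightarrow>
     Y \<in> L2_adapted M Z T \<and> V \<in> L2_adapted M Z T \<and>
     (\<forall>t\<in>{0..T}. \<exists>I. has_ito_integral M Z t T V I \<and>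
        (AE \<omega> in M. Y t \<omega> = c *\<^sub>R 1
           + (LINT s:{t..T}|lborel. A *v Y s \<omega> + H *v U s \<omega>
                + (\<Sum>j\<in>UNIV. diag (column j H) *v column j (V s \<omega>)))
           - I \<omega>))"

definition controllable_subspace ::
  "'w measure \<Rightarrow> (real \<Rightarrow> 'w \<Rightarrow> real^'m) \<Rightarrow> real \<Rightarrow> real^'d^'d \<Rightarrow> real^'m^'d \<Rightarrow> (real^'d) set" where
  "controllable_subspace M Z T A H =
     {y. \<exists>U c Y V. U \<in> L2_adapted M Z T \<and> bsde_solution M Z T A H U c Y V \<and>
           (AE \<omega> in M. Y 0 \<omega> = y)}"

text \<open>On \<open>real^'d\<close> the product \<open>*\<close> is element-wise.\<close>

inductive_set generated_vectors :: "real^'d^'d \<Rightarrow> real^'m^'d \<Rightarrow> (real^'d) set"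
  for A :: "real^'d^'d" and H :: "real^'m^'d" where
  one: "1 \<in> generated_vectors A H"
| apply_A: "g \<in> generated_vectors A H \<Longrightarrow> A *v g \<in> generated_vectors A H"
| mult_H: "g \<in> generated_vectors A H \<Longrightarrow> column j H * g \<in> generated_vectors A H"

end

theory Submission
  imports Defs
begin

text \<open>Write \<open>D\<^sub>j = diag (H\<^sup>j)\<close> and let \<open>G\<close> be the span on the right-hand side. It is invariant under
  \<open>A\<close> and all \<open>D\<^sub>j\<close> and contains the range of \<open>H\<close>. For the orthogonal projection \<open>Q\<close> along \<open>G\<close>, the pair
  \<open>(QY, QV)\<close> therefore solves a homogeneous linear backward equation with terminal value \<open>0\<close>.
  By the Ito isometry, \<open>E|y\<^sub>t|\<^sup>2 + E \<integral> |v|\<^sup>2 \<le> 4 E |\<integral> f|\<^sup>2\<close> on \<open>[t, T]\<close>, where \<open>f\<close> is the drift; on short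
  intervals this is a contraction, so \<open>QY\<^sub>0 = 0\<close> and \<open>Y\<^sub>0 \<in> G\<close>.

  Conversely, call \<open>y\<close> steerable at time \<open>r\<close> if \<open>\<xi> y\<close> can be steered from time \<open>r\<close> to \<open>0\<close> for every
  square-integrable \<open>\<xi>\<close> known at time \<open>r\<close>. If \<open>w' = - A w\<close>, \<open>y' = - (A y + H u + D\<^sub>j w)\<close> and both \<open>y\<close> and
  \<open>w\<close> end in vectors steerable at \<open>q\<close>, then \<open>Y\<^sub>t = \<xi> (y t + (Z\<^sub>t\<^sup>j - Z\<^sub>r\<^sup>j) w t)\<close>, \<open>V\<^sub>t\<^sup>j = \<xi> w t\<close>, \<open>U\<^sub>t = \<xi> u t\<close>
  solves the equation on \<open>[r, q]\<close> and shows that \<open>y r\<close> is steerable at \<open>r\<close>: the noise injected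
  on \<open>[r, q]\<close> is known at time \<open>q\<close> and multiplies a steerable vector. Letting \<open>q\<close> tend to \<open>r\<close>,
  the vectors steerable at all times \<open>< T\<close> form a subspace that contains \<open>A y + H u + D\<^sub>j w\<close> with \<open>y\<close>
  and \<open>w\<close>. Together with the constant solutions \<open>Y = c 1\<close> this gives all of \<open>G\<close>.\<close>

text \<open>No existence theorem for the backward equation enters. One inclusion only estimates a
  given solution. For the other, every solution is written down by formula, as a deterministic flow
  times a random factor, so the only stochastic integrals to be computed have integrands
  \<open>\<xi> w\<close> with \<open>w\<close> deterministic, and integration by parts gives them in
  closed form. The obstacle is that \<open>D_j\<close> enters the drift only through a non-zero
  \<open>V\<close>, and such a \<open>V\<close> leaves a random state at time \<open>q\<close>. A
  notion of steerability for deterministic states alone would therefore not reproduce itself. With a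
  random coefficient it does: the residue is a fixed vector times
  \<open>\<xi> (Z_q^j - Z_r^j)\<close>, which is again square-integrable and known at
  \<open>q\<close>. The vector \<open>1\<close> is treated apart. Zero row sums give
  \<open>A 1 = 0\<close>, so constants solve the equation, while \<open>H^j * 1 = H^j\<close> is
  reached directly by a control. The filtration is the raw one, without added null sets, so every
  process that is built has to be adapted as it stands.\<close>

section \<open>Linear flows\<close>

text \<open>The flow is the exponential series with terms \<open>t^n / n! B^n z0\<close>. It is
  differentiated one coordinate at a time, where it is a real power series that converges
  everywhere. It supplies the deterministic curves along which states are steered.\<close>

lemma linear_flow_exists:
  fixes B :: "'a::euclidean_space \<Rightarrow> 'a"
  assumes "linear B"
  obtains z where "z 0 = z0" "\<And>t. (z has_vector_derivative B (z t)) (at t)"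
proof -
  interpret B: bounded_linear B using assms by (simp add: linear_conv_bounded_linear)
  obtain K where K: "K > 0" "\<And>x. norm (B x) \<le> norm x * K" using B.pos_bounded by blast
  define v where "v n = (B ^^ n) z0" for n
  have vS: "v (Suc n) = B (v n)" for n by (simp add: v_def)
  have nv: "norm (v n) \<le> norm z0 * K ^ n" for n
  proof (induction n)
    case (Suc n)
    have "norm (v (Suc n)) \<le> norm (v n) * K" using K vS by simp
    also have "\<dots> \<le> norm z0 * K ^ n * K" using Suc K by (intro mult_right_mono) auto
    finally show ?case by (simp add: mult_ac)
  qed (simp add: v_def)
  \<comment> \<open>The coefficients of the real power series for coordinate \<open>i\<close>. The
    bound on \<open>v n\<close> dominates it, up to the factor \<open>norm z0\<close>, by the series
    of \<open>exp (K * \<bar>t\<bar>)\<close>.\<close>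
  define a where "a i n = (v n \<bullet> i) / fact n" for i n
  have summable_exp: "summable (\<lambda>n. norm z0 * (K ^ n / fact n * t ^ n))" for t :: real
    using summable_mult[OF summable_exp[of "K * t"], of "norm z0"]
    by (simp add: field_simps power_mult_distrib)
  have sa: "summable (\<lambda>n. a i n * t ^ n)" if "i \<in> Basis" for i and t :: real
  proof (rule summable_comparison_test'[where N=0])
    show "summable (\<lambda>n. norm z0 * (K ^ n / fact n * \<bar>t\<bar> ^ n))" by (rule summable_exp)
    fix n :: nat
    have "\<bar>v n \<bullet> i\<bar> \<le> norm z0 * K ^ n"
      using Basis_le_norm[OF that, of "v n"] nv[of n] by linarith
    then have "\<bar>v n \<bullet> i\<bar> / fact n * \<bar>t\<bar>^n \<le> norm z0 * K ^ n / fact n * \<bar>t\<bar>^n"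
      by (intro mult_right_mono divide_right_mono) auto
    then show "norm (a i n * t ^ n) \<le> norm z0 * (K ^ n / fact n * \<bar>t\<bar> ^ n)"
      by (simp add: a_def abs_mult power_abs)
  qed
  define s where "s t = (\<Sum>n. (t ^ n / fact n) *\<^sub>R v n)" for t :: real
  have ss: "summable (\<lambda>n. (t ^ n / fact n) *\<^sub>R v n)" for t
  proof (rule summable_comparison_test'[where N=0])
    show "summable (\<lambda>n. norm z0 * (K ^ n / fact n * \<bar>t\<bar> ^ n))" by (rule summable_exp)
    fix n :: nat
    have "\<bar>t\<bar>^n / fact n * norm (v n) \<le> \<bar>t\<bar>^n / fact n * (norm z0 * K ^ n)"
      by (intro mult_left_mono nv) auto
    then show "norm ((t ^ n / fact n) *\<^sub>R v n) \<le> norm z0 * (K ^ n / fact n * \<bar>t\<bar> ^ n)"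
      by (simp add: power_abs mult_ac)
  qed
  have si: "s t \<bullet> i = (\<Sum>n. a i n * t ^ n)" for t i
    unfolding s_def using bounded_linear.suminf[OF bounded_linear_inner_left[of i] ss[of t]]
    by (simp add: a_def mult_ac)
  \<comment> \<open>Applying \<open>B\<close> shifts \<open>v n\<close> to \<open>v (Suc n)\<close>,
    which is what \<open>diffs\<close> does to the coefficients: the factor \<open>Suc n\<close>
    cancels against the factorial.\<close>
  have Bs: "B (s t) \<bullet> i = (\<Sum>n. diffs (a i) n * t ^ n)" for t i
  proof -
    have "B (s t) = (\<Sum>n. B ((t ^ n / fact n) *\<^sub>R v n))"
      unfolding s_def by (rule B.suminf[OF ss])
    also have "\<dots> \<bullet> i = (\<Sum>n. B ((t ^ n / fact n) *\<^sub>R v n) \<bullet> i)"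
      by (rule bounded_linear.suminf[OF bounded_linear_inner_left B.summable[OF ss]])
    also have "\<dots> = (\<Sum>n. diffs (a i) n * t ^ n)"
      by (intro suminf_cong) (simp add: diffs_def a_def B.scaleR vS mult_ac del: of_nat_Suc)
    finally show ?thesis .
  qed
  have "((\<lambda>t. s t \<bullet> i) has_real_derivative B (s t) \<bullet> i) (at t)" if "i \<in> Basis" for i t
    unfolding si Bs using that by (intro termdiffs_strong_converges_everywhere sa)
  then have "(s has_vector_derivative B (s t)) (at t)" for t
    unfolding has_vector_derivative_def
    by (subst has_derivative_componentwise_within)
       (auto simp: has_field_derivative_def mult_commute_abs)
  moreover have "s 0 = z0"
  proof -
    have "(\<lambda>n. ((0::real) ^ n / fact n) *\<^sub>R v n) sums (\<Sum>n\<in>{0}. ((0::real) ^ n / fact n) *\<^sub>R v n)"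
      by (rule sums_finite) auto
    then show ?thesis unfolding s_def by (simp add: sums_iff v_def)
  qed
  ultimately show ?thesis using that by blast
qed

section \<open>Brownian increments\<close>

lemma borel_measurable_vec_nth [measurable (raw)]:
  fixes f :: "'a \<Rightarrow> 'b::euclidean_space^'n"
  assumes "f \<in> borel_measurable N" shows "(\<lambda>x. f x $ i) \<in> borel_measurable N"
  by (rule measurable_compose[OF assms])
     (intro borel_measurable_continuous_onI linear_continuous_on bounded_linear_vec_nth)

abbreviation sqint :: "'a measure \<Rightarrow> ('a \<Rightarrow> 'b::real_normed_vector) \<Rightarrow> ennreal" where
  "sqint N f \<equiv> \<integral>\<^sup>+x. ennreal ((norm (f x))\<^sup>2) \<partial>N"

abbreviation sqint2 :: "('a \<times> 'c) measure \<Rightarrow> ('a \<Rightarrow> 'c \<Rightarrow> 'b::real_normed_vector) \<Rightarrow> ennreal" where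
  "sqint2 N f \<equiv> \<integral>\<^sup>+(t, x). ennreal ((norm (f t x))\<^sup>2) \<partial>N"

context brownian_motion
begin

abbreviation ito where "ito \<equiv> has_ito_integral M Z"

abbreviation L2a where "L2a \<equiv> L2_adapted M Z T"

abbreviation sq_integrable where "sq_integrable X \<equiv> integrable M (\<lambda>\<omega>. (norm (X \<omega>))\<^sup>2)"

abbreviation Esq where "Esq X \<equiv> expectation (\<lambda>\<omega>. (norm (X \<omega>))\<^sup>2)"

abbreviation inc where "inc j s t \<omega> \<equiv> Z t \<omega> $ j - Z s \<omega> $ j"

abbreviation strip :: "real set \<Rightarrow> (real \<times> 'w) measure" where
  "strip A \<equiv> restrict_space lborel A \<Otimes>\<^sub>M M"

abbreviation tint :: "real \<Rightarrow> real \<Rightarrow> (real \<Rightarrow> ennreal) \<Rightarrow> ennreal" where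
  "tint a b g \<equiv> \<integral>\<^sup>+s. g s * indicator {a..b} s \<partial>lborel"

abbreviation padd where "padd X Y \<equiv> \<lambda>t \<omega>. X t \<omega> + Y t \<omega>"

abbreviation joint where "joint A X \<equiv> (\<lambda>(t, \<omega>). X t \<omega>) \<in> borel_measurable (strip A)"

abbreviation F where "F \<equiv> natural_filtration M Z"

lemma space_F [simp]: "space (F t) = space M"
  unfolding natural_filtration_def by (simp add: space_measure_of_conv)

lemma sets_F: "sets (F t) = sigma_sets (space M) {Z s -` B \<inter> space M | s B. s \<in> {0..t} \<and> B \<in> sets borel}"
  unfolding natural_filtration_def by (rule sets_measure_of) auto

lemma sets_F_subset: assumes "t \<le> T" shows "sets (F t) \<subseteq> sets M"
  unfolding sets_F
  by (rule sets.sigma_sets_subset) (use assms in \<open>auto intro!: measurable_sets[OF random_variable_Z]\<close>)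

lemma measurable_F_mono:
  assumes "f \<in> measurable (F s) N" "s \<le> t" shows "f \<in> measurable (F t) N"
proof -
  have "sets (F s) \<subseteq> sets (F t)"
    unfolding sets_F using \<open>s \<le> t\<close> by (intro sigma_sets_mono') force
  then show ?thesis using assms(1) by (auto simp: measurable_def)
qed

lemma measurable_F_imp:
  assumes "f \<in> measurable (F t) N" "t \<le> T" shows "f \<in> measurable M N"
  using assms sets_F_subset[of t] by (auto simp: measurable_def)

lemma Z_measurable_F: assumes "0 \<le> s" "s \<le> t" shows "Z s \<in> borel_measurable (F t)"
  by (rule measurableI) (use assms in \<open>auto simp: sets_F intro!: sigma_sets.Basic\<close>)

text \<open>The assumption on increments concerns two families of sets. Both are stable under
  intersection, so independence passes to the sigma-algebras they generate, and from there to
  measurable functions of the past and of the increment. The later choices of \<open>\<phi>\<close>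
  are a coordinate and a product of two coordinates.\<close>

lemma indep_increment:
  fixes X :: "'w \<Rightarrow> real"
  assumes X: "X \<in> borel_measurable (F s)" and st: "0 \<le> s" "s < t" "t \<le> T"
    and \<phi>: "\<phi> \<in> borel_measurable borel"
  shows "indep_var borel X borel (\<lambda>\<omega>. \<phi> (Z t \<omega> - Z s \<omega>))"
proof -
  have XM: "X \<in> borel_measurable M" by (rule measurable_F_imp[OF X]) (use st in simp)
  have Zm: "(\<lambda>\<omega>. Z t \<omega> - Z s \<omega>) \<in> borel_measurable M"
    by (intro borel_measurable_diff random_variable_Z) (use st in auto)
  let ?D = "{(\<lambda>\<omega>. Z t \<omega> - Z s \<omega>) -` B \<inter> space M | B. B \<in> sets borel}"
  have "indep_set (sigma_sets (space M) (sets (F s))) (sigma_sets (space M) ?D)"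
  proof (rule indep_set_sigma_sets[OF indep_increments[OF st]])
    show "Int_stable (sets (F s))" by (auto simp: Int_stable_def)
    show "Int_stable ?D"
    proof (safe intro!: Int_stableI)
      fix B C :: "(real^'m) set" assume "B \<in> sets borel" "C \<in> sets borel"
      then show "\<exists>D. ((\<lambda>\<omega>. Z t \<omega> - Z s \<omega>) -` B \<inter> space M) \<inter> ((\<lambda>\<omega>. Z t \<omega> - Z s \<omega>) -` C \<inter> space M)
          = (\<lambda>\<omega>. Z t \<omega> - Z s \<omega>) -` D \<inter> space M \<and> D \<in> sets borel"
        by (intro exI[of _ "B \<inter> C"]) auto
    qed
  qed
  moreover have "sigma_sets (space M) {X -` A \<inter> space M |A. A \<in> sets borel} \<subseteq> sigma_sets (space M) (sets (F s))"
    using measurable_sets[OF X] by (intro sigma_sets_mono') auto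
  moreover have "sigma_sets (space M) {(\<lambda>\<omega>. \<phi> (Z t \<omega> - Z s \<omega>)) -` A \<inter> space M |A. A \<in> sets borel} \<subseteq> sigma_sets (space M) ?D"
  proof (rule sigma_sets_mono', safe)
    fix A :: "real set" assume "A \<in> sets borel"
    then have "\<phi> -` A \<in> sets borel" using measurable_sets[OF \<phi>, of A] by simp
    then show "\<exists>B. (\<lambda>\<omega>. \<phi> (Z t \<omega> - Z s \<omega>)) -` A \<inter> space M = (\<lambda>\<omega>. Z t \<omega> - Z s \<omega>) -` B \<inter> space M \<and> B \<in> sets borel"
      by (intro exI[of _ "\<phi> -` A"]) auto
  qed
  ultimately have "indep_set (sigma_sets (space M) {X -` A \<inter> space M |A. A \<in> sets borel})
      (sigma_sets (space M) {(\<lambda>\<omega>. \<phi> (Z t \<omega> - Z s \<omega>)) -` A \<inter> space M |A. A \<in> sets borel})"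
    unfolding indep_set_def by - (erule indep_sets_mono_sets, auto split: bool.split)
  then show ?thesis
    using XM measurable_compose[OF Zm \<phi>] by (simp add: indep_var_eq)
qed

lemma increment_moment1:
  assumes "0 \<le> s" "s \<le> t" "t \<le> T"
  shows "has_bochner_integral M (\<lambda>\<omega>. inc j s t \<omega>) 0"
proof (cases "s = t")
  case False
  then have st: "s < t" using assms by simp
  note D = gaussian_increments[OF assms(1) st assms(3), of j]
  have pos: "0 < sqrt (t - s)" using st by simp
  have "integrable M (\<lambda>\<omega>. inc j s t \<omega>)"
    using distributed_integrable[OF D, of "\<lambda>x. x"] integrable_normal_moment_nz_1[OF pos, of 0]
    by (simp add: normal_density_nonneg)
  then show ?thesis using normal_distributed_expectation[OF pos D] by (simp add: has_bochner_integral_iff)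
qed (simp add: has_bochner_integral_zero)

text \<open>For \<open>j = k\<close> this is the variance of the Gaussian law; for
  \<open>j \<noteq> k\<close> the two components are independent with mean zero.\<close>

lemma increment_moment2:
  assumes "0 \<le> s" "s \<le> t" "t \<le> T"
  shows "has_bochner_integral M (\<lambda>\<omega>. (inc j s t \<omega>) * (inc k s t \<omega>)) (if j = k then t - s else 0)"
proof (cases "s = t")
  case False
  then have st: "s < t" using assms by simp
  note D = gaussian_increments[OF assms(1) st assms(3), of j]
  have pos: "0 < sqrt (t - s)" using st by simp
  show ?thesis
  proof (cases "j = k")
    case True
    have "integrable M (\<lambda>\<omega>. (inc j s t \<omega>)^2)"
      using distributed_integrable[OF D, of "\<lambda>x. x^2"] integrable_normal_moment[OF pos, of 0 2]
      by (simp add: normal_density_nonneg)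
    moreover have "expectation (\<lambda>\<omega>. (inc j s t \<omega>)^2) = t - s"
      using normal_distributed_variance[OF pos D] normal_distributed_expectation[OF pos D] st by simp
    ultimately show ?thesis using True by (simp add: has_bochner_integral_iff power2_eq_square)
  next
    case False
    have "indep_vars (\<lambda>_. borel) (\<lambda>j \<omega>. inc j s t \<omega>) {j,k}"
      by (rule indep_vars_subset[OF indep_components[OF assms(1) st assms(3)]]) simp
    then have i: "indep_vars (\<lambda>_. borel) (\<lambda>j \<omega>. inc j s t \<omega>) (insert j {k})" by simp
    \<comment> \<open>A product over the singleton \<open>{k}\<close> brings the independence of a
      family into the form of two independent variables.\<close>
    have "indep_var borel (\<lambda>\<omega>. inc j s t \<omega>) borel (\<lambda>\<omega>. \<Prod>i\<in>{k}. inc i s t \<omega>)"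
      by (rule indep_vars_prod[OF _ _ i]) (use False in auto)
    then have ind: "indep_var borel (\<lambda>\<omega>. inc j s t \<omega>) borel (\<lambda>\<omega>. inc k s t \<omega>)" by simp
    note m = increment_moment1[OF assms, unfolded has_bochner_integral_iff]
    show ?thesis using False indep_var_integrable[OF ind] indep_var_lebesgue_integral[OF ind] m
      by (simp add: has_bochner_integral_iff)
  qed
qed (simp add: has_bochner_integral_zero)

text \<open>Integrability of the products comes from independence rather than from Cauchy-Schwarz,
  so \<open>X\<close> need only be integrable. This matters because \<open>X\<close> will itself be
  a product of two square-integrable functions.\<close>

lemma mult_increment:
  fixes X :: "'w \<Rightarrow> real"
  assumes X: "X \<in> borel_measurable (F s)" "integrable M X" and st: "0 \<le> s" "s \<le> t" "t \<le> T"
  shows "has_bochner_integral M (\<lambda>\<omega>. X \<omega> * (inc j s t \<omega>)) 0"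
    and "has_bochner_integral M (\<lambda>\<omega>. X \<omega> * ((inc j s t \<omega>) * (inc k s t \<omega>)))
           (if j = k then (t - s) * expectation X else 0)"
proof -
  have *: "has_bochner_integral M (\<lambda>\<omega>. X \<omega> * (inc j s t \<omega>)) 0 \<and>
     has_bochner_integral M (\<lambda>\<omega>. X \<omega> * ((inc j s t \<omega>) * (inc k s t \<omega>)))
           (if j = k then (t - s) * expectation X else 0)"
  proof (cases "s = t")
    case False
    then have lt: "s < t" using st by simp
    have i1: "indep_var borel X borel (\<lambda>\<omega>. (Z t \<omega> - Z s \<omega>) $ j)"
      by (rule indep_increment[OF X(1) st(1) lt st(3), where \<phi>="\<lambda>x. x $ j"]) simp
    have i2: "indep_var borel X borel (\<lambda>\<omega>. (Z t \<omega> - Z s \<omega>) $ j * (Z t \<omega> - Z s \<omega>) $ k)"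
      by (rule indep_increment[OF X(1) st(1) lt st(3), where \<phi>="\<lambda>x. x $ j * x $ k"]) simp
    note m1 = increment_moment1[OF st, of j, unfolded has_bochner_integral_iff]
    note m2 = increment_moment2[OF st, of j k, unfolded has_bochner_integral_iff]
    show ?thesis using indep_var_integrable[OF i1 X(2)] indep_var_lebesgue_integral[OF i1 X(2)] m1
       indep_var_integrable[OF i2 X(2)] indep_var_lebesgue_integral[OF i2 X(2)] m2
      by (auto simp: has_bochner_integral_iff)
  qed (simp add: has_bochner_integral_zero)
  then show "has_bochner_integral M (\<lambda>\<omega>. X \<omega> * (inc j s t \<omega>)) 0"
    and "has_bochner_integral M (\<lambda>\<omega>. X \<omega> * ((inc j s t \<omega>) * (inc k s t \<omega>)))
           (if j = k then (t - s) * expectation X else 0)" by auto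
qed

lemma integrable_mult_L2:
  fixes X Y :: "'w \<Rightarrow> real"
  assumes "X \<in> borel_measurable M" "Y \<in> borel_measurable M"
    "integrable M (\<lambda>\<omega>. (X \<omega>)\<^sup>2)" "integrable M (\<lambda>\<omega>. (Y \<omega>)\<^sup>2)"
  shows "integrable M (\<lambda>\<omega>. X \<omega> * Y \<omega>)"
proof (rule Bochner_Integration.integrable_bound)
  show "integrable M (\<lambda>\<omega>. (X \<omega>)\<^sup>2 + (Y \<omega>)\<^sup>2)" using assms by simp
  show "(\<lambda>\<omega>. X \<omega> * Y \<omega>) \<in> borel_measurable M" using assms by simp
  have "\<bar>x * y\<bar> \<le> x\<^sup>2 + y\<^sup>2" for x y :: real
    using sum_squares_bound[of "\<bar>x\<bar>" "\<bar>y\<bar>"] mult_nonneg_nonneg[of "\<bar>x\<bar>" "\<bar>y\<bar>"]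
    unfolding abs_mult power2_abs by linarith
  then show "AE \<omega> in M. norm (X \<omega> * Y \<omega>) \<le> norm ((X \<omega>)\<^sup>2 + (Y \<omega>)\<^sup>2)" by simp
qed

lemma (in -) norm_matrix_sq: "(norm (x :: real^'n^'k))\<^sup>2 = (\<Sum>i\<in>UNIV. \<Sum>j\<in>UNIV. (x $ i $ j)\<^sup>2)"
  by (simp add: norm_vec_def L2_set_def sum_nonneg)

lemma (in -) norm_vector_sq: "(norm (x :: real^'n))\<^sup>2 = (\<Sum>i\<in>UNIV. (x $ i)\<^sup>2)"
  by (simp add: norm_vec_def L2_set_def sum_nonneg)

lemma integrable_component_sq:
  fixes W :: "'w \<Rightarrow> real^'k"
  assumes "W \<in> borel_measurable M" "sq_integrable W"
  shows "integrable M (\<lambda>\<omega>. (W \<omega> $ i)\<^sup>2)"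
  by (rule Bochner_Integration.integrable_bound[OF assms(2)])
     (use assms(1) in \<open>simp_all add: component_le_norm_cart flip: abs_le_square_iff\<close>)

lemma integrable_entry_sq:
  fixes W :: "'w \<Rightarrow> real^'n^'k"
  assumes "W \<in> borel_measurable M" "sq_integrable W"
  shows "integrable M (\<lambda>\<omega>. (W \<omega> $ i $ j)\<^sup>2)"
proof (rule integrable_component_sq)
  show "sq_integrable (\<lambda>\<omega>. W \<omega> $ i)"
    by (rule Bochner_Integration.integrable_bound[OF assms(2)])
       (use assms(1) in \<open>auto intro!: power_mono Finite_Cartesian_Product.norm_nth_le\<close>)
qed (use assms(1) in simp)

text \<open>When the square is expanded, the terms linear in the increment vanish, since it is
  centred and independent of the past, and of the quadratic terms only those with
  \<open>j = k\<close> survive, with weight \<open>t - s\<close>. Keeping an arbitrary past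
  \<open>W\<close> in the statement makes it iterable along a partition.\<close>

lemma pythagoras_step:
  fixes W :: "'w \<Rightarrow> real^'d" and \<xi> :: "'w \<Rightarrow> real^'m^'d"
  assumes W: "W \<in> borel_measurable (F s)" "sq_integrable W"
    and \<xi>: "\<xi> \<in> borel_measurable (F s)" "sq_integrable \<xi>"
    and st: "0 \<le> s" "s \<le> t" "t \<le> T"
  shows "has_bochner_integral M (\<lambda>\<omega>. (norm (W \<omega> + \<xi> \<omega> *v (Z t \<omega> - Z s \<omega>)))\<^sup>2)
           (Esq W + (t - s) * Esq \<xi>)"
proof -
  have WM: "W \<in> borel_measurable M" and \<xi>M: "\<xi> \<in> borel_measurable M"
    using W(1) \<xi>(1) measurable_F_imp st by (meson order_trans)+
  note Wi = integrable_component_sq[OF WM W(2)] and \<xi>i = integrable_entry_sq[OF \<xi>M \<xi>(2)]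
  define D where "D \<omega> j = inc j s t \<omega>" for \<omega> j
  let ?c = "\<lambda>i \<omega>. \<Sum>j\<in>UNIV. 2 * ((W \<omega> $ i * \<xi> \<omega> $ i $ j) * D \<omega> j)"
    and ?q = "\<lambda>i \<omega>. \<Sum>j\<in>UNIV. \<Sum>k\<in>UNIV. (\<xi> \<omega> $ i $ j * \<xi> \<omega> $ i $ k) * (D \<omega> j * D \<omega> k)"
    and ?l = "\<lambda>i \<omega>. \<Sum>j\<in>UNIV. \<xi> \<omega> $ i $ j * D \<omega> j"
  have eq: "(norm (W \<omega> + \<xi> \<omega> *v (Z t \<omega> - Z s \<omega>)))\<^sup>2 =
    (\<Sum>i\<in>UNIV. (W \<omega> $ i)\<^sup>2 + ?c i \<omega>
        + ?q i \<omega>)" for \<omega>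
    unfolding norm_vector_sq
  proof (intro sum.cong refl)
    fix i :: 'd
    have "(W \<omega> + \<xi> \<omega> *v (Z t \<omega> - Z s \<omega>)) $ i = W \<omega> $ i + ?l i \<omega>"
      by (simp add: matrix_vector_mult_def D_def)
    moreover have "(x + y)\<^sup>2 = x\<^sup>2 + 2 * x * y + y * y" for x y :: real
      by (simp add: power2_eq_square algebra_simps)
    moreover have "2 * W \<omega> $ i * ?l i \<omega> = ?c i \<omega>"
      by (simp only: sum_distrib_left mult.assoc)
    moreover have "?l i \<omega> * ?l i \<omega>
        = ?q i \<omega>"
      unfolding sum_product by (intro sum.cong refl) (simp only: mult_ac)
    ultimately show "((W \<omega> + \<xi> \<omega> *v (Z t \<omega> - Z s \<omega>)) $ i)\<^sup>2 = (W \<omega> $ i)\<^sup>2 + ?c i \<omega>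
        + ?q i \<omega>"
      by simp
  qed
  have h1: "has_bochner_integral M (\<lambda>\<omega>. 2 * ((W \<omega> $ i * \<xi> \<omega> $ i $ j) * D \<omega> j)) 0" for i j
  proof -
    have "(\<lambda>\<omega>. W \<omega> $ i * \<xi> \<omega> $ i $ j) \<in> borel_measurable (F s)" using W(1) \<xi>(1) by simp
    moreover have "integrable M (\<lambda>\<omega>. W \<omega> $ i * \<xi> \<omega> $ i $ j)"
      by (rule integrable_mult_L2) (use WM \<xi>M Wi \<xi>i in auto)
    ultimately show ?thesis using has_bochner_integral_mult_right[OF mult_increment(1)[OF _ _ st, of "\<lambda>\<omega>. W \<omega> $ i * \<xi> \<omega> $ i $ j" j], of 2]
      by (simp add: D_def)
  qed
  have h2: "has_bochner_integral M (\<lambda>\<omega>. (\<xi> \<omega> $ i $ j * \<xi> \<omega> $ i $ k) * (D \<omega> j * D \<omega> k))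
      (if j = k then (t - s) * expectation (\<lambda>\<omega>. (\<xi> \<omega> $ i $ j)\<^sup>2) else 0)" for i j k
  proof -
    have "(\<lambda>\<omega>. \<xi> \<omega> $ i $ j * \<xi> \<omega> $ i $ k) \<in> borel_measurable (F s)" using W(1) \<xi>(1) by simp
    moreover have "integrable M (\<lambda>\<omega>. \<xi> \<omega> $ i $ j * \<xi> \<omega> $ i $ k)"
      by (rule integrable_mult_L2) (use WM \<xi>M Wi \<xi>i in auto)
    ultimately show ?thesis using mult_increment(2)[OF _ _ st, of "\<lambda>\<omega>. \<xi> \<omega> $ i $ j * \<xi> \<omega> $ i $ k" j k]
      by (simp add: D_def power2_eq_square cong: if_cong)
  qed
  have "has_bochner_integral M (\<lambda>\<omega>. (norm (W \<omega> + \<xi> \<omega> *v (Z t \<omega> - Z s \<omega>)))\<^sup>2)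
     (\<Sum>i\<in>UNIV. expectation (\<lambda>\<omega>. (W \<omega> $ i)\<^sup>2) + (\<Sum>j\<in>(UNIV::'m set). 0) +
        (\<Sum>j\<in>UNIV. \<Sum>k\<in>UNIV. (if j = k then (t - s) * expectation (\<lambda>\<omega>. (\<xi> \<omega> $ i $ j)\<^sup>2) else 0)))"
    unfolding eq
    by (intro has_bochner_integral_sum has_bochner_integral_add h1 h2 has_bochner_integral_integrable Wi)
  also have "(\<Sum>i\<in>UNIV. expectation (\<lambda>\<omega>. (W \<omega> $ i)\<^sup>2) + (\<Sum>j\<in>(UNIV::'m set). 0) +
        (\<Sum>j\<in>UNIV. \<Sum>k\<in>UNIV. (if j = k then (t - s) * expectation (\<lambda>\<omega>. (\<xi> \<omega> $ i $ j)\<^sup>2) else 0)))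
     = Esq W + (t - s) * Esq \<xi>"
    unfolding norm_vector_sq norm_matrix_sq using Wi \<xi>i
    by (simp add: sum.distrib flip: sum_distrib_left)
  finally show ?thesis .
qed

end

section \<open>The Ito isometry\<close>

lemma norm_sq_add_le: "(norm (x + y :: 'a::real_normed_vector))\<^sup>2 \<le> 2 * (norm x)\<^sup>2 + 2 * (norm y)\<^sup>2"
proof -
  have "(norm (x + y))\<^sup>2 \<le> (norm x + norm y)\<^sup>2" by (intro power_mono norm_triangle_ineq) auto
  also have "\<dots> \<le> 2 * (norm x)\<^sup>2 + 2 * (norm y)\<^sup>2"
    using sum_squares_bound[of "norm x" "norm y"] by (simp add: power2_sum)
  finally show ?thesis .
qed

lemma ennreal_norm_sq_add_le:
  "ennreal ((norm (x + y :: 'a::real_normed_vector))\<^sup>2) \<le> 2 * ennreal ((norm x)\<^sup>2) + 2 * ennreal ((norm y)\<^sup>2)"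
proof -
  have "ennreal ((norm (x + y))\<^sup>2) \<le> ennreal (2 * (norm x)\<^sup>2 + 2 * (norm y)\<^sup>2)"
    by (intro ennreal_leI norm_sq_add_le)
  then show ?thesis by (simp add: ennreal_mult)
qed

lemma nn_integral_norm_sq_add_le:
  fixes f g :: "'a \<Rightarrow> 'b::euclidean_space"
  assumes [measurable]: "f \<in> borel_measurable N" "g \<in> borel_measurable N"
  shows "sqint N (\<lambda>x. f x + g x)
     \<le> 2 * sqint N f + 2 * sqint N g"
proof -
  have "sqint N (\<lambda>x. f x + g x)
     \<le> (\<integral>\<^sup>+x. 2 * ennreal ((norm (f x))\<^sup>2) + 2 * ennreal ((norm (g x))\<^sup>2) \<partial>N)"
    by (intro nn_integral_mono ennreal_norm_sq_add_le)
  also have "\<dots> = 2 * sqint N f + 2 * sqint N g"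
    by (simp add: nn_integral_add nn_integral_cmult)
  finally show ?thesis .
qed

lemma integrable_norm_sq_iff:
  fixes f :: "'a \<Rightarrow> 'b::euclidean_space"
  assumes "f \<in> borel_measurable N"
  shows "integrable N (\<lambda>x. (norm (f x))\<^sup>2) \<longleftrightarrow> sqint N f < \<infinity>"
  using assms by (simp add: integrable_iff_bounded)

lemma borel_measurable_vec_lambda [measurable (raw)]:
  fixes f :: "'a \<Rightarrow> 'n::finite \<Rightarrow> 'b::euclidean_space"
  assumes "\<And>i. (\<lambda>x. f x i) \<in> borel_measurable N"
  shows "(\<lambda>x. \<chi> i. f x i) \<in> borel_measurable N"
  by (subst borel_measurable_euclidean_space) (use assms in \<open>auto simp: Basis_vec_def inner_axis\<close>)

lemma borel_measurable_matrix_vector_mult [measurable (raw)]: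
  fixes f :: "'a \<Rightarrow> real^'n^'k"
  assumes [measurable]: "f \<in> borel_measurable N" "g \<in> borel_measurable N"
  shows "(\<lambda>x. f x *v g x) \<in> borel_measurable N"
  unfolding matrix_vector_mult_def by measurable

section \<open>Partitions and simple processes\<close>

lemma simple_data_mono:
  assumes "simple_data M Z a b n p \<xi>" "i \<le> j" "j \<le> n"
  shows "p i \<le> p j"
  using assms(2,3)
proof (induction j)
  case (Suc j)
  show ?case
  proof (cases "i = Suc j")
    case False
    then have "p i \<le> p j" using Suc by simp
    also have "p j \<le> p (Suc j)" using assms(1) Suc.prems by (simp add: simple_data_def)
    finally show ?thesis .
  qed simp
qed simp

lemma simple_data_bounds:
  assumes "simple_data M Z a b n p \<xi>" "k \<le> n"
  shows "a \<le> p k" "p k \<le> b"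
  using simple_data_mono[OF assms(1), of 0 k] simple_data_mono[OF assms(1), of k n] assms
  by (auto simp: simple_data_def)

lemma simple_process_eq:
  assumes "simple_data M Z a b n p \<xi>" "k < n" "t \<in> {p k<..p (Suc k)}"
  shows "simple_process n p \<xi> t \<omega> = \<xi> k \<omega>"
proof -
  have other: "t \<notin> {p i<..p (Suc i)}" if "i < n" "i \<noteq> k" for i
  proof (cases "i < k")
    case True
    then show ?thesis using simple_data_mono[OF assms(1), of "Suc i" k] assms by auto
  next
    case False
    then show ?thesis using simple_data_mono[OF assms(1), of "Suc k" i] assms that by auto
  qed
  have "simple_process n p \<xi> t \<omega> = (\<Sum>i\<in>{k}. indicator {p i<..p (Suc i)} t *\<^sub>R \<xi> i \<omega>)"
    unfolding simple_process_def using assms other by (intro sum.mono_neutral_right) auto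
  also have "\<dots> = \<xi> k \<omega>" using assms by (subst sum.insert) auto
  finally show ?thesis .
qed

text \<open>The intervals \<open>{p k<..p (Suc k)}\<close> are disjoint, so at each time at most one
  summand is non-zero and no cross terms arise.\<close>

lemma norm_simple_process_le:
  assumes "simple_data M Z a b n p \<xi>"
  shows "(norm (simple_process n p \<xi> t \<omega>))\<^sup>2 \<le> (\<Sum>k<n. indicator {p k<..p (Suc k)} t * (norm (\<xi> k \<omega>))\<^sup>2)"
proof (cases "\<exists>k<n. t \<in> {p k<..p (Suc k)}")
  case True
  then obtain k where k: "k < n" "t \<in> {p k<..p (Suc k)}" by blast
  have "(norm (simple_process n p \<xi> t \<omega>))\<^sup>2 = indicator {p k<..p (Suc k)} t * (norm (\<xi> k \<omega>))\<^sup>2"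
    using k by (simp add: simple_process_eq[OF assms k])
  also have "\<dots> \<le> (\<Sum>k<n. indicator {p k<..p (Suc k)} t * (norm (\<xi> k \<omega>))\<^sup>2)"
    using k by (intro member_le_sum) auto
  finally show ?thesis .
next
  case False
  then have "simple_process n p \<xi> t \<omega> = 0"
    unfolding simple_process_def by (intro sum.neutral) auto
  then show ?thesis by (simp add: sum_nonneg)
qed

context brownian_motion
begin

lemma measurable_case_prod_mult_indicator:
  assumes "f \<in> borel_measurable M" "A \<in> sets N"
  shows "(\<lambda>(t,\<omega>). indicator A t * f \<omega> :: ennreal) \<in> borel_measurable (N \<Otimes>\<^sub>M M)"
  unfolding split_beta using assms by measurable

lemma simple_data_measurable:
  assumes "simple_data M Z a b n p \<xi>" "0 \<le> a" "b \<le> T" "k < n"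
  shows "\<xi> k \<in> borel_measurable M"
proof -
  have "\<xi> k \<in> borel_measurable (F (p k))" using assms by (simp add: simple_data_def)
  moreover have "p k \<le> T" using simple_data_bounds(2)[OF assms(1), of k] assms by simp
  ultimately show ?thesis by (rule measurable_F_imp)
qed

lemma simple_process_measurable:
  assumes "simple_data M Z a b n p \<xi>" "0 \<le> a" "b \<le> T"
  shows "(\<lambda>(t,\<omega>). simple_process n p \<xi> t \<omega>) \<in> borel_measurable (strip A)"
  unfolding split_beta simple_process_def
proof (intro borel_measurable_sum borel_measurable_scaleR)
  fix k assume "k \<in> {..<n}"
  then have [measurable]: "\<xi> k \<in> borel_measurable M" using simple_data_measurable[OF assms] by simp
  show "(\<lambda>x. \<xi> k (snd x)) \<in> borel_measurable (strip A)" by measurable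
  have "fst \<in> measurable (strip A) lborel"
    by (rule measurable_compose[OF measurable_fst]) (rule measurable_restrict_space1, simp)
  then show "(\<lambda>x. indicator {p k<..p (Suc k)} (fst x) :: real) \<in> borel_measurable (strip A)"
    by (rule measurable_compose) simp
qed

lemma simple_integral_measurable:
  assumes "simple_data M Z a b n p \<xi>" "0 \<le> a" "b \<le> T"
  shows "simple_integral Z n p \<xi> \<in> borel_measurable M"
  unfolding simple_integral_def[abs_def]
proof (intro borel_measurable_sum)
  fix k assume k: "k \<in> {..<n}"
  have [measurable]: "\<xi> k \<in> borel_measurable M" using simple_data_measurable[OF assms] k by simp
  have [measurable]: "Z (p k) \<in> borel_measurable M" "Z (p (Suc k)) \<in> borel_measurable M"
    using simple_data_bounds[OF assms(1), of k] simple_data_bounds[OF assms(1), of "Suc k"] k assms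
    by (auto intro!: random_variable_Z)
  show "(\<lambda>x. \<xi> k x *v (Z (p (Suc k)) x - Z (p k) x)) \<in> borel_measurable M"
    by measurable
qed

text \<open>The increments are appended one at a time by \<open>pythagoras_step\<close>, so the
  induction also has to carry that the partial integral is known at \<open>p k\<close>. The initial
  summand \<open>X\<close> is what later gives a joint bound for a solution and its integrand:
  \<open>X\<close> becomes \<open>y t\<close>.\<close>

lemma simple_pythagoras:
  fixes X :: "'w \<Rightarrow> real^'d"
  assumes sd: "simple_data M Z a b n p \<xi>" and ab: "0 \<le> a" "b \<le> T"
    and X: "X \<in> borel_measurable (F a)" "sq_integrable X"
  shows "has_bochner_integral M (\<lambda>\<omega>. (norm (X \<omega> + simple_integral Z n p \<xi> \<omega>))\<^sup>2)
     (Esq X + (\<Sum>k<n. (p (Suc k) - p k) * Esq (\<xi> k)))"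
proof -
  have "simple_integral Z k p \<xi> \<in> borel_measurable (F (p k)) \<and>
    has_bochner_integral M (\<lambda>\<omega>. (norm (X \<omega> + simple_integral Z k p \<xi> \<omega>))\<^sup>2)
     (Esq X + (\<Sum>i<k. (p (Suc i) - p i) * Esq (\<xi> i)))"
    if "k \<le> n" for k
    using that
  proof (induction k)
    case 0
    then show ?case using X by (auto simp: simple_integral_def[abs_def] has_bochner_integral_integrable)
  next
    case (Suc k)
    then have k: "k < n" by simp
    have le: "0 \<le> p k" "p k \<le> p (Suc k)" "p (Suc k) \<le> T"
      using simple_data_bounds[OF sd, of k] simple_data_bounds[OF sd, of "Suc k"] Suc.prems ab sd
      by (auto simp: simple_data_def)
    have \<xi>: "\<xi> k \<in> borel_measurable (F (p k))" "sq_integrable (\<xi> k)"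
      using sd k by (auto simp: simple_data_def)
    have XF: "X \<in> borel_measurable (F (p k))"
      by (rule measurable_F_mono[OF X(1)]) (use simple_data_bounds[OF sd, of k] k in simp)
    have SF: "simple_integral Z k p \<xi> \<in> borel_measurable (F (p k))" using Suc by simp
    have rec: "simple_integral Z (Suc k) p \<xi> \<omega> = simple_integral Z k p \<xi> \<omega> + \<xi> k \<omega> *v (Z (p (Suc k)) \<omega> - Z (p k) \<omega>)" for \<omega>
      by (simp add: simple_integral_def)
    have "has_bochner_integral M (\<lambda>\<omega>. (norm ((X \<omega> + simple_integral Z k p \<xi> \<omega>) + \<xi> k \<omega> *v (Z (p (Suc k)) \<omega> - Z (p k) \<omega>)))\<^sup>2)
           (Esq (\<lambda>\<omega>. X \<omega> + simple_integral Z k p \<xi> \<omega>) + (p (Suc k) - p k) * Esq (\<xi> k))"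
      by (rule pythagoras_step) (use XF SF \<xi> le Suc in \<open>auto simp: has_bochner_integral_iff\<close>)
    then have "has_bochner_integral M (\<lambda>\<omega>. (norm (X \<omega> + simple_integral Z (Suc k) p \<xi> \<omega>))\<^sup>2)
           (Esq (\<lambda>\<omega>. X \<omega> + simple_integral Z k p \<xi> \<omega>) + (p (Suc k) - p k) * Esq (\<xi> k))"
      by (simp add: rec add.assoc)
    moreover have "simple_integral Z (Suc k) p \<xi> \<in> borel_measurable (F (p (Suc k)))"
    proof -
      have [measurable]: "simple_integral Z k p \<xi> \<in> borel_measurable (F (p (Suc k)))"
        "\<xi> k \<in> borel_measurable (F (p (Suc k)))"
        using SF \<xi>(1) le(2) by (auto intro: measurable_F_mono)
      have [measurable]: "Z (p k) \<in> borel_measurable (F (p (Suc k)))" "Z (p (Suc k)) \<in> borel_measurable (F (p (Suc k)))"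
        using le by (auto intro: Z_measurable_F)
      show ?thesis unfolding rec[abs_def] by measurable
    qed
    ultimately show ?case using Suc by (simp add: add.assoc has_bochner_integral_iff)
  qed
  then show ?thesis by auto
qed

text \<open>Tonelli on each partition interval. By the previous lemma with \<open>X = 0\<close>, the
  right-hand side is the second moment of the simple integral. This direction is the one that bounds
  an integrand by its integral.\<close>

lemma simple_process_isometry_le:
  assumes sd: "simple_data M Z a b n p \<xi>" and ab: "0 \<le> a" "b \<le> T"
  shows "sqint2 (strip {a..b}) (\<lambda>t \<omega>. simple_process n p \<xi> t \<omega>)
    \<le> ennreal (\<Sum>k<n. (p (Suc k) - p k) * Esq (\<xi> k))"
proof -
  let ?N = "restrict_space lborel {a..b}" and ?g = "\<lambda>k t \<omega>. indicator {p k<..p (Suc k)} t * ennreal ((norm (\<xi> k \<omega>))\<^sup>2)"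
  \<comment> \<open>Partition intervals lie inside \<open>{a..b}\<close>, so the restricted measure
    gives them their full length.\<close>
  have S: "{p k<..p (Suc k)} \<inter> {a..b} = {p k<..p (Suc k)}" if "k < n" for k
    using simple_data_bounds[OF sd, of k] simple_data_bounds[OF sd, of "Suc k"] that by auto
  have A: "{p k<..p (Suc k)} \<in> sets ?N" if "k < n" for k
    using S[OF that] by (auto simp: sets_restrict_space intro!: image_eqI[of _ _ "{p k<..p (Suc k)}"])
  have m: "(\<lambda>\<omega>. ennreal ((norm (\<xi> k \<omega>))\<^sup>2)) \<in> borel_measurable M" if "k < n" for k
    using simple_data_measurable[OF sd ab that] by measurable
  have "sqint2 (?N \<Otimes>\<^sub>M M) (\<lambda>t \<omega>. simple_process n p \<xi> t \<omega>)
     \<le> (\<integral>\<^sup>+x. (\<Sum>k<n. (case x of (t,\<omega>) \<Rightarrow> ?g k t \<omega>)) \<partial>(?N \<Otimes>\<^sub>M M))"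
  proof (rule nn_integral_mono)
    fix x :: "real \<times> 'w"
    obtain t \<omega> where x: "x = (t, \<omega>)" by (cases x)
    have "ennreal ((norm (simple_process n p \<xi> t \<omega>))\<^sup>2) \<le> ennreal (\<Sum>k<n. indicator {p k<..p (Suc k)} t * (norm (\<xi> k \<omega>))\<^sup>2)"
      by (intro ennreal_leI norm_simple_process_le[OF sd])
    also have "\<dots> = (\<Sum>k<n. ?g k t \<omega>)"
      by (subst sum_ennreal[symmetric]) (auto simp: ennreal_mult ennreal_indicator)
    finally show "(case x of (t,\<omega>) \<Rightarrow> ennreal ((norm (simple_process n p \<xi> t \<omega>))\<^sup>2))
      \<le> (\<Sum>k<n. (case x of (t,\<omega>) \<Rightarrow> ?g k t \<omega>))"
      by (simp only: x prod.case)
  qed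
  also have "\<dots> = (\<Sum>k<n. \<integral>\<^sup>+(t,\<omega>). ?g k t \<omega> \<partial>(?N \<Otimes>\<^sub>M M))"
    by (intro nn_integral_sum measurable_case_prod_mult_indicator m A) auto
  also have "\<dots> = (\<Sum>k<n. ennreal ((p (Suc k) - p k) * Esq (\<xi> k)))"
  proof (intro sum.cong refl)
    fix k assume "k \<in> {..<n}"
    then have k: "k < n" by simp
    have i: "sq_integrable (\<xi> k)" using sd k by (simp add: simple_data_def)
    have le: "p k \<le> p (Suc k)" using sd k by (simp add: simple_data_def)
    have "(\<integral>\<^sup>+(t,\<omega>). ?g k t \<omega> \<partial>(?N \<Otimes>\<^sub>M M))
       = (\<integral>\<^sup>+t. (\<integral>\<^sup>+\<omega>. ?g k t \<omega> \<partial>M) \<partial>?N)"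
      using nn_integral_fst[OF measurable_case_prod_mult_indicator[OF m[OF k] A[OF k]]] by simp
    also have "\<dots> = (\<integral>\<^sup>+t. indicator {p k<..p (Suc k)} t * ennreal (Esq (\<xi> k)) \<partial>?N)"
      by (simp add: nn_integral_cmult[OF m[OF k]] nn_integral_eq_integral[OF i])
    also have "\<dots> = emeasure ?N {p k<..p (Suc k)} * ennreal (Esq (\<xi> k))"
      using A[OF k] by (subst nn_integral_multc) auto
    also have "emeasure ?N {p k<..p (Suc k)} = ennreal (p (Suc k) - p k)"
      using S[OF k] le by (subst emeasure_restrict_space) auto
    finally show "(\<integral>\<^sup>+(t,\<omega>). ?g k t \<omega> \<partial>(?N \<Otimes>\<^sub>M M))
      = ennreal ((p (Suc k) - p k) * Esq (\<xi> k))"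
      using le by (simp add: ennreal_mult)
  qed
  also have "\<dots> = ennreal (\<Sum>k<n. (p (Suc k) - p k) * Esq (\<xi> k))"
    using sd by (intro sum_ennreal mult_nonneg_nonneg) (auto simp: simple_data_def)
  finally show ?thesis .
qed

text \<open>Equality holds without the factor \<open>4\<close>, which comes from two uses of
  \<open>|x + y|\<^sup>2 \<le> 2 |x|\<^sup>2 + 2 |y|\<^sup>2\<close> in place of a limit argument for the norms.\<close>

lemma ito_pythagoras:
  fixes X :: "'w \<Rightarrow> real^'d" and V :: "real \<Rightarrow> 'w \<Rightarrow> real^'m^'d"
  assumes ito: "ito a b V I" and ab: "0 \<le> a" "b \<le> T"
    and V: "joint {a..b} V"
    and X: "X \<in> borel_measurable (F a)" "sq_integrable X" and "a \<le> T"
  shows "sqint M X +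
      sqint2 (strip {a..b}) V
    \<le> 4 * sqint M (\<lambda>\<omega>. X \<omega> + I \<omega>)"
proof -
  let ?N = "strip {a..b}"
  obtain n p \<xi> where sd: "\<And>i::nat. simple_data M Z a b (n i) (p i) (\<xi> i)"
    and c1: "(\<lambda>i. sqint2 ?N (\<lambda>t \<omega>. V t \<omega> - simple_process (n i) (p i) (\<xi> i) t \<omega>)) \<longlonglongrightarrow> 0"
    and c2: "(\<lambda>i. sqint M (\<lambda>\<omega>. I \<omega> - simple_integral Z (n i) (p i) (\<xi> i) \<omega>)) \<longlonglongrightarrow> 0"
    and I[measurable]: "I \<in> borel_measurable M"
    using ito unfolding has_ito_integral_def by blast
  have XM[measurable]: "X \<in> borel_measurable M" using measurable_F_imp[OF X(1) \<open>a \<le> T\<close>] .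
  let ?x = "sqint M X" and ?v = "sqint2 ?N V"
    and ?r = "sqint M (\<lambda>\<omega>. X \<omega> + I \<omega>)"
  let ?e = "\<lambda>i. sqint2 ?N (\<lambda>t \<omega>. V t \<omega> - simple_process (n i) (p i) (\<xi> i) t \<omega>)"
  let ?d = "\<lambda>i. sqint M (\<lambda>\<omega>. I \<omega> - simple_integral Z (n i) (p i) (\<xi> i) \<omega>)"
  have main: "?x + ?v \<le> 4 * ?r + (4 * ?d i + 2 * ?e i)" for i
  proof -
    let ?\<Phi> = "simple_process (n i) (p i) (\<xi> i)" and ?S = "simple_integral Z (n i) (p i) (\<xi> i)"
    define q where "q = (\<Sum>k<n i. (p i (Suc k) - p i k) * Esq (\<lambda>\<omega>. \<xi> i k \<omega>))"
    have q0: "0 \<le> q" unfolding q_def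
      using sd[of i] by (intro sum_nonneg mult_nonneg_nonneg) (auto simp: simple_data_def)
    have Sm[measurable]: "?S \<in> borel_measurable M" by (rule simple_integral_measurable[OF sd ab])
    have \<Phi>m: "(\<lambda>x. ?\<Phi> (fst x) (snd x)) \<in> borel_measurable ?N"
      using simple_process_measurable[OF sd ab] by (simp add: split_beta)
    have Vm: "(\<lambda>x. V (fst x) (snd x)) \<in> borel_measurable ?N" using V by (simp add: split_beta)
    have "?v \<le> 2 * sqint ?N (\<lambda>x. ?\<Phi> (fst x) (snd x)) + 2 * ?e i"
      using nn_integral_norm_sq_add_le[OF \<Phi>m borel_measurable_diff[OF Vm \<Phi>m]] by (simp add: case_prod_unfold)
    moreover have "sqint ?N (\<lambda>x. ?\<Phi> (fst x) (snd x)) \<le> ennreal q"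
      using simple_process_isometry_le[OF sd[of i] ab] by (simp add: case_prod_unfold q_def)
    ultimately have v: "?v \<le> 2 * ennreal q + 2 * ?e i"
      by (meson add_right_mono mult_left_mono order_trans zero_le)
    note py = simple_pythagoras[OF sd[of i] ab X, folded q_def, unfolded has_bochner_integral_iff]
    \<comment> \<open>For simple integrands the isometry is exact. Passing from the simple integral
      to \<open>I\<close> then costs only the error \<open>?d i\<close>.\<close>
    have "?x + ennreal q = sqint M (\<lambda>\<omega>. X \<omega> + ?S \<omega>)"
      using py X(2) q0 by (simp add: nn_integral_eq_integral ennreal_plus[symmetric] del: ennreal_plus)
    also have "\<dots> = sqint M (\<lambda>\<omega>. (X \<omega> + I \<omega>) + - (I \<omega> - ?S \<omega>))" by simp
    also have "\<dots> \<le> 2 * ?r + 2 * sqint M (\<lambda>\<omega>. - (I \<omega> - ?S \<omega>))"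
      by (rule nn_integral_norm_sq_add_le) measurable
    also have "\<dots> = 2 * ?r + 2 * ?d i" by (simp only: norm_minus_cancel)
    finally have xq: "?x + ennreal q \<le> 2 * ?r + 2 * ?d i" .
    have "?x + ?v \<le> 2 * (?x + ennreal q) + 2 * ?e i"
    proof -
      have "?x \<le> 2 * ?x" using mult_right_mono[of 1 2 ?x] by simp
      with v have "?x + ?v \<le> 2 * ?x + (2 * ennreal q + 2 * ?e i)" by (rule add_mono[rotated])
      then show ?thesis by (simp add: distrib_left add.assoc)
    qed
    also have "\<dots> \<le> 2 * (2 * ?r + 2 * ?d i) + 2 * ?e i" by (intro add_right_mono mult_left_mono xq) simp
    also have "\<dots> = 4 * ?r + (4 * ?d i + 2 * ?e i)" by (simp add: distrib_left add.assoc mult.assoc[symmetric])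
    finally show ?thesis .
  qed
  \<comment> \<open>The left side of \<open>main\<close> does not depend on \<open>i\<close> and
    both error terms tend to zero, so only \<open>4 * ?r\<close> remains.\<close>
  have "(\<lambda>i. 4 * ?r + (4 * ?d i + 2 * ?e i)) \<longlonglongrightarrow> 4 * ?r + (4 * 0 + 2 * 0)"
    by (intro tendsto_add tendsto_const ennreal_tendsto_cmult c1 c2) auto
  then show ?thesis using main by (intro LIMSEQ_le_const[where X="\<lambda>i. 4 * ?r + (4 * ?d i + 2 * ?e i)"]) auto
qed

text \<open>A single approximant suffices: \<open>I\<close> is a square-integrable simple integral
  plus an error with second moment below 1.\<close>

lemma ito_integral_L2:
  fixes V :: "real \<Rightarrow> 'w \<Rightarrow> real^'m^'d"
  assumes ito: "ito a b V I" and ab: "0 \<le> a" "b \<le> T"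
  shows "I \<in> borel_measurable M" "sq_integrable I"
proof -
  obtain n p \<xi> where sd: "\<And>i::nat. simple_data M Z a b (n i) (p i) (\<xi> i)"
    and c2: "(\<lambda>i. sqint M (\<lambda>\<omega>. I \<omega> - simple_integral Z (n i) (p i) (\<xi> i) \<omega>)) \<longlonglongrightarrow> 0"
    and I: "I \<in> borel_measurable M"
    using ito unfolding has_ito_integral_def by blast
  obtain i where i: "sqint M (\<lambda>\<omega>. I \<omega> - simple_integral Z (n i) (p i) (\<xi> i) \<omega>) < 1"
    using order_tendstoD(2)[OF c2, of 1] by (auto simp: eventually_sequentially)
  let ?S = "simple_integral Z (n i) (p i) (\<xi> i)"
  have Sm: "?S \<in> borel_measurable M" by (rule simple_integral_measurable[OF sd ab])
  have "sq_integrable ?S"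
    using simple_pythagoras[OF sd[of i] ab, of "\<lambda>_. 0"] by (simp add: has_bochner_integral_iff)
  then have S: "sqint M ?S < \<infinity>" using integrable_norm_sq_iff[OF Sm] by simp
  have "sqint M I = sqint M (\<lambda>\<omega>. ?S \<omega> + (I \<omega> - ?S \<omega>))" by simp
  also have "\<dots> \<le> 2 * sqint M ?S + 2 * sqint M (\<lambda>\<omega>. I \<omega> - ?S \<omega>)"
    by (rule nn_integral_norm_sq_add_le) (use Sm I in auto)
  also have "\<dots> < \<infinity>" using S order.strict_trans[OF i, of \<infinity>] by (simp add: ennreal_mult_less_top)
  finally show "sq_integrable I" using integrable_norm_sq_iff[OF I] by simp
  show "I \<in> borel_measurable M" by (rule I)
qed

end

section \<open>Time integrals of processes\<close>

lemma ennreal_sq_add_le: "(x + y)\<^sup>2 \<le> 2 * x\<^sup>2 + 2 * (y::ennreal)\<^sup>2"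
proof (cases "x = \<top> \<or> y = \<top>")
  case False
  then obtain a b where ab: "x = ennreal a" "y = ennreal b" "0 \<le> a" "0 \<le> b"
    by (cases x; cases y) auto
  have "(a + b)\<^sup>2 \<le> 2 * a\<^sup>2 + 2 * b\<^sup>2"
    using sum_squares_bound[of a b] by (simp add: power2_sum)
  then have "ennreal ((a + b)\<^sup>2) \<le> ennreal (2 * a\<^sup>2 + 2 * b\<^sup>2)" by (rule ennreal_leI)
  moreover have "(x + y)\<^sup>2 = ennreal ((a + b)\<^sup>2)"
    using ab by (simp add: ennreal_power flip: ennreal_plus)
  moreover have "2 * x\<^sup>2 + 2 * y\<^sup>2 = ennreal (2 * a\<^sup>2 + 2 * b\<^sup>2)"
    using ab by (simp add: ennreal_power ennreal_mult)
  ultimately show ?thesis by simp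
qed (auto simp: power2_eq_square ennreal_mult_eq_top_iff)

section \<open>Measurability on the product of a time interval and the probability space\<close>

lemma measurable_pair_restrict_mono:
  assumes "f \<in> borel_measurable (restrict_space L A \<Otimes>\<^sub>M M)" "B \<subseteq> A"
  shows "f \<in> borel_measurable (restrict_space L B \<Otimes>\<^sub>M M)"
proof -
  have "fst \<in> measurable (restrict_space L B \<Otimes>\<^sub>M M) (restrict_space L A)"
    by (rule measurable_compose[OF measurable_fst]) (use assms(2) in \<open>auto intro: measurable_restrict_space3\<close>)
  then have "(\<lambda>x. (fst x, snd x)) \<in> measurable (restrict_space L B \<Otimes>\<^sub>M M) (restrict_space L A \<Otimes>\<^sub>M M)"
    by measurable
  from measurable_compose[OF this assms(1)] show ?thesis by simp
qed

text \<open>Extension by zero moves a process from a strip to the whole product, where swapping the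
  factors and Fubini apply directly.\<close>

lemma measurable_pair_extend:
  fixes f :: "'a \<Rightarrow> 'b \<Rightarrow> 'c::{real_normed_vector, second_countable_topology}"
  assumes f: "(\<lambda>(s,\<omega>). f s \<omega>) \<in> borel_measurable (restrict_space L A \<Otimes>\<^sub>M M)" and A: "A \<in> sets L"
  shows "(\<lambda>(s,\<omega>). indicator A s *\<^sub>R f s \<omega>) \<in> borel_measurable (L \<Otimes>\<^sub>M M)"
proof -
  let ?\<Omega> = "A \<times> space M"
  have \<Omega>: "?\<Omega> \<inter> space (L \<Otimes>\<^sub>M M) \<in> sets (L \<Otimes>\<^sub>M M)" using A by auto
  have "fst \<in> measurable (restrict_space (L \<Otimes>\<^sub>M M) ?\<Omega>) (restrict_space L A)"
    by (rule measurable_restrict_space3) auto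
  moreover have "snd \<in> measurable (restrict_space (L \<Otimes>\<^sub>M M) ?\<Omega>) M"
    by (rule measurable_restrict_space1) auto
  ultimately have "(\<lambda>x. (fst x, snd x)) \<in> measurable (restrict_space (L \<Otimes>\<^sub>M M) ?\<Omega>) (restrict_space L A \<Otimes>\<^sub>M M)"
    by measurable
  from measurable_compose[OF this f]
  have "(\<lambda>(s,\<omega>). f s \<omega>) \<in> borel_measurable (restrict_space (L \<Otimes>\<^sub>M M) ?\<Omega>)" by simp
  then have "(\<lambda>x. indicator ?\<Omega> x *\<^sub>R (case x of (s,\<omega>) \<Rightarrow> f s \<omega>)) \<in> borel_measurable (L \<Otimes>\<^sub>M M)"
    using borel_measurable_restrict_space_iff[OF \<Omega>] by blast
  then show ?thesis
    by (rule measurable_cong[THEN iffD1, rotated]) (auto simp: space_pair_measure indicator_def)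
qed

context brownian_motion
begin

lemma nn_integral_pair_restrict:
  assumes "(\<lambda>(s,\<omega>). h s \<omega> :: ennreal) \<in> borel_measurable (strip A)" "A \<in> sets borel"
  shows "(\<integral>\<^sup>+(s,\<omega>). h s \<omega> \<partial>(strip A)) = (\<integral>\<^sup>+s. (\<integral>\<^sup>+\<omega>. h s \<omega> \<partial>M) * indicator A s \<partial>lborel)"
  using nn_integral_fst[OF assms(1)] assms(2) by (simp add: nn_integral_restrict_space)

lemma integral_process_measurable:
  fixes f :: "real \<Rightarrow> 'w \<Rightarrow> 'e::euclidean_space"
  assumes f: "joint {a..b} f"
  shows "(\<lambda>\<omega>. LINT s:{a..b}|lborel. f s \<omega>) \<in> borel_measurable M"
proof -
  have "(\<lambda>(s,\<omega>). indicator {a..b} s *\<^sub>R f s \<omega>) \<in> borel_measurable (lborel \<Otimes>\<^sub>M M)"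
    by (rule measurable_pair_extend[OF f]) simp
  then have "(\<lambda>(\<omega>,s). indicator {a..b} s *\<^sub>R f s \<omega>) \<in> borel_measurable (M \<Otimes>\<^sub>M lborel)"
    by (subst (asm) measurable_pair_swap_iff) (simp add: case_prod_unfold)
  then show ?thesis unfolding set_lebesgue_integral_def
    by (rule lborel.borel_measurable_lebesgue_integral)
qed

text \<open>Norms are integrated with values in \<open>ennreal\<close>, so no path needs to be known
  integrable beforehand. The third part is Cauchy-Schwarz in time, which produces the length
  \<open>b - a\<close>, followed by Tonelli.\<close>

lemma nn_integral_process_measurable:
  fixes f :: "real \<Rightarrow> 'w \<Rightarrow> 'e::euclidean_space"
  assumes f: "joint {a..b} f"
  shows "(\<lambda>\<omega>. tint a b (\<lambda>s. ennreal (norm (f s \<omega>)))) \<in> borel_measurable M"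
    and "\<omega> \<in> space M \<Longrightarrow> (\<lambda>s. ennreal (norm (f s \<omega>)) * indicator {a..b} s) \<in> borel_measurable lborel"
    and "(\<integral>\<^sup>+\<omega>. (tint a b (\<lambda>s. ennreal (norm (f s \<omega>))))\<^sup>2 \<partial>M)
       \<le> ennreal (b - a) * tint a b (\<lambda>s. sqint M (f s))"
proof -
  have "(\<lambda>(s,\<omega>). indicator {a..b} s *\<^sub>R f s \<omega>) \<in> borel_measurable (lborel \<Otimes>\<^sub>M M)"
    by (rule measurable_pair_extend[OF f]) simp
  then have "(\<lambda>x. ennreal (norm (case x of (s,\<omega>) \<Rightarrow> indicator {a..b} s *\<^sub>R f s \<omega>))) \<in> borel_measurable (lborel \<Otimes>\<^sub>M M)"
    by measurable
  also have "(\<lambda>x. ennreal (norm (case x of (s,\<omega>) \<Rightarrow> indicator {a..b} s *\<^sub>R f s \<omega>))) = (\<lambda>(s,\<omega>). ennreal (norm (f s \<omega>)) * indicator {a..b} s)"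
    by (auto simp: indicator_def)
  finally have m: "(\<lambda>(s,\<omega>). ennreal (norm (f s \<omega>)) * indicator {a..b} s) \<in> borel_measurable (lborel \<Otimes>\<^sub>M M)" .
  then have m': "(\<lambda>(\<omega>,s). ennreal (norm (f s \<omega>)) * indicator {a..b} s) \<in> borel_measurable (M \<Otimes>\<^sub>M lborel)"
    by (subst (asm) measurable_pair_swap_iff) (simp add: case_prod_unfold)
  then show m1: "(\<lambda>\<omega>. tint a b (\<lambda>s. ennreal (norm (f s \<omega>)))) \<in> borel_measurable M"
    by (rule lborel.borel_measurable_nn_integral)
  show ms: "(\<lambda>s. ennreal (norm (f s \<omega>)) * indicator {a..b} s) \<in> borel_measurable lborel" if "\<omega> \<in> space M" for \<omega>
    using measurable_compose_Pair1[OF that m'] by simp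
  have eq: "(ennreal (norm (f s \<omega>)) * indicator {a..b} s)\<^sup>2 = ennreal ((norm (f s \<omega>))\<^sup>2) * indicator {a..b} s" for s \<omega>
    by (auto simp: indicator_def ennreal_power)
  have "(\<integral>\<^sup>+\<omega>. (tint a b (\<lambda>s. ennreal (norm (f s \<omega>))))\<^sup>2 \<partial>M)
     \<le> (\<integral>\<^sup>+\<omega>. ennreal (b - a) * tint a b (\<lambda>s. ennreal ((norm (f s \<omega>))\<^sup>2)) \<partial>M)"
  proof (rule nn_integral_mono)
    fix \<omega> assume "\<omega> \<in> space M"
    note ms[OF this, measurable]
    \<comment> \<open>An indicator is its own square, so one copy can be split off as the second
      factor for Cauchy-Schwarz.\<close>
    have "(tint a b (\<lambda>s. ennreal (norm (f s \<omega>))))\<^sup>2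
      = (\<integral>\<^sup>+s. indicator {a..b} s * (ennreal (norm (f s \<omega>)) * indicator {a..b} s) \<partial>lborel)\<^sup>2"
      by (intro arg_cong[where f="\<lambda>x. x\<^sup>2"] nn_integral_cong) (auto simp: indicator_def)
    also have "\<dots> \<le> (\<integral>\<^sup>+s. (indicator {a..b} s)\<^sup>2 \<partial>lborel) * (\<integral>\<^sup>+s. (ennreal (norm (f s \<omega>)) * indicator {a..b} s)\<^sup>2 \<partial>lborel)"
      by (intro Cauchy_Schwarz_nn_integral) auto
    also have "(\<integral>\<^sup>+s. (indicator {a..b} s :: ennreal)\<^sup>2 \<partial>lborel) = (\<integral>\<^sup>+s. indicator {a..b} s \<partial>lborel)"
      by (intro nn_integral_cong) (auto simp: indicator_def)
    also have "\<dots> = ennreal (b - a)" by (cases "a \<le> b") (auto simp: ennreal_neg)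
    finally show "(tint a b (\<lambda>s. ennreal (norm (f s \<omega>))))\<^sup>2
       \<le> ennreal (b - a) * tint a b (\<lambda>s. ennreal ((norm (f s \<omega>))\<^sup>2))"
      by (simp only: eq)
  qed
  also have "\<dots> = ennreal (b - a) * (\<integral>\<^sup>+\<omega>. tint a b (\<lambda>s. ennreal ((norm (f s \<omega>))\<^sup>2)) \<partial>M)"
  proof (rule nn_integral_cmult)
    have "(\<lambda>(\<omega>,s). ennreal ((norm (f s \<omega>))\<^sup>2) * indicator {a..b} s) \<in> borel_measurable (M \<Otimes>\<^sub>M lborel)"
      using borel_measurable_times_ennreal[OF m' m'] by (simp add: case_prod_unfold eq flip: power2_eq_square)
    then show "(\<lambda>\<omega>. tint a b (\<lambda>s. ennreal ((norm (f s \<omega>))\<^sup>2))) \<in> borel_measurable M"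
      by (rule lborel.borel_measurable_nn_integral)
  qed
  also have "(\<integral>\<^sup>+\<omega>. tint a b (\<lambda>s. ennreal ((norm (f s \<omega>))\<^sup>2)) \<partial>M)
    = (\<integral>\<^sup>+s. (\<integral>\<^sup>+\<omega>. ennreal ((norm (f s \<omega>))\<^sup>2) * indicator {a..b} s \<partial>M) \<partial>lborel)"
  proof -
    interpret pair_sigma_finite lborel M ..
    have "(\<lambda>(s,\<omega>). ennreal ((norm (f s \<omega>))\<^sup>2) * indicator {a..b} s) \<in> borel_measurable (lborel \<Otimes>\<^sub>M M)"
      using borel_measurable_times_ennreal[OF m m] by (simp add: case_prod_unfold eq flip: power2_eq_square)
    from Fubini[OF this] show ?thesis by simp
  qed
  also have "\<dots> = tint a b (\<lambda>s. sqint M (f s))"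
    by (intro nn_integral_cong) (auto simp: indicator_def)
  finally show "(\<integral>\<^sup>+\<omega>. (tint a b (\<lambda>s. ennreal (norm (f s \<omega>))))\<^sup>2 \<partial>M)
       \<le> ennreal (b - a) * tint a b (\<lambda>s. sqint M (f s))" .
qed

text \<open>On a path that is not integrable the Bochner integral is 0 by convention, so the bound
  holds there as well and no exceptional set has to be excluded.\<close>

lemma norm_integral_process_le:
  fixes f :: "real \<Rightarrow> 'w \<Rightarrow> 'e::euclidean_space"
  shows "ennreal (norm (LINT s:{a..b}|lborel. f s \<omega>)) \<le> tint a b (\<lambda>s. ennreal (norm (f s \<omega>)))"
proof (cases "set_integrable lborel {a..b} (\<lambda>s. f s \<omega>)")
  case True
  then have "ennreal (norm (LINT s:{a..b}|lborel. f s \<omega>)) \<le> (\<integral>\<^sup>+s. norm (indicator {a..b} s *\<^sub>R f s \<omega>) \<partial>lborel)"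
    unfolding set_integrable_def set_lebesgue_integral_def by (rule integral_norm_bound_ennreal)
  also have "\<dots> = tint a b (\<lambda>s. ennreal (norm (f s \<omega>)))"
    by (intro nn_integral_cong) (auto simp: indicator_def)
  finally show ?thesis .
next
  case False
  then show ?thesis unfolding set_integrable_def set_lebesgue_integral_def
    by (simp add: not_integrable_integral_eq)
qed

text \<open>The cut at \<open>c\<close> gives the two pieces separate length factors. In the
  uniqueness proof the piece after \<open>c\<close> is already known to vanish, and the remaining
  one carries a small length.\<close>

lemma integral_process_sq_le:
  fixes f :: "real \<Rightarrow> 'w \<Rightarrow> 'e::euclidean_space"
  assumes f: "joint {a..b} f"
    and "a \<le> c" "c \<le> b"
  shows "sqint M (\<lambda>\<omega>. LINT s:{a..b}|lborel. f s \<omega>)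
    \<le> 2 * (ennreal (c - a) * tint a c (\<lambda>s. sqint M (f s)))
    + 2 * (ennreal (b - c) * tint c b (\<lambda>s. sqint M (f s)))"
proof -
  define N where "N x y \<omega> = tint x y (\<lambda>s. ennreal (norm (f s \<omega>)))" for x y \<omega>
  have f1: "joint {a..c} f"
   and f2: "joint {c..b} f"
    using assms by (auto intro!: measurable_pair_restrict_mono[OF f])
  have [measurable]: "N a c \<in> borel_measurable M" "N c b \<in> borel_measurable M"
    using nn_integral_process_measurable(1)[OF f1] nn_integral_process_measurable(1)[OF f2] by (simp_all add: N_def[abs_def])
  have "sqint M (\<lambda>\<omega>. LINT s:{a..b}|lborel. f s \<omega>) \<le> (\<integral>\<^sup>+\<omega>. 2 * (N a c \<omega>)\<^sup>2 + 2 * (N c b \<omega>)\<^sup>2 \<partial>M)"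
  proof (rule nn_integral_mono)
    fix \<omega> assume \<omega>: "\<omega> \<in> space M"
    have "N a b \<omega> \<le> (\<integral>\<^sup>+s. ennreal (norm (f s \<omega>)) * indicator {a..c} s + ennreal (norm (f s \<omega>)) * indicator {c..b} s \<partial>lborel)"
      unfolding N_def by (intro nn_integral_mono) (auto simp: indicator_def)
    also have "\<dots> = N a c \<omega> + N c b \<omega>" unfolding N_def
      by (intro nn_integral_add nn_integral_process_measurable(2)[OF f1 \<omega>] nn_integral_process_measurable(2)[OF f2 \<omega>])
    finally have N: "N a b \<omega> \<le> N a c \<omega> + N c b \<omega>" .
    have "ennreal ((norm (LINT s:{a..b}|lborel. f s \<omega>))\<^sup>2) = (ennreal (norm (LINT s:{a..b}|lborel. f s \<omega>)))\<^sup>2"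
      by (simp add: ennreal_power)
    also have "\<dots> \<le> (N a c \<omega> + N c b \<omega>)\<^sup>2"
      using N norm_integral_process_le[of a b f \<omega>] unfolding N_def[of a b] by (intro power_mono) (auto intro: order_trans)
    also have "\<dots> \<le> 2 * (N a c \<omega>)\<^sup>2 + 2 * (N c b \<omega>)\<^sup>2" by (rule ennreal_sq_add_le)
    finally show "ennreal ((norm (LINT s:{a..b}|lborel. f s \<omega>))\<^sup>2) \<le> 2 * (N a c \<omega>)\<^sup>2 + 2 * (N c b \<omega>)\<^sup>2" .
  qed
  also have "\<dots> = 2 * (\<integral>\<^sup>+\<omega>. (N a c \<omega>)\<^sup>2 \<partial>M) + 2 * (\<integral>\<^sup>+\<omega>. (N c b \<omega>)\<^sup>2 \<partial>M)"
    by (simp add: nn_integral_add nn_integral_cmult)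
  also have "\<dots> \<le> 2 * (ennreal (c - a) * tint a c (\<lambda>s. sqint M (f s)))
    + 2 * (ennreal (b - c) * tint c b (\<lambda>s. sqint M (f s)))"
    unfolding N_def using nn_integral_process_measurable(3)[OF f1] nn_integral_process_measurable(3)[OF f2]
    by (intro add_mono mult_left_mono) auto
  finally show ?thesis .
qed

section \<open>Uniqueness for the homogeneous backward equation\<close>

lemma L2_adaptedD:
  fixes X :: "real \<Rightarrow> 'w \<Rightarrow> 'e::euclidean_space"
  assumes X: "X \<in> L2a"
  shows L2_adapted_joint: "joint {0..T} X"
    and L2_adapted_F: "t \<in> {0..T} \<Longrightarrow> X t \<in> borel_measurable (F t)"
    and L2_adapted_M: "t \<in> {0..T} \<Longrightarrow> X t \<in> borel_measurable M"
    and L2_adapted_second_moment_measurable: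
      "(\<lambda>s. sqint M (X s) * indicator {0..T} s) \<in> borel_measurable lborel"
    and L2_adapted_finite: "tint 0 T (\<lambda>s. sqint M (X s)) < \<infinity>"
proof -
  show j: "joint {0..T} X"
    and F: "t \<in> {0..T} \<Longrightarrow> X t \<in> borel_measurable (F t)" for t
    using X by (auto simp: L2_adapted_def)
  show "t \<in> {0..T} \<Longrightarrow> X t \<in> borel_measurable M"
    using measurable_F_imp[OF F] by auto
  have j2: "(\<lambda>(t,\<omega>). ennreal ((norm (X t \<omega>))\<^sup>2)) \<in> borel_measurable (strip {0..T})"
    using j unfolding case_prod_unfold by measurable
  have "(\<lambda>s. sqint M (X s)) \<in> borel_measurable (restrict_space lborel {0..T})"
    by (rule borel_measurable_nn_integral[OF j2])
  then show "(\<lambda>s. sqint M (X s) * indicator {0..T} s) \<in> borel_measurable lborel"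
    by (subst (asm) borel_measurable_restrict_space_iff_ennreal) auto
  have "integrable (strip {0..T}) (\<lambda>(t, \<omega>). (norm (X t \<omega>))\<^sup>2)"
    using X by (simp add: L2_adapted_def)
  then have "sqint2 (strip {0..T}) X < \<infinity>"
    by (simp add: integrable_iff_bounded case_prod_unfold)
  then show "tint 0 T (\<lambda>s. sqint M (X s)) < \<infinity>"
    using nn_integral_pair_restrict[OF j2] by simp
qed

text \<open>Let \<open>\<Gamma> a b\<close> be the total energy of \<open>y\<close> and
  \<open>v\<close> on \<open>{a..b}\<close>. The estimate \<open>main\<close> bounds both
  \<open>\<phi> t\<close> and the energy of \<open>v\<close> after \<open>t\<close>. Integrating the
  first bound over a short interval and using the second at its left end gives
  \<open>\<Gamma> \<le> \<Gamma> / 2\<close> there, once the energy after the interval is known to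
  be zero. The vanishing thus spreads backwards from \<open>T\<close>.\<close>

lemma homogeneous_backward_eq_zero:
  fixes y f :: "real \<Rightarrow> 'w \<Rightarrow> real^'d" and v :: "real \<Rightarrow> 'w \<Rightarrow> real^'m^'d"
  assumes T: "0 \<le> T" and y: "y \<in> L2a"
    and vj: "joint {0..T} v"
    and vfin: "tint 0 T (\<lambda>s. sqint M (v s)) < \<infinity>"
    and fj: "joint {0..T} f"
    and fb: "\<And>t \<omega>. (norm (f t \<omega>))\<^sup>2 \<le> C * ((norm (y t \<omega>))\<^sup>2 + (norm (v t \<omega>))\<^sup>2)" and C: "0 \<le> C"
    and eq: "\<And>t. t \<in> {0..T} \<Longrightarrow> \<exists>I. ito t T v I \<and>
       (AE \<omega> in M. y t \<omega> + I \<omega> = (LINT s:{t..T}|lborel. f s \<omega>))"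
  shows "AE \<omega> in M. y 0 \<omega> = 0"
proof -
  define \<phi> where "\<phi> s = sqint M (y s)" for s
  define \<psi> where "\<psi> s = sqint M (v s)" for s
  have vj2: "(\<lambda>(t,\<omega>). ennreal ((norm (v t \<omega>))\<^sup>2)) \<in> borel_measurable (strip {0..T})"
    using vj unfolding case_prod_unfold by measurable
  have "\<psi> \<in> borel_measurable (restrict_space lborel {0..T})"
    unfolding \<psi>_def by (rule borel_measurable_nn_integral[OF vj2])
  then have \<psi>m0: "(\<lambda>s. \<psi> s * indicator {0..T} s) \<in> borel_measurable lborel"
    by (subst (asm) borel_measurable_restrict_space_iff_ennreal) auto
  have \<phi>m0: "(\<lambda>s. \<phi> s * indicator {0..T} s) \<in> borel_measurable lborel"
    unfolding \<phi>_def by (rule L2_adapted_second_moment_measurable[OF y])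
  have meas: "(\<lambda>s. g s * indicator {a..b} s) \<in> borel_measurable lborel"
    if "(\<lambda>s. g s * indicator {0..T} s) \<in> borel_measurable lborel" "0 \<le> a" "b \<le> T" for g :: "real \<Rightarrow> ennreal" and a b
  proof -
    have "(\<lambda>s. g s * indicator {a..b} s) = (\<lambda>s. (g s * indicator {0..T} s) * indicator {a..b} s)"
      using that by (auto simp: indicator_def fun_eq_iff)
    also have "\<dots> \<in> borel_measurable lborel" by (intro borel_measurable_times_ennreal that) auto
    finally show ?thesis .
  qed
  define \<Phi> where "\<Phi> a b = tint a b \<phi>" for a b
  define \<Psi> where "\<Psi> a b = tint a b \<psi>" for a b
  define \<Gamma> where "\<Gamma> a b = \<Phi> a b + \<Psi> a b" for a b
  have \<Gamma>fin: "\<Gamma> 0 T < \<infinity>"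
    using L2_adapted_finite[OF y] vfin unfolding \<Gamma>_def \<Phi>_def \<phi>_def \<Psi>_def \<psi>_def by simp
  have mono0: "tint a b g \<le> tint a' b' g"
    if "a' \<le> a" "b \<le> b'" for g :: "real \<Rightarrow> ennreal" and a b a' b'
    using that by (intro nn_integral_mono) (auto simp: indicator_def)
  have mono: "\<Gamma> a b \<le> \<Gamma> a' b'" "\<Phi> a b \<le> \<Phi> a' b'" "\<Psi> a b \<le> \<Psi> a' b'" if "a' \<le> a" "b \<le> b'" for a b a' b'
    unfolding \<Gamma>_def \<Phi>_def \<Psi>_def using that by (intro add_mono mono0; simp)+
  have sub0: "tint a b g \<le> tint a c g + tint c b g"
    if "(\<lambda>s. g s * indicator {0..T} s) \<in> borel_measurable lborel" "0 \<le> a" "a \<le> c" "c \<le> b" "b \<le> T" for g :: "real \<Rightarrow> ennreal" and a b c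
  proof -
    have "tint a b g \<le> (\<integral>\<^sup>+s. g s * indicator {a..c} s + g s * indicator {c..b} s \<partial>lborel)"
      by (intro nn_integral_mono) (auto simp: indicator_def)
    also have "\<dots> = tint a c g + tint c b g"
      using that(2-) by (intro nn_integral_add meas[OF that(1)]) auto
    finally show ?thesis .
  qed
  have sub: "\<Gamma> a b \<le> \<Gamma> a c + \<Gamma> c b" if "0 \<le> a" "a \<le> c" "c \<le> b" "b \<le> T" for a b c
  proof -
    have "\<Gamma> a b \<le> (\<Phi> a c + \<Phi> c b) + (\<Psi> a c + \<Psi> c b)"
      unfolding \<Gamma>_def \<Phi>_def \<Psi>_def using that by (intro add_mono sub0 \<phi>m0 \<psi>m0) auto
    then show ?thesis by (simp add: \<Gamma>_def add_ac)
  qed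
  have fB: "tint a b (\<lambda>s. sqint M (f s)) \<le> C * \<Gamma> a b"
    if ab: "0 \<le> a" "b \<le> T" for a b
  proof -
    have *: "sqint M (f s) \<le> C * (\<phi> s + \<psi> s)" if s: "s \<in> {0..T}" for s
    proof -
      have [measurable]: "y s \<in> borel_measurable M" by (rule L2_adapted_M[OF y s])
      have [measurable]: "v s \<in> borel_measurable M"
        using measurable_compose_Pair1[OF _ vj, of s] s by (simp add: space_restrict_space)
      have "sqint M (f s) \<le> (\<integral>\<^sup>+\<omega>. C * (ennreal ((norm (y s \<omega>))\<^sup>2) + ennreal ((norm (v s \<omega>))\<^sup>2)) \<partial>M)"
      proof (rule nn_integral_mono)
        fix \<omega>
        have "ennreal ((norm (f s \<omega>))\<^sup>2) \<le> ennreal (C * ((norm (y s \<omega>))\<^sup>2 + (norm (v s \<omega>))\<^sup>2))" by (rule ennreal_leI[OF fb])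
        then show "ennreal ((norm (f s \<omega>))\<^sup>2) \<le> C * (ennreal ((norm (y s \<omega>))\<^sup>2) + ennreal ((norm (v s \<omega>))\<^sup>2))"
          using C by (simp add: ennreal_mult)
      qed
      also have "\<dots> = C * (\<phi> s + \<psi> s)" unfolding \<phi>_def \<psi>_def
        by (simp add: nn_integral_cmult nn_integral_add)
      finally show ?thesis .
    qed
    have "tint a b (\<lambda>s. sqint M (f s))
       \<le> (\<integral>\<^sup>+s. C * (\<phi> s * indicator {a..b} s + \<psi> s * indicator {a..b} s) \<partial>lborel)"
      using * ab by (intro nn_integral_mono) (auto simp: indicator_def)
    also have "\<dots> = C * \<Gamma> a b" unfolding \<Gamma>_def \<Phi>_def \<Psi>_def
      using meas[OF \<phi>m0 ab] meas[OF \<psi>m0 ab] by (simp add: nn_integral_cmult nn_integral_add)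
    finally show ?thesis .
  qed
  have main: "\<phi> t + \<Psi> t T \<le> 4 * (2 * (ennreal (c - t) * (C * \<Gamma> t c)) + 2 * (ennreal (T - c) * (C * \<Gamma> c T)))"
    if t: "0 \<le> t" "t \<le> c" "c \<le> T" for t c
  proof -
    have t': "t \<in> {0..T}" using t by auto
    obtain I where ito: "ito t T v I"
      and ae: "AE \<omega> in M. y t \<omega> + I \<omega> = (LINT s:{t..T}|lborel. f s \<omega>)" using eq[OF t'] by blast
    have I[measurable]: "I \<in> borel_measurable M" and I2: "sq_integrable I"
      using ito_integral_L2[OF ito] t by auto
    have ft: "joint {t..T} f"
      by (rule measurable_pair_restrict_mono[OF fj]) (use t in auto)
    have vt: "joint {t..T} v"
      by (rule measurable_pair_restrict_mono[OF vj]) (use t in auto)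
    have vt2: "(\<lambda>(t,\<omega>). ennreal ((norm (v t \<omega>))\<^sup>2)) \<in> borel_measurable (strip {t..T})"
      by (rule measurable_pair_restrict_mono[OF vj2]) (use t in auto)
    have yM[measurable]: "y t \<in> borel_measurable M" by (rule L2_adapted_M[OF y t'])
    let ?J = "\<lambda>\<omega>. LINT s:{t..T}|lborel. f s \<omega>"
    have Jm[measurable]: "?J \<in> borel_measurable M" by (rule integral_process_measurable[OF ft])
    have J: "sqint M ?J \<le> 2 * (ennreal (d - t) * (C * \<Gamma> t d)) + 2 * (ennreal (T - d) * (C * \<Gamma> d T))"
      if "t \<le> d" "d \<le> T" for d
      by (rule order_trans[OF integral_process_sq_le[OF ft that]]) (use t that in \<open>intro add_mono mult_left_mono fB; simp\<close>)
    have "sqint M ?J \<le> 2 * (ennreal (T - t) * (C * \<Gamma> t T))"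
      using J[of T] t by simp
    also have "\<dots> < \<infinity>"
      using le_less_trans[OF mono(1)[of 0 t T T] \<Gamma>fin] t by (simp add: ennreal_mult_less_top)
    finally have Jfin: "sqint M ?J < \<infinity>" .
    \<comment> \<open>Membership in \<open>L2a\<close> bounds the second moment of
      \<open>y t\<close> only for almost every \<open>t\<close>. For the given \<open>t\<close> it
      follows from the equation, as \<open>y t\<close> is a difference of two square-integrable
      terms.\<close>
    have "\<phi> t = sqint M (\<lambda>\<omega>. ?J \<omega> + - I \<omega>)"
      unfolding \<phi>_def using ae by (intro nn_integral_cong_AE) (auto elim!: eventually_mono simp: eq_diff_eq[symmetric])
    also have "\<dots> \<le> 2 * sqint M ?J + 2 * sqint M (\<lambda>\<omega>. - I \<omega>)"
      by (rule nn_integral_norm_sq_add_le) measurable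
    also have "\<dots> < \<infinity>" using Jfin I2 integrable_norm_sq_iff[OF I] by (simp add: ennreal_mult_less_top)
    finally have yint: "sq_integrable (\<lambda>\<omega>. y t \<omega>)"
      using integrable_norm_sq_iff[OF yM] by (simp add: \<phi>_def)
    have "\<phi> t + \<Psi> t T = sqint M (y t) +
        sqint2 (strip {t..T}) v"
      unfolding \<phi>_def \<Psi>_def \<psi>_def using nn_integral_pair_restrict[OF vt2] by simp
    also have "\<dots> \<le> 4 * sqint M (\<lambda>\<omega>. y t \<omega> + I \<omega>)"
      by (rule ito_pythagoras[OF ito _ _ vt L2_adapted_F[OF y t'] yint]) (use t in auto)
    also have "sqint M (\<lambda>\<omega>. y t \<omega> + I \<omega>) = sqint M ?J"
      using ae by (intro nn_integral_cong_AE) (auto elim!: eventually_mono)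
    finally show ?thesis by (rule order_trans[OF _ mult_left_mono[OF J[OF t(2,3)]]]) simp
  qed
  \<comment> \<open>Since \<open>\<delta> C \<le> 1/32\<close> and
    \<open>1 + \<delta> \<le> 2\<close>, the contraction factor
    \<open>8 \<delta> C (1 + \<delta>)\<close> is at most \<open>8 * (1/32) * 2 = 1/2\<close>.
    Dividing by \<open>C + 1\<close> instead of \<open>C\<close> covers the case
    \<open>C = 0\<close>.\<close>
  define \<delta> where "\<delta> = min 1 (1 / (32 * (C + 1)))"
  have \<delta>: "0 < \<delta>" "\<delta> \<le> 1" "8 * \<delta> * C * (1 + \<delta>) \<le> 1 / 2"
  proof -
    show p: "0 < \<delta>" "\<delta> \<le> 1" using C by (auto simp: \<delta>_def)
    have "\<delta> * C \<le> \<delta> * (C + 1)" using p by simp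
    also have "\<dots> \<le> 1 / (32 * (C + 1)) * (C + 1)" using C by (intro mult_right_mono) (auto simp: \<delta>_def)
    also have "\<dots> = 1 / 32" using C by simp
    finally have "8 * (\<delta> * C) * (1 + \<delta>) \<le> 8 * (1 / 32) * 2" using p C by (intro mult_mono) auto
    then show "8 * \<delta> * C * (1 + \<delta>) \<le> 1 / 2" by (simp add: mult.assoc)
  qed
  have step: "\<Gamma> a T = 0" if c: "\<Gamma> c T = 0" "0 \<le> a" "a \<le> c" "c \<le> T" "c - a \<le> \<delta>" for a c
  proof -
    \<comment> \<open>The factor 8 is \<open>4 * 2\<close>: the 4 of the isometry estimate times the
      2 of the split time integral. The piece after \<open>c\<close> is gone because
      \<open>\<Gamma> c T = 0\<close>.\<close>
    define K where "K = ennreal (8 * \<delta> * C) * \<Gamma> a c"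
    have K: "\<phi> t + \<Psi> t T \<le> K" if t: "a \<le> t" "t \<le> c" for t
    proof -
      have "\<phi> t + \<Psi> t T \<le> 4 * (2 * (ennreal (c - t) * (C * \<Gamma> t c)))"
        using main[of t c] c t by simp
      also have "\<dots> \<le> 4 * (2 * (ennreal \<delta> * (C * \<Gamma> a c)))"
        using t c by (intro mult_mono mult_left_mono mono) (auto simp: ennreal_leI)
      also have "\<dots> = K" unfolding K_def using \<delta> C by (simp add: ennreal_mult mult.assoc[symmetric])
      finally show ?thesis .
    qed
    have "\<Phi> a c \<le> tint a c (\<lambda>s. K)" unfolding \<Phi>_def
    proof (rule nn_integral_mono)
      fix s show "\<phi> s * indicator {a..c} s \<le> K * indicator {a..c} s"
        using K[of s] order_trans[OF _ K[of s], of "\<phi> s"] by (auto simp: indicator_def)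
    qed
    also have "\<dots> = K * ennreal (c - a)" using c by (simp add: nn_integral_cmult)
    also have "\<dots> \<le> K * ennreal \<delta>" using c by (intro mult_left_mono ennreal_leI) auto
    finally have 1: "\<Phi> a c \<le> K * ennreal \<delta>" .
    have "\<Psi> a c \<le> \<Psi> a T" using c by (intro mono) auto
    also have "\<dots> \<le> \<phi> a + \<Psi> a T" by simp
    also have "\<dots> \<le> K" using K[of a] c by simp
    finally have "\<Gamma> a c \<le> K * ennreal \<delta> + K" unfolding \<Gamma>_def using 1 by (rule add_mono[rotated])
    also have "\<dots> = ennreal (8 * \<delta> * C * (1 + \<delta>)) * \<Gamma> a c"
      unfolding K_def using \<delta> C by (simp add: ennreal_mult distrib_left mult_ac)
    also have "\<dots> \<le> ennreal (1/2) * \<Gamma> a c" by (intro mult_right_mono ennreal_leI \<delta>) auto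
    finally have le: "\<Gamma> a c \<le> ennreal (1/2) * \<Gamma> a c" .
    \<comment> \<open>Finiteness is essential here: \<open>\<infinity>\<close> also satisfies the
      inequality \<open>le\<close>.\<close>
    have "\<Gamma> a c < \<infinity>" using le_less_trans[OF mono(1)[of 0 a c T] \<Gamma>fin] c by simp
    then obtain g where g: "\<Gamma> a c = ennreal g" "0 \<le> g" by (cases "\<Gamma> a c") auto
    have "ennreal g \<le> ennreal (1 / 2 * g)" using le unfolding g(1) using g(2) by (subst ennreal_mult) auto
    then have "g \<le> 1 / 2 * g" using g(2) by (subst (asm) ennreal_le_iff) auto
    then have "\<Gamma> a c = 0" using g by simp
    then show ?thesis using sub[of a c T] c by simp
  qed
  \<comment> \<open>The truncation at 0 accounts for the last step, which may be shorter than
    \<open>\<delta>\<close>.\<close>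
  have "\<Gamma> (max 0 (T - real n * \<delta>)) T = 0" for n
  proof (induction n)
    case 0
    have "\<Gamma> T T = 0"
    proof -
      have "tint T T g = 0" for g :: "real \<Rightarrow> ennreal"
      proof -
        have "AE s in lborel. s \<noteq> T" by (rule AE_lborel_singleton)
        then have "tint T T g = (\<integral>\<^sup>+(s::real). 0 \<partial>lborel)"
          by (intro nn_integral_cong_AE) (auto elim!: eventually_mono)
        then show ?thesis by simp
      qed
      then show ?thesis by (simp add: \<Gamma>_def \<Phi>_def \<Psi>_def)
    qed
    then show ?case using T by simp
  next
    case (Suc n)
    show ?case
      by (rule step[OF Suc]) (use T \<delta> in \<open>auto simp: algebra_simps max_def\<close>)
  qed
  moreover obtain n where "T / \<delta> < real n" using reals_Archimedean2 by blast
  then have "max 0 (T - real n * \<delta>) = 0" using \<delta> by (simp add: field_simps)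
  ultimately have "\<Gamma> 0 T = 0" by metis
  \<comment> \<open>With \<open>t = c = 0\<close> both terms on the right of \<open>main\<close>
    vanish. This reaches the value at time 0 itself, whereas a vanishing energy says nothing about a
    single time.\<close>
  then have "\<phi> 0 = 0" using main[of 0 0] T by simp
  then have "AE \<omega> in M. ennreal ((norm (y 0 \<omega>))\<^sup>2) = 0"
    unfolding \<phi>_def using L2_adapted_M[OF y, of 0] T by (subst (asm) nn_integral_0_iff_AE) auto
  then show ?thesis by simp
qed

end

section \<open>Additivity of the Ito integral\<close>

lemma borel_measurable_matrix_mult [measurable (raw)]:
  fixes f :: "'a \<Rightarrow> real^'n^'k" and g :: "'a \<Rightarrow> real^'l^'n"
  assumes [measurable]: "f \<in> borel_measurable N" "g \<in> borel_measurable N"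
  shows "(\<lambda>x. f x ** g x) \<in> borel_measurable N"
  unfolding matrix_matrix_mult_def by measurable

lemma bounded_linear_matrix_mult_left: "bounded_linear (\<lambda>X :: real^'l^'n. (Q :: real^'n^'k) ** X)"
  unfolding linear_conv_bounded_linear[symmetric]
  by (rule linearI) (simp_all add: matrix_add_ldistrib matrix_scalar_ac scalar_matrix_assoc)

lemma simple_process_0: "simple_process 0 p \<xi> t \<omega> = 0"
  by (simp add: simple_process_def)

lemma simple_process_Suc:
  "simple_process (Suc n) p \<xi> t \<omega> = simple_process n p \<xi> t \<omega> + indicator {p n<..p (Suc n)} t *\<^sub>R \<xi> n \<omega>"
  by (simp only: simple_process_def sum.lessThan_Suc)

lemma simple_process_cong:
  assumes "\<And>k. k \<le> n \<Longrightarrow> p k = p' k" "\<And>k. k < n \<Longrightarrow> \<xi> k = \<xi>' k"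
  shows "simple_process n p \<xi> t \<omega> = simple_process n p' \<xi>' t \<omega>"
  unfolding simple_process_def using assms by (intro sum.cong) auto

lemma simple_integral_0: "simple_integral Z 0 p \<xi> \<omega> = 0"
  by (simp add: simple_integral_def)

lemma simple_integral_Suc:
  "simple_integral Z (Suc n) p \<xi> \<omega> = simple_integral Z n p \<xi> \<omega> + \<xi> n \<omega> *v (Z (p (Suc n)) \<omega> - Z (p n) \<omega>)"
  by (simp only: simple_integral_def sum.lessThan_Suc)

lemma simple_integral_cong:
  assumes "\<And>k. k \<le> n \<Longrightarrow> p k = p' k" "\<And>k. k < n \<Longrightarrow> \<xi> k = \<xi>' k"
  shows "simple_integral Z n p \<xi> \<omega> = simple_integral Z n p' \<xi>' \<omega>"
  unfolding simple_integral_def using assms by (intro sum.cong) auto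

context brownian_motion
begin

text \<open>A simple process together with its integral, built by appending steps. In this form pairs can
  be split at a point and added without handling common refinements of partitions.\<close>

inductive simple_pair :: "real \<Rightarrow> real \<Rightarrow> (real \<Rightarrow> 'w \<Rightarrow> real^'m^'d) \<Rightarrow> ('w \<Rightarrow> real^'d) \<Rightarrow> bool"
  for a :: real where
  nil: "simple_pair a a (\<lambda>_ _. 0) (\<lambda>_. 0)"
| snoc: "simple_pair a b \<Phi> J \<Longrightarrow> b \<le> c \<Longrightarrow> \<zeta> \<in> borel_measurable (F b) \<Longrightarrow>
    sq_integrable \<zeta> \<Longrightarrow>
    simple_pair a c (\<lambda>t \<omega>. \<Phi> t \<omega> + indicator {b<..c} t *\<^sub>R \<zeta> \<omega>) (\<lambda>\<omega>. J \<omega> + \<zeta> \<omega> *v (Z c \<omega> - Z b \<omega>))"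

lemma simple_pair_cong:
  assumes "simple_pair a b \<Phi> J" "\<And>t \<omega>. \<Phi> t \<omega> = \<Phi>' t \<omega>" "\<And>\<omega>. J \<omega> = J' \<omega>"
  shows "simple_pair a b \<Phi>' J'"
proof -
  have "\<Phi> = \<Phi>'" "J = J'" using assms(2,3) by (auto simp: fun_eq_iff)
  then show ?thesis using assms(1) by simp
qed

lemma simple_pair_le: "simple_pair a b \<Phi> J \<Longrightarrow> a \<le> b"
  by (induction rule: simple_pair.induct) auto

lemma simple_pair_support: "simple_pair a b \<Phi> J \<Longrightarrow> t \<notin> {a<..b} \<Longrightarrow> \<Phi> t \<omega> = 0"
proof (induction rule: simple_pair.induct)
  case (snoc b \<Phi> J c \<zeta>)
  have "a \<le> b" using snoc(1) by (rule simple_pair_le)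
  then show ?case using snoc by (auto simp: indicator_def)
qed simp

lemma simple_data_imp_simple_pair:
  assumes "simple_data M Z a b n p \<xi>"
  shows "simple_pair a b (simple_process n p \<xi>) (simple_integral Z n p \<xi>)"
proof -
  have "simple_pair a (p k) (simple_process k p \<xi>) (simple_integral Z k p \<xi>)" if "k \<le> n" for k
    using that
  proof (induction k)
    case 0
    have "p 0 = a" using assms by (simp add: simple_data_def)
    then show ?case using simple_pair.nil by (auto intro: simple_pair_cong simp: simple_process_0 simple_integral_0)
  next
    case (Suc k)
    then have "simple_pair a (p k) (simple_process k p \<xi>) (simple_integral Z k p \<xi>)" by simp
    from simple_pair.snoc[OF this, of "p (Suc k)" "\<xi> k"] show ?case
      using assms Suc.prems by (auto intro!: simple_pair_cong simp: simple_data_def simple_process_Suc simple_integral_Suc)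
  qed
  from this[of n] show ?thesis using assms by (simp add: simple_data_def)
qed

lemma simple_pair_imp_simple_data:
  assumes "simple_pair a b \<Phi> J"
  shows "\<exists>n p \<xi>. simple_data M Z a b n p \<xi> \<and> \<Phi> = simple_process n p \<xi> \<and> J = simple_integral Z n p \<xi>"
  using assms
proof (induction rule: simple_pair.induct)
  case nil
  show ?case
    by (rule exI[of _ 0], rule exI[of _ "\<lambda>_. a"])
       (simp add: simple_data_def fun_eq_iff simple_process_0 simple_integral_0)
next
  case (snoc b \<Phi> J c \<zeta>)
  then obtain n p \<xi> where d: "simple_data M Z a b n p \<xi>" "\<Phi> = simple_process n p \<xi>" "J = simple_integral Z n p \<xi>"
    by blast
  let ?p = "p(Suc n := c)" and ?\<xi> = "\<xi>(n := \<zeta>)"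
  have "simple_data M Z a c (Suc n) ?p ?\<xi>"
    using d(1) snoc by (auto simp: simple_data_def less_Suc_eq)
  moreover have "simple_process (Suc n) ?p ?\<xi> = (\<lambda>t \<omega>. \<Phi> t \<omega> + indicator {b<..c} t *\<^sub>R \<zeta> \<omega>)"
    using d simple_process_cong[of n ?p p ?\<xi> \<xi>] by (simp add: fun_eq_iff simple_process_Suc simple_data_def)
  moreover have "simple_integral Z (Suc n) ?p ?\<xi> = (\<lambda>\<omega>. J \<omega> + \<zeta> \<omega> *v (Z c \<omega> - Z b \<omega>))"
    using d simple_integral_cong[of n ?p p ?\<xi> \<xi>] by (simp add: fun_eq_iff simple_integral_Suc simple_data_def)
  ultimately show ?case by metis
qed

lemma simple_pair_measurable:
  assumes "simple_pair a b \<Phi> J" "0 \<le> a" "b \<le> T"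
  shows "(\<lambda>(t,\<omega>). \<Phi> t \<omega>) \<in> borel_measurable (strip A)" "J \<in> borel_measurable M"
proof -
  from simple_pair_imp_simple_data[OF assms(1)] obtain n p \<xi> where
    d: "simple_data M Z a b n p \<xi>" "\<Phi> = simple_process n p \<xi>" "J = simple_integral Z n p \<xi>" by blast
  show "(\<lambda>(t,\<omega>). \<Phi> t \<omega>) \<in> borel_measurable (strip A)" "J \<in> borel_measurable M"
    using simple_process_measurable[OF d(1) assms(2,3)] simple_integral_measurable[OF d(1) assms(2,3)] d by auto
qed

lemma simple_pair_concat:
  assumes "simple_pair b c \<Phi>' J'" "simple_pair a b \<Phi> J"
  shows "simple_pair a c (\<lambda>t \<omega>. \<Phi> t \<omega> + \<Phi>' t \<omega>) (\<lambda>\<omega>. J \<omega> + J' \<omega>)"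
  using assms
proof (induction rule: simple_pair.induct)
  case (snoc c \<Phi>' J' d \<zeta>)
  have "simple_pair a c (\<lambda>t \<omega>. \<Phi> t \<omega> + \<Phi>' t \<omega>) (\<lambda>\<omega>. J \<omega> + J' \<omega>)" using snoc by blast
  from simple_pair.snoc[OF this snoc(2-4)] show ?case
    by (rule simple_pair_cong) (simp_all add: add.assoc)
qed simp

lemma simple_pair_zero: "a \<le> b \<Longrightarrow> simple_pair a b (\<lambda>_ _. 0) (\<lambda>_. 0)"
  using simple_pair.snoc[OF simple_pair.nil, of a b "\<lambda>_. 0"] by simp

lemma simple_pair_extend:
  assumes "simple_pair a b \<Phi> J" "a' \<le> a" "b \<le> b'"
  shows "simple_pair a' b' \<Phi> J"
  using simple_pair_concat[OF simple_pair_zero[OF assms(3)] simple_pair_concat[OF assms(1) simple_pair_zero[OF assms(2)]]]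
  by simp

text \<open>Only a cut beyond the start of the last step needs work: its value
  \<open>\<zeta>\<close> is then used on both sides, which is allowed because what is known at
  \<open>b\<close> is known at the later time \<open>c\<close>.\<close>

lemma simple_pair_split:
  assumes "simple_pair a b \<Phi> J" "a \<le> c" "c \<le> b"
  shows "\<exists>\<Phi>1 J1 \<Phi>2 J2. simple_pair a c \<Phi>1 J1 \<and> simple_pair c b \<Phi>2 J2 \<and>
    \<Phi> = (\<lambda>t \<omega>. \<Phi>1 t \<omega> + \<Phi>2 t \<omega>) \<and> J = (\<lambda>\<omega>. J1 \<omega> + J2 \<omega>)"
  using assms
proof (induction rule: simple_pair.induct)
  case nil
  then have "c = a" by simp
  then show ?case using simple_pair.nil[of a] by (intro exI[of _ "\<lambda>_ _. 0"] exI[of _ "\<lambda>_. 0"]) auto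
next
  case (snoc b \<Phi> J d \<zeta>)
  show ?case
  proof (cases "c \<le> b")
    case True
    then obtain \<Phi>1 J1 \<Phi>2 J2 where s: "simple_pair a c \<Phi>1 J1" "simple_pair c b \<Phi>2 J2"
      "\<Phi> = (\<lambda>t \<omega>. \<Phi>1 t \<omega> + \<Phi>2 t \<omega>)" "J = (\<lambda>\<omega>. J1 \<omega> + J2 \<omega>)" using snoc by blast
    show ?thesis using s(1) simple_pair.snoc[OF s(2) snoc(2-4)] s(3,4)
      by (intro exI[of _ \<Phi>1] exI[of _ J1] exI[of _ "\<lambda>t \<omega>. \<Phi>2 t \<omega> + indicator {b<..d} t *\<^sub>R \<zeta> \<omega>"]
           exI[of _ "\<lambda>\<omega>. J2 \<omega> + \<zeta> \<omega> *v (Z d \<omega> - Z b \<omega>)"]) (auto simp: add.assoc)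
  next
    case False
    then have bc: "b \<le> c" by simp
    have \<zeta>c: "\<zeta> \<in> borel_measurable (F c)" using snoc(3) bc by (rule measurable_F_mono)
    have 1: "simple_pair a c (\<lambda>t \<omega>. \<Phi> t \<omega> + indicator {b<..c} t *\<^sub>R \<zeta> \<omega>) (\<lambda>\<omega>. J \<omega> + \<zeta> \<omega> *v (Z c \<omega> - Z b \<omega>))"
      by (rule simple_pair.snoc[OF snoc(1) bc snoc(3,4)])
    have 2: "simple_pair c d (\<lambda>t \<omega>. 0 + indicator {c<..d} t *\<^sub>R \<zeta> \<omega>) (\<lambda>\<omega>. 0 + \<zeta> \<omega> *v (Z d \<omega> - Z c \<omega>))"
      by (rule simple_pair.snoc[OF simple_pair.nil _ \<zeta>c snoc(4)]) (use snoc in simp)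
    have "indicator {b<..d} t *\<^sub>R \<zeta> \<omega> = indicator {b<..c} t *\<^sub>R \<zeta> \<omega> + indicator {c<..d} t *\<^sub>R \<zeta> \<omega>" for t \<omega>
      using bc snoc(7) by (auto simp: indicator_def)
    moreover have "\<zeta> \<omega> *v (Z d \<omega> - Z b \<omega>) = \<zeta> \<omega> *v (Z c \<omega> - Z b \<omega>) + \<zeta> \<omega> *v (Z d \<omega> - Z c \<omega>)" for \<omega>
      by (simp flip: matrix_vector_right_distrib)
    ultimately have "(\<lambda>t \<omega>. \<Phi> t \<omega> + indicator {b<..d} t *\<^sub>R \<zeta> \<omega>) = (\<lambda>t \<omega>. (\<Phi> t \<omega> + indicator {b<..c} t *\<^sub>R \<zeta> \<omega>) + (0 + indicator {c<..d} t *\<^sub>R \<zeta> \<omega>))"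
      "(\<lambda>\<omega>. J \<omega> + \<zeta> \<omega> *v (Z d \<omega> - Z b \<omega>)) = (\<lambda>\<omega>. (J \<omega> + \<zeta> \<omega> *v (Z c \<omega> - Z b \<omega>)) + (0 + \<zeta> \<omega> *v (Z d \<omega> - Z c \<omega>)))"
      by (simp_all add: add.assoc)
    note eqs = this
    show ?thesis by (rule exI, rule exI, rule exI, rule exI, rule conjI[OF 1 conjI[OF 2 conjI[OF eqs]]])
  qed
qed

text \<open>The single value \<open>\<zeta>\<close> is distributed over the steps: being known at
  \<open>a\<close>, it is known at the start of each step, where it is added to the value already
  there.\<close>

lemma simple_pair_add_constant:
  assumes "simple_pair a b \<Phi> J" "\<zeta> \<in> borel_measurable (F a)" "sq_integrable \<zeta>" "0 \<le> a" "b \<le> T"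
  shows "simple_pair a b (\<lambda>t \<omega>. \<Phi> t \<omega> + indicator {a<..b} t *\<^sub>R \<zeta> \<omega>) (\<lambda>\<omega>. J \<omega> + \<zeta> \<omega> *v (Z b \<omega> - Z a \<omega>))"
  using assms
proof (induction rule: simple_pair.induct)
  case nil
  show ?case by (rule simple_pair_cong[OF simple_pair.nil]) auto
next
  case (snoc b \<Phi> J c \<eta>)
  have ab: "a \<le> b" using snoc(1) by (rule simple_pair_le)
  have mb: "\<zeta> \<in> borel_measurable (F b)" using snoc(6) ab by (rule measurable_F_mono)
  have bT: "b \<le> T" using snoc by simp
  have mM[measurable]: "\<zeta> \<in> borel_measurable M" "\<eta> \<in> borel_measurable M"
    using mb snoc(3) bT by (auto intro: measurable_F_imp)
  have "sqint M (\<lambda>\<omega>. \<zeta> \<omega> + \<eta> \<omega>) < \<infinity>"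
    using snoc(4,7) by (intro le_less_trans[OF nn_integral_norm_sq_add_le])
      (auto simp: integrable_norm_sq_iff ennreal_mult_less_top)
  then have i: "sq_integrable (\<lambda>\<omega>. \<zeta> \<omega> + \<eta> \<omega>)" by (simp add: integrable_norm_sq_iff)
  have "simple_pair a b (\<lambda>t \<omega>. \<Phi> t \<omega> + indicator {a<..b} t *\<^sub>R \<zeta> \<omega>) (\<lambda>\<omega>. J \<omega> + \<zeta> \<omega> *v (Z b \<omega> - Z a \<omega>))"
    using snoc bT by blast
  from simple_pair.snoc[OF this snoc(2) _ i] have
    *: "simple_pair a c (\<lambda>t \<omega>. (\<Phi> t \<omega> + indicator {a<..b} t *\<^sub>R \<zeta> \<omega>) + indicator {b<..c} t *\<^sub>R (\<zeta> \<omega> + \<eta> \<omega>))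
      (\<lambda>\<omega>. (J \<omega> + \<zeta> \<omega> *v (Z b \<omega> - Z a \<omega>)) + (\<zeta> \<omega> + \<eta> \<omega>) *v (Z c \<omega> - Z b \<omega>))"
    using mb snoc(3) by simp
  have ind: "indicator {a<..c} t *\<^sub>R \<zeta> \<omega> = indicator {a<..b} t *\<^sub>R \<zeta> \<omega> + indicator {b<..c} t *\<^sub>R \<zeta> \<omega>" for t \<omega>
    using ab snoc(2) by (auto simp: indicator_def)
  have int: "\<zeta> \<omega> *v (Z c \<omega> - Z a \<omega>) = \<zeta> \<omega> *v (Z b \<omega> - Z a \<omega>) + \<zeta> \<omega> *v (Z c \<omega> - Z b \<omega>)" for \<omega>
    by (simp flip: matrix_vector_right_distrib)
  show ?case
    by (rule simple_pair_cong[OF *]) (simp_all add: ind int scaleR_add_right matrix_vector_mult_add_rdistrib)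
qed

text \<open>Induction on the first pair, with the second one arbitrary. The second is cut where the
  last step of the first begins; the induction hypothesis adds the parts before the cut, and after
  it the first pair is a single value.\<close>

lemma simple_pair_add:
  assumes "simple_pair a b \<Phi>' J'" "simple_pair a b \<Phi> J" "0 \<le> a" "b \<le> T"
  shows "simple_pair a b (\<lambda>t \<omega>. \<Phi> t \<omega> + \<Phi>' t \<omega>) (\<lambda>\<omega>. J \<omega> + J' \<omega>)"
  using assms
proof (induction arbitrary: \<Phi> J rule: simple_pair.induct)
  case nil
  then show ?case by simp
next
  case (snoc b \<Phi>' J' c \<eta>)
  have ab: "a \<le> b" using snoc(1) by (rule simple_pair_le)
  from simple_pair_split[OF snoc(6) ab snoc(2)] obtain \<Phi>1 J1 \<Phi>2 J2 where
    s: "simple_pair a b \<Phi>1 J1" "simple_pair b c \<Phi>2 J2"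
    "\<Phi> = (\<lambda>t \<omega>. \<Phi>1 t \<omega> + \<Phi>2 t \<omega>)" "J = (\<lambda>\<omega>. J1 \<omega> + J2 \<omega>)" by blast
  have 1: "simple_pair a b (\<lambda>t \<omega>. \<Phi>1 t \<omega> + \<Phi>' t \<omega>) (\<lambda>\<omega>. J1 \<omega> + J' \<omega>)"
    using snoc(5)[OF s(1)] snoc by simp
  have 2: "simple_pair b c (\<lambda>t \<omega>. \<Phi>2 t \<omega> + indicator {b<..c} t *\<^sub>R \<eta> \<omega>) (\<lambda>\<omega>. J2 \<omega> + \<eta> \<omega> *v (Z c \<omega> - Z b \<omega>))"
    by (rule simple_pair_add_constant[OF s(2) snoc(3,4)]) (use ab snoc in auto)
  show ?case by (rule simple_pair_cong[OF simple_pair_concat[OF 2 1]]) (simp_all add: s(3,4) add_ac)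
qed

lemma has_ito_integral_iff:
  "ito a b V I \<longleftrightarrow> I \<in> borel_measurable M \<and> (\<exists>\<Phi> J. (\<forall>i::nat. simple_pair a b (\<Phi> i) (J i)) \<and>
      (\<lambda>i. sqint2 (strip {a..b}) (\<lambda>t \<omega>. V t \<omega> - \<Phi> i t \<omega>)) \<longlonglongrightarrow> 0 \<and>
      (\<lambda>i. sqint M (\<lambda>\<omega>. I \<omega> - J i \<omega>)) \<longlonglongrightarrow> 0)"
  (is "_ \<longleftrightarrow> ?rhs")
proof
  assume "ito a b V I"
  then obtain n p \<xi> where sd: "\<And>i::nat. simple_data M Z a b (n i) (p i) (\<xi> i)"
    and c: "(\<lambda>i. sqint2 (strip {a..b}) (\<lambda>t \<omega>. V t \<omega> - simple_process (n i) (p i) (\<xi> i) t \<omega>)) \<longlonglongrightarrow> 0"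
    "(\<lambda>i. sqint M (\<lambda>\<omega>. I \<omega> - simple_integral Z (n i) (p i) (\<xi> i) \<omega>)) \<longlonglongrightarrow> 0"
    and I: "I \<in> borel_measurable M"
    unfolding has_ito_integral_def by blast
  show ?rhs
    using simple_data_imp_simple_pair[OF sd] c I
    by (intro conjI exI[of _ "\<lambda>i. simple_process (n i) (p i) (\<xi> i)"] exI[of _ "\<lambda>i. simple_integral Z (n i) (p i) (\<xi> i)"]) auto
next
  assume ?rhs
  then obtain \<Phi> J where I: "I \<in> borel_measurable M" and sp: "\<forall>i::nat. simple_pair a b (\<Phi> i) (J i)"
    and c: "(\<lambda>i. sqint2 (strip {a..b}) (\<lambda>t \<omega>. V t \<omega> - \<Phi> i t \<omega>)) \<longlonglongrightarrow> 0"
      "(\<lambda>i. sqint M (\<lambda>\<omega>. I \<omega> - J i \<omega>)) \<longlonglongrightarrow> 0"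
    by blast
  have "\<forall>i. \<exists>n p \<xi>. simple_data M Z a b n p \<xi> \<and> \<Phi> i = simple_process n p \<xi> \<and> J i = simple_integral Z n p \<xi>"
    using simple_pair_imp_simple_data sp by blast
  then obtain n p \<xi> where "\<forall>i. simple_data M Z a b (n i) (p i) (\<xi> i) \<and> \<Phi> i = simple_process (n i) (p i) (\<xi> i)
      \<and> J i = simple_integral Z (n i) (p i) (\<xi> i)"
    by metis
  then show "ito a b V I" using I c unfolding has_ito_integral_def
    by (intro conjI exI[of _ n] exI[of _ p] exI[of _ \<xi>]) auto
qed

lemma nn_integral_sq_add_tendsto_0:
  fixes f g :: "nat \<Rightarrow> 'z \<Rightarrow> 'e::euclidean_space"
  assumes "\<And>i. f i \<in> borel_measurable N" "\<And>i. g i \<in> borel_measurable N"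
    and f: "(\<lambda>i. \<integral>\<^sup>+x. ennreal ((norm (f i x))\<^sup>2) \<partial>N) \<longlonglongrightarrow> 0"
    and g: "(\<lambda>i. \<integral>\<^sup>+x. ennreal ((norm (g i x))\<^sup>2) \<partial>N) \<longlonglongrightarrow> 0"
  shows "(\<lambda>i. \<integral>\<^sup>+x. ennreal ((norm (f i x + g i x))\<^sup>2) \<partial>N) \<longlonglongrightarrow> 0"
proof (rule tendsto_sandwich[OF _ _ tendsto_const])
  have "(\<lambda>i. 2 * sqint N (f i) + 2 * sqint N (g i)) \<longlonglongrightarrow> 2 * 0 + 2 * 0"
    by (intro tendsto_add ennreal_tendsto_cmult f g) auto
  then show "(\<lambda>i. 2 * sqint N (f i) + 2 * sqint N (g i)) \<longlonglongrightarrow> 0" by simp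
  show "\<forall>\<^sub>F i in sequentially. sqint N (\<lambda>x. f i x + g i x)
    \<le> 2 * sqint N (f i) + 2 * sqint N (g i)"
    using assms by (intro always_eventually allI nn_integral_norm_sq_add_le) auto
qed simp

lemma ito_add:
  fixes V V' :: "real \<Rightarrow> 'w \<Rightarrow> real^'m^'d"
  assumes V: "ito a b V I" "joint {a..b} V"
    and V': "ito a b V' I'" "joint {a..b} V'"
    and ab: "0 \<le> a" "b \<le> T"
  shows "ito a b (padd V V') (\<lambda>\<omega>. I \<omega> + I' \<omega>)"
proof -
  let ?N = "strip {a..b}"
  obtain \<Phi> J where 1: "\<And>i::nat. simple_pair a b (\<Phi> i) (J i)" "I \<in> borel_measurable M"
     "(\<lambda>i. sqint2 ?N (\<lambda>t \<omega>. V t \<omega> - \<Phi> i t \<omega>)) \<longlonglongrightarrow> 0"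
     "(\<lambda>i. sqint M (\<lambda>\<omega>. I \<omega> - J i \<omega>)) \<longlonglongrightarrow> 0"
    using V(1) unfolding has_ito_integral_iff by blast
  obtain \<Phi>' J' where 2: "\<And>i::nat. simple_pair a b (\<Phi>' i) (J' i)" "I' \<in> borel_measurable M"
     "(\<lambda>i. sqint2 ?N (\<lambda>t \<omega>. V' t \<omega> - \<Phi>' i t \<omega>)) \<longlonglongrightarrow> 0"
     "(\<lambda>i. sqint M (\<lambda>\<omega>. I' \<omega> - J' i \<omega>)) \<longlonglongrightarrow> 0"
    using V'(1) unfolding has_ito_integral_iff by blast
  note m1 = simple_pair_measurable[OF 1(1) ab] and m2 = simple_pair_measurable[OF 2(1) ab]
  have mV: "(\<lambda>x. V (fst x) (snd x) - \<Phi> i (fst x) (snd x)) \<in> borel_measurable ?N"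
    "(\<lambda>x. V' (fst x) (snd x) - \<Phi>' i (fst x) (snd x)) \<in> borel_measurable ?N" for i
    using V(2) V'(2) m1(1)[of i] m2(1)[of i] unfolding case_prod_unfold by (auto intro!: borel_measurable_diff)
  show ?thesis unfolding has_ito_integral_iff
  proof (intro conjI exI[of _ "\<lambda>i t \<omega>. \<Phi> i t \<omega> + \<Phi>' i t \<omega>"] exI[of _ "\<lambda>i \<omega>. J i \<omega> + J' i \<omega>"] allI)
    show "(\<lambda>\<omega>. I \<omega> + I' \<omega>) \<in> borel_measurable M" using 1(2) 2(2) by measurable
    show "simple_pair a b (\<lambda>t \<omega>. \<Phi> i t \<omega> + \<Phi>' i t \<omega>) (\<lambda>\<omega>. J i \<omega> + J' i \<omega>)" for i
      by (rule simple_pair_add[OF 2(1) 1(1) ab])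
    show "(\<lambda>i. sqint2 ?N (\<lambda>t \<omega>. V t \<omega> + V' t \<omega> - (\<Phi> i t \<omega> + \<Phi>' i t \<omega>))) \<longlonglongrightarrow> 0"
      using nn_integral_sq_add_tendsto_0[OF mV] 1(3) 2(3) by (simp add: case_prod_unfold add_diff_add)
    show "(\<lambda>i. sqint M (\<lambda>\<omega>. I \<omega> + I' \<omega> - (J i \<omega> + J' i \<omega>))) \<longlonglongrightarrow> 0"
      using nn_integral_sq_add_tendsto_0[OF borel_measurable_diff[OF 1(2) m1(2)] borel_measurable_diff[OF 2(2) m2(2)] 1(4) 2(4)]
      by (simp add: add_diff_add)
  qed
qed

text \<open>The approximants of \<open>V\<close> vanish off \<open>{a<..b}\<close>, so they
  approximate \<open>W\<close> with no larger error and with the same integrals. Nothing relates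
  \<open>W\<close> to \<open>V\<close> at the two points \<open>a\<close> and \<open>b\<close>,
  which form a null set, so pieces with different conventions at their end points can be
  pasted.\<close>

lemma ito_extend:
  fixes V W :: "real \<Rightarrow> 'w \<Rightarrow> real^'m^'d"
  assumes V: "ito a b V I" "joint {a..b} V"
    and W: "joint {a'..b'} W"
      "\<And>t \<omega>. a < t \<Longrightarrow> t < b \<Longrightarrow> W t \<omega> = V t \<omega>"
      "\<And>t \<omega>. a' \<le> t \<Longrightarrow> t < a \<Longrightarrow> W t \<omega> = 0" "\<And>t \<omega>. b < t \<Longrightarrow> t \<le> b' \<Longrightarrow> W t \<omega> = 0"
    and ab: "0 \<le> a'" "a' \<le> a" "b \<le> b'" "b' \<le> T"
  shows "ito a' b' W I"
proof -
  let ?N = "strip {a..b}" and ?N' = "strip {a'..b'}"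
  obtain \<Phi> J where 1: "\<And>i::nat. simple_pair a b (\<Phi> i) (J i)" "I \<in> borel_measurable M"
     "(\<lambda>i. sqint2 ?N (\<lambda>t \<omega>. V t \<omega> - \<Phi> i t \<omega>)) \<longlonglongrightarrow> 0"
     "(\<lambda>i. sqint M (\<lambda>\<omega>. I \<omega> - J i \<omega>)) \<longlonglongrightarrow> 0"
    using V(1) unfolding has_ito_integral_iff by blast
  have m: "(\<lambda>(t,\<omega>). \<Phi> i t \<omega>) \<in> borel_measurable ?N" "(\<lambda>(t,\<omega>). \<Phi> i t \<omega>) \<in> borel_measurable ?N'" for i
    using simple_pair_measurable[OF 1(1)] ab by auto
  have mV: "(\<lambda>(t,\<omega>). ennreal ((norm (V t \<omega> - \<Phi> i t \<omega>))\<^sup>2)) \<in> borel_measurable ?N"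
    and mW: "(\<lambda>(t,\<omega>). ennreal ((norm (W t \<omega> - \<Phi> i t \<omega>))\<^sup>2)) \<in> borel_measurable ?N'" for i
    using V(2) W(1) m[of i] unfolding case_prod_unfold by measurable
  have le: "sqint2 (?N') (\<lambda>t \<omega>. W t \<omega> - \<Phi> i t \<omega>)
     \<le> sqint2 ?N (\<lambda>t \<omega>. V t \<omega> - \<Phi> i t \<omega>)" for i
  proof -
    have "(\<integral>\<^sup>+t. sqint M (\<lambda>\<omega>. W t \<omega> - \<Phi> i t \<omega>) * indicator {a'..b'} t \<partial>lborel)
       \<le> (\<integral>\<^sup>+t. sqint M (\<lambda>\<omega>. V t \<omega> - \<Phi> i t \<omega>) * indicator {a..b} t \<partial>lborel)"
    proof (rule nn_integral_mono_AE)
      show "AE t in lborel. sqint M (\<lambda>\<omega>. W t \<omega> - \<Phi> i t \<omega>) * indicator {a'..b'} t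
        \<le> sqint M (\<lambda>\<omega>. V t \<omega> - \<Phi> i t \<omega>) * indicator {a..b} t"
        using AE_lborel_singleton[of a] AE_lborel_singleton[of b]
      proof eventually_elim
        case (elim t)
        consider "a < t \<and> t < b" | "t < a \<or> b < t" using elim by linarith
        then show ?case
        proof cases
          case 1
          then show ?thesis using W(2) ab by (simp add: indicator_def)
        next
          case 2
          then have "\<Phi> i t \<omega> = 0" for \<omega> using simple_pair_support[OF 1(1), of t i] by auto
          moreover have "W t \<omega> = 0" if "t \<in> {a'..b'}" for \<omega> using W(3,4)[of t \<omega>] 2 that by auto
          ultimately show ?thesis by (simp add: indicator_def)
        qed
      qed
    qed
    then show ?thesis using nn_integral_pair_restrict[OF mV] nn_integral_pair_restrict[OF mW] by simp
  qed
  show ?thesis unfolding has_ito_integral_iff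
  proof (intro conjI exI[of _ \<Phi>] exI[of _ J] allI 1(2,4))
    show "simple_pair a' b' (\<Phi> i) (J i)" for i by (rule simple_pair_extend[OF 1(1) ab(2,3)])
    show "(\<lambda>i. sqint2 (?N') (\<lambda>t \<omega>. W t \<omega> - \<Phi> i t \<omega>)) \<longlonglongrightarrow> 0"
      by (rule tendsto_sandwich[OF _ _ tendsto_const 1(3)]) (use le in auto)
  qed
qed

section \<open>Ito integrals under a constant matrix\<close>

lemma simple_pair_matrix_mult:
  fixes Q :: "real^'d^'k"
  assumes "simple_pair a b \<Phi> J" "b \<le> T"
  shows "simple_pair a b (\<lambda>t \<omega>. Q ** \<Phi> t \<omega>) (\<lambda>\<omega>. Q *v J \<omega>)"
  using assms
proof (induction rule: simple_pair.induct)
  case nil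
  show ?case
    by (rule simple_pair_cong[OF simple_pair.nil]) (simp_all add: linear_0[OF bounded_linear.linear[OF bounded_linear_matrix_mult_left]])
next
  case (snoc b \<Phi> J c \<zeta>)
  obtain K where K: "norm (Q ** X) \<le> norm X * K" for X :: "real^'m^'d"
    using bounded_linear.bounded[OF bounded_linear_matrix_mult_left[of Q]] by blast
  have bT: "b \<le> T" using snoc by simp
  have F: "(\<lambda>\<omega>. Q ** \<zeta> \<omega>) \<in> borel_measurable (F b)" using snoc(3) by measurable
  have i: "sq_integrable (\<lambda>\<omega>. Q ** \<zeta> \<omega>)"
  proof (rule Bochner_Integration.integrable_bound)
    show "integrable M (\<lambda>\<omega>. K\<^sup>2 * (norm (\<zeta> \<omega>))\<^sup>2)" using snoc(4) by simp
    show "(\<lambda>\<omega>. (norm (Q ** \<zeta> \<omega>))\<^sup>2) \<in> borel_measurable M" using measurable_F_imp[OF F bT] by measurable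
    have "(norm (Q ** X))\<^sup>2 \<le> K\<^sup>2 * (norm X)\<^sup>2" for X :: "real^'m^'d"
      using power_mono[OF K[of X], of 2] by (simp add: power_mult_distrib mult.commute)
    then show "AE \<omega> in M. norm ((norm (Q ** \<zeta> \<omega>))\<^sup>2) \<le> norm (K\<^sup>2 * (norm (\<zeta> \<omega>))\<^sup>2)" by (simp add: abs_mult)
  qed
  show ?case
    by (rule simple_pair_cong[OF simple_pair.snoc[OF snoc(5)[OF bT] snoc(2) F i]])
       (simp_all add: matrix_add_ldistrib linear_cmul[OF bounded_linear.linear[OF bounded_linear_matrix_mult_left]]
          matrix_vector_right_distrib matrix_vector_mul_assoc)
qed

lemma nn_integral_sq_linear_tendsto_0:
  fixes f :: "nat \<Rightarrow> 'z \<Rightarrow> 'e::euclidean_space" and g :: "'e \<Rightarrow> 'f::euclidean_space"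
  assumes g: "bounded_linear g" and f: "\<And>i. f i \<in> borel_measurable N" "(\<lambda>i. sqint N (f i)) \<longlonglongrightarrow> 0"
  shows "(\<lambda>i. sqint N (\<lambda>x. g (f i x))) \<longlonglongrightarrow> 0"
proof -
  obtain K where K: "norm (g x) \<le> norm x * K" for x using bounded_linear.bounded[OF g] by blast
  have le: "sqint N (\<lambda>x. g (f i x)) \<le> ennreal (K\<^sup>2) * sqint N (f i)" for i
  proof -
    have "ennreal ((norm (g y))\<^sup>2) \<le> ennreal (K\<^sup>2) * ennreal ((norm y)\<^sup>2)" for y
      using ennreal_leI[OF power_mono[OF K[of y], of 2]] by (simp add: power_mult_distrib ennreal_mult mult.commute)
    then have "sqint N (\<lambda>x. g (f i x)) \<le> (\<integral>\<^sup>+x. ennreal (K\<^sup>2) * ennreal ((norm (f i x))\<^sup>2) \<partial>N)"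
      by (intro nn_integral_mono)
    then show ?thesis using f(1)[of i] by (simp add: nn_integral_cmult)
  qed
  have lim: "(\<lambda>i. ennreal (K\<^sup>2) * sqint N (f i)) \<longlonglongrightarrow> 0"
    using ennreal_tendsto_cmult[OF _ f(2), of "ennreal (K\<^sup>2)"] by simp
  show ?thesis by (rule tendsto_sandwich[OF _ _ tendsto_const lim]) (simp_all add: le)
qed

lemma ito_matrix_mult:
  fixes V :: "real \<Rightarrow> 'w \<Rightarrow> real^'m^'d" and Q :: "real^'d^'k"
  assumes V: "ito a b V I" "joint {a..b} V" and ab: "0 \<le> a" "b \<le> T"
  shows "ito a b (\<lambda>t \<omega>. Q ** V t \<omega>) (\<lambda>\<omega>. Q *v I \<omega>)"
proof -
  obtain \<Phi> J where 1: "\<And>i::nat. simple_pair a b (\<Phi> i) (J i)" "I \<in> borel_measurable M"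
     "(\<lambda>i. sqint2 (strip {a..b}) (\<lambda>t \<omega>. V t \<omega> - \<Phi> i t \<omega>)) \<longlonglongrightarrow> 0"
     "(\<lambda>i. sqint M (\<lambda>\<omega>. I \<omega> - J i \<omega>)) \<longlonglongrightarrow> 0"
    using V(1) unfolding has_ito_integral_iff by blast
  note m = simple_pair_measurable[OF 1(1) ab]
  have mV: "(\<lambda>x. V (fst x) (snd x) - \<Phi> i (fst x) (snd x)) \<in> borel_measurable (strip {a..b})" for i
    using V(2) m(1)[of i] unfolding case_prod_unfold by (auto intro!: borel_measurable_diff)
  show ?thesis unfolding has_ito_integral_iff
  proof (intro conjI exI[of _ "\<lambda>i t \<omega>. Q ** \<Phi> i t \<omega>"] exI[of _ "\<lambda>i \<omega>. Q *v J i \<omega>"] allI)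
    show "(\<lambda>\<omega>. Q *v I \<omega>) \<in> borel_measurable M" using 1(2) by measurable
    show "simple_pair a b (\<lambda>t \<omega>. Q ** \<Phi> i t \<omega>) (\<lambda>\<omega>. Q *v J i \<omega>)" for i
      by (rule simple_pair_matrix_mult[OF 1(1) ab(2)])
    show "(\<lambda>i. sqint2 (strip {a..b}) (\<lambda>t \<omega>. Q ** V t \<omega> - Q ** \<Phi> i t \<omega>)) \<longlonglongrightarrow> 0"
      using nn_integral_sq_linear_tendsto_0[OF bounded_linear_matrix_mult_left mV] 1(3)
      by (simp add: case_prod_unfold linear_diff[OF bounded_linear.linear[OF bounded_linear_matrix_mult_left]])
    show "(\<lambda>i. sqint M (\<lambda>\<omega>. Q *v I \<omega> - Q *v J i \<omega>)) \<longlonglongrightarrow> 0"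
      using nn_integral_sq_linear_tendsto_0[OF matrix_vector_mul_bounded_linear borel_measurable_diff[OF 1(2) m(2)] 1(4)]
      by (simp add: matrix_vector_mult_diff_distrib)
  qed
qed

end

section \<open>Invariant subspaces contain the initial values\<close>

lemma column_matrix_mult: "column j (Q ** X) = Q *v column j (X :: real^'l^'n)"
  by (simp add: column_def matrix_matrix_mult_def matrix_vector_mult_def vec_eq_iff)

lemma linear_column: "linear (column j :: real^'l^'n \<Rightarrow> real^'n)"
  by (rule linearI) (simp_all add: column_def vec_eq_iff)

lemma diag_mult_vector: "diag v *v x = v * (x :: real^'d)"
proof -
  have "(\<Sum>j\<in>UNIV. (if i = j then v $ i else 0) * x $ j) = v $ i * x $ i" for i
  proof -
    have "(\<Sum>j\<in>UNIV. (if i = j then v $ i else 0) * x $ j) = (\<Sum>j\<in>UNIV. if i = j then v $ i * x $ j else 0)"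
      by (intro sum.cong) auto
    then show ?thesis by simp
  qed
  then show ?thesis by (simp add: diag_def matrix_vector_mult_def vec_eq_iff)
qed

context brownian_motion
begin

section \<open>Linear operations on square-integrable adapted processes\<close>

lemma L2_adapted_linear:
  fixes X :: "real \<Rightarrow> 'w \<Rightarrow> 'e::euclidean_space" and g :: "'e \<Rightarrow> 'f::euclidean_space"
  assumes X: "X \<in> L2a" and g: "bounded_linear g"
  shows "(\<lambda>t \<omega>. g (X t \<omega>)) \<in> L2a"
proof -
  interpret g: bounded_linear g by fact
  obtain K where K: "K > 0" "\<And>x. norm (g x) \<le> norm x * K" using g.pos_bounded by blast
  have gm: "g \<in> borel_measurable borel"
    by (intro borel_measurable_continuous_onI linear_continuous_on g)
  have j: "(\<lambda>x. case x of (t,\<omega>) \<Rightarrow> g (X t \<omega>)) \<in> borel_measurable (strip {0..T})"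
    using measurable_compose[OF L2_adapted_joint[OF X] gm] by (simp add: case_prod_unfold)
  have "integrable (strip {0..T}) (\<lambda>x. K\<^sup>2 * (case x of (t,\<omega>) \<Rightarrow> (norm (X t \<omega>))\<^sup>2))"
    using X by (simp add: L2_adapted_def)
  then have "integrable (strip {0..T}) (\<lambda>x. case x of (t,\<omega>) \<Rightarrow> (norm (g (X t \<omega>)))\<^sup>2)"
  proof (rule Bochner_Integration.integrable_bound)
    show "(\<lambda>x. case x of (t,\<omega>) \<Rightarrow> (norm (g (X t \<omega>)))\<^sup>2) \<in> borel_measurable (strip {0..T})"
      using j unfolding case_prod_unfold by measurable
    have "(norm (g x))\<^sup>2 \<le> K\<^sup>2 * (norm x)\<^sup>2" for x
      using power_mono[OF K(2)[of x], of 2] by (simp add: power_mult_distrib mult.commute)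
    then show "AE x in strip {0..T}. norm (case x of (t,\<omega>) \<Rightarrow> (norm (g (X t \<omega>)))\<^sup>2)
      \<le> norm (K\<^sup>2 * (case x of (t,\<omega>) \<Rightarrow> (norm (X t \<omega>))\<^sup>2))"
      by (auto simp: abs_mult)
  qed
  then show ?thesis
    using j measurable_compose[OF L2_adapted_F[OF X] gm] by (auto simp: L2_adapted_def)
qed

lemma L2_adapted_add:
  fixes X Y :: "real \<Rightarrow> 'w \<Rightarrow> 'e::euclidean_space"
  assumes X: "X \<in> L2a" and Y: "Y \<in> L2a"
  shows "(\<lambda>t \<omega>. X t \<omega> + Y t \<omega>) \<in> L2a"
proof -
  let ?N = "strip {0..T}"
  have j: "(\<lambda>x. case x of (t,\<omega>) \<Rightarrow> X t \<omega> + Y t \<omega>) \<in> borel_measurable ?N"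
    using L2_adapted_joint[OF X] L2_adapted_joint[OF Y] unfolding case_prod_unfold by measurable
  have "integrable ?N (\<lambda>x. 2 * (case x of (t,\<omega>) \<Rightarrow> (norm (X t \<omega>))\<^sup>2) + 2 * (case x of (t,\<omega>) \<Rightarrow> (norm (Y t \<omega>))\<^sup>2))"
    using X Y by (simp add: L2_adapted_def)
  then have "integrable ?N (\<lambda>x. case x of (t,\<omega>) \<Rightarrow> (norm (X t \<omega> + Y t \<omega>))\<^sup>2)"
  proof (rule Bochner_Integration.integrable_bound)
    show "(\<lambda>x. case x of (t,\<omega>) \<Rightarrow> (norm (X t \<omega> + Y t \<omega>))\<^sup>2) \<in> borel_measurable ?N"
      using j unfolding case_prod_unfold by measurable
    show "AE x in ?N. norm (case x of (t,\<omega>) \<Rightarrow> (norm (X t \<omega> + Y t \<omega>))\<^sup>2)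
      \<le> norm (2 * (case x of (t,\<omega>) \<Rightarrow> (norm (X t \<omega>))\<^sup>2) + 2 * (case x of (t,\<omega>) \<Rightarrow> (norm (Y t \<omega>))\<^sup>2))"
      using norm_sq_add_le by (intro AE_I2) (auto split: prod.split)
  qed
  then show ?thesis
    using j L2_adapted_F[OF X] L2_adapted_F[OF Y] by (auto simp: L2_adapted_def intro!: borel_measurable_add)
qed

text \<open>One null set serves all intervals at once: the integral of the norm over
  \<open>{0..T}\<close> has finite second moment, hence is almost surely finite, and subintervals
  inherit integrability.\<close>

lemma L2_adapted_set_integrable:
  fixes X :: "real \<Rightarrow> 'w \<Rightarrow> 'e::euclidean_space"
  assumes X: "X \<in> L2a"
  shows "AE \<omega> in M. \<forall>a b. 0 \<le> a \<longrightarrow> b \<le> T \<longrightarrow> set_integrable lborel {a..b} (\<lambda>s. X s \<omega>)"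
proof -
  note j = L2_adapted_joint[OF X]
  let ?N = "\<lambda>\<omega>. tint 0 T (\<lambda>s. ennreal (norm (X s \<omega>)))"
  have [measurable]: "?N \<in> borel_measurable M" by (rule nn_integral_process_measurable(1)[OF j])
  have "(\<integral>\<^sup>+\<omega>. (?N \<omega>)\<^sup>2 \<partial>M) < \<infinity>"
    by (rule le_less_trans[OF nn_integral_process_measurable(3)[OF j]])
       (use L2_adapted_finite[OF X] in \<open>simp add: ennreal_mult_less_top\<close>)
  then have "AE \<omega> in M. (?N \<omega>)\<^sup>2 \<noteq> \<infinity>" by (intro nn_integral_PInf_AE) auto
  then have "AE \<omega> in M. ?N \<omega> < \<infinity>"
    by eventually_elim (auto simp: power2_eq_square ennreal_mult_eq_top_iff less_top)
  then show ?thesis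
  proof (rule AE_mp, intro AE_I2 impI allI)
    fix \<omega> and a b :: real assume \<omega>: "\<omega> \<in> space M" and fin: "?N \<omega> < \<infinity>" and ab: "0 \<le> a" "b \<le> T"
    have "(\<lambda>(s,\<omega>). indicator {0..T} s *\<^sub>R X s \<omega>) \<in> borel_measurable (lborel \<Otimes>\<^sub>M M)"
      by (rule measurable_pair_extend[OF j]) simp
    from measurable_compose[OF measurable_Pair2'[OF \<omega>] this]
    have m: "(\<lambda>s. indicator {0..T} s *\<^sub>R X s \<omega>) \<in> borel_measurable lborel" by simp
    have "(\<integral>\<^sup>+s. norm (indicator {0..T} s *\<^sub>R X s \<omega>) \<partial>lborel) = ?N \<omega>"
      by (intro nn_integral_cong) (auto simp: indicator_def)
    then have "set_integrable lborel {0..T} (\<lambda>s. X s \<omega>)"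
      unfolding set_integrable_def using m fin by (simp add: integrable_iff_bounded)
    then show "set_integrable lborel {a..b} (\<lambda>s. X s \<omega>)"
      by (rule set_integrable_subset) (use ab in auto)
  qed
qed

end

text \<open>\<open>Q\<close> is the identity minus the orthogonal projection onto \<open>G\<close>.
  The two properties together give \<open>Q (B x) = Q (B (Q x))\<close> for every linear
  \<open>B\<close> that leaves \<open>G\<close> invariant, which is how the projected equation
  closes on itself.\<close>

lemma subspace_projection_matrix:
  fixes G :: "(real^'d) set"
  assumes "subspace G"
  obtains Q :: "real^'d^'d" where "\<And>g. g \<in> G \<Longrightarrow> Q *v g = 0" "\<And>x. x - Q *v x \<in> G"
proof -
  obtain B where B: "B \<subseteq> G" "pairwise orthogonal B" "\<And>x. x \<in> B \<Longrightarrow> norm x = 1" "independent B" "span B = G"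
    using orthonormal_basis_subspace[OF assms] by metis
  have fin: "finite B" using B(4) by (rule independent_imp_finite)
  define q where "q x = x - (\<Sum>b\<in>B. (x \<bullet> b) *\<^sub>R b)" for x
  have lin: "linear q"
    by (rule linearI) (simp_all add: q_def inner_add_left scaleR_add_left sum.distrib scaleR_diff_right scaleR_sum_right)
  have mq: "matrix q *v x = q x" for x using fun_cong[OF matrix_vector_mul(2)[OF lin]] by simp
  have "q b = 0" if "b \<in> B" for b
  proof -
    have "(b \<bullet> c) *\<^sub>R c = (if c = b then b else 0)" if "c \<in> B" for c
      using B(2,3) \<open>b \<in> B\<close> that by (auto simp: pairwise_def orthogonal_def norm_eq_1)
    then have "(\<Sum>c\<in>B. (b \<bullet> c) *\<^sub>R c) = (\<Sum>c\<in>B. if c = b then b else 0)" by (intro sum.cong) auto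
    then show ?thesis using that fin by (simp add: q_def)
  qed
  then have "q g = 0" if "g \<in> G" for g
    using linear_eq_0_on_span[OF lin, of B g] that B(5) by auto
  moreover have "x - q x \<in> G" for x
    unfolding q_def using B(1) assms by (auto intro!: subspace_sum subspace_scale)
  ultimately show ?thesis using that[of "matrix q"] by (simp add: mq)
qed

context brownian_motion
begin

definition drift ::
  "real^'d^'d \<Rightarrow> real^'m^'d \<Rightarrow> (real \<Rightarrow> 'w \<Rightarrow> real^'m) \<Rightarrow> (real \<Rightarrow> 'w \<Rightarrow> real^'d) \<Rightarrow> (real \<Rightarrow> 'w \<Rightarrow> real^'m^'d) \<Rightarrow> real \<Rightarrow> 'w \<Rightarrow> real^'d"
  where "drift A H U Y V s \<omega> = A *v Y s \<omega> + H *v U s \<omega> + (\<Sum>j\<in>UNIV. diag (column j H) *v column j (V s \<omega>))"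

abbreviation drift_integral where
  "drift_integral A H U Y V t \<omega> \<equiv> LINT s:{t..T}|lborel. drift A H U Y V s \<omega>"

lemma drift_set_integrable:
  assumes U: "U \<in> L2a" and Y: "Y \<in> L2a" and V: "V \<in> L2a"
  shows "AE \<omega> in M. \<forall>a b. 0 \<le> a \<longrightarrow> b \<le> T \<longrightarrow> set_integrable lborel {a..b} (\<lambda>s. drift A H U Y V s \<omega>)"
proof -
  have 1: "bounded_linear (\<lambda>x. diag (column j H) *v column j x)" for j
    using linear_compose[OF linear_column[of j] matrix_vector_mul_linear[of "diag (column j H)"]]
    by (simp add: linear_conv_bounded_linear comp_def)
  have "AE \<omega> in M. \<forall>j\<in>UNIV. \<forall>a b. 0 \<le> a \<longrightarrow> b \<le> T \<longrightarrow> set_integrable lborel {a..b} (\<lambda>s. diag (column j H) *v column j (V s \<omega>))"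
    by (intro AE_finite_allI L2_adapted_set_integrable L2_adapted_linear[OF V 1]) auto
  moreover have "AE \<omega> in M. \<forall>a b. 0 \<le> a \<longrightarrow> b \<le> T \<longrightarrow> set_integrable lborel {a..b} (\<lambda>s. A *v Y s \<omega>)"
    by (intro L2_adapted_set_integrable L2_adapted_linear[OF Y] matrix_vector_mul_bounded_linear)
  moreover have "AE \<omega> in M. \<forall>a b. 0 \<le> a \<longrightarrow> b \<le> T \<longrightarrow> set_integrable lborel {a..b} (\<lambda>s. H *v U s \<omega>)"
    by (intro L2_adapted_set_integrable L2_adapted_linear[OF U] matrix_vector_mul_bounded_linear)
  ultimately show ?thesis
  proof eventually_elim
    case (elim \<omega>)
    then show ?case unfolding drift_def set_integrable_def scaleR_add_right scaleR_sum_right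
      by (intro allI impI Bochner_Integration.integrable_add Bochner_Integration.integrable_sum) auto
  qed
qed

lemma bsde_initial_value_in_invariant_subspace:
  fixes G :: "(real^'d) set"
  assumes T: "0 \<le> T" and G: "subspace G" "1 \<in> G" "\<And>g. g \<in> G \<Longrightarrow> A *v g \<in> G"
      "\<And>g j. g \<in> G \<Longrightarrow> column j H * g \<in> G"
    and U: "U \<in> L2a" and sol: "bsde_solution M Z T A H U c Y V"
    and y0: "AE \<omega> in M. Y 0 \<omega> = y0"
  shows "y0 \<in> G"
proof -
  obtain Q :: "real^'d^'d" where Q: "\<And>g. g \<in> G \<Longrightarrow> Q *v g = 0" "\<And>x. x - Q *v x \<in> G"
    using subspace_projection_matrix[OF G(1)] by blast
  have HG: "column j H \<in> G" for j using G(4)[OF G(2), of j] by simp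
  have Y: "Y \<in> L2a" and V: "V \<in> L2a" using sol by (auto simp: bsde_solution_def)
  define y where "y t \<omega> = Q *v Y t \<omega>" for t \<omega>
  define v where "v t \<omega> = Q ** V t \<omega>" for t \<omega>
  define L where "L p = Q *v (A *v fst p + (\<Sum>j\<in>UNIV. diag (column j H) *v column j (snd p)))" for p :: "(real^'d) \<times> (real^'m^'d)"
  have linL: "linear L"
    by (rule linearI) (simp_all add: L_def linear_add[OF linear_column] linear_cmul[OF linear_column]
        matrix_vector_right_distrib sum.distrib scaleR_sum_right[symmetric]
        linear_cmul[OF matrix_vector_mul_linear] flip: scaleR_add_right)
  have blL: "bounded_linear L" using linL by (simp add: linear_conv_bounded_linear)
  then obtain B where B: "0 < B" "\<And>p. norm (L p) \<le> norm p * B" using bounded_linear.pos_bounded by blast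
  define f where "f t \<omega> = L (y t \<omega>, v t \<omega>)" for t \<omega>
  have QR: "Q *v drift A H U Y V t \<omega> = f t \<omega>" for t \<omega>
  proof -
    have 1: "Q *v (A *v x) = Q *v (A *v (Q *v x))" for x
      using Q(1)[OF G(3)[OF Q(2)[of x]]] by (simp add: matrix_vector_mult_diff_distrib)
    have 2: "Q *v (diag (column j H) *v x) = Q *v (diag (column j H) *v (Q *v x))" for x j
      using Q(1)[OF G(4)[OF Q(2)[of x], of j]] by (simp add: matrix_vector_mult_diff_distrib flip: diag_mult_vector)
    \<comment> \<open>The control disappears: \<open>H *v u\<close> is a combination of the columns
      \<open>H^j = H^j * 1\<close>, which lie in \<open>G\<close>.\<close>
    have 3: "Q *v (H *v u) = 0" for u
    proof (rule Q(1))
      have "H *v u = (\<Sum>j\<in>UNIV. u $ j *\<^sub>R column j H)"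
        by (simp add: matrix_mult_sum scalar_mult_eq_scaleR)
      then show "H *v u \<in> G" using HG G(1) by (auto intro!: subspace_sum subspace_scale)
    qed
    have s: "Q *v (\<Sum>j\<in>UNIV. g j) = (\<Sum>j\<in>UNIV. Q *v g j)" for g :: "'m \<Rightarrow> real^'d"
      by (rule linear_sum[OF matrix_vector_mul_linear])
    show ?thesis
      unfolding drift_def f_def L_def y_def v_def
      by (simp add: matrix_vector_right_distrib s 3 column_matrix_mult flip: 1 2)
  qed
  have yL: "y \<in> L2a"
    unfolding y_def[abs_def] by (rule L2_adapted_linear[OF Y matrix_vector_mul_bounded_linear])
  have vL: "v \<in> L2a"
    unfolding v_def[abs_def] by (rule L2_adapted_linear[OF V bounded_linear_matrix_mult_left])
  have "AE \<omega> in M. y 0 \<omega> = 0"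
  proof (rule homogeneous_backward_eq_zero[OF T yL L2_adapted_joint[OF vL] L2_adapted_finite[OF vL]])
    show "joint {0..T} f"
    proof -
      have "(\<lambda>x. (y (fst x) (snd x), v (fst x) (snd x))) \<in> borel_measurable (strip {0..T})"
        using L2_adapted_joint[OF yL] L2_adapted_joint[OF vL] by (simp add: case_prod_unfold)
      from measurable_compose[OF this borel_measurable_continuous_onI[OF linear_continuous_on[OF blL]]]
      show ?thesis by (simp add: f_def case_prod_unfold)
    qed
    show "(norm (f t \<omega>))\<^sup>2 \<le> B\<^sup>2 * ((norm (y t \<omega>))\<^sup>2 + (norm (v t \<omega>))\<^sup>2)" for t \<omega>
      using power_mono[OF B(2)[of "(y t \<omega>, v t \<omega>)"], of 2]
      by (simp add: f_def power_mult_distrib norm_Pair mult.commute)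
    show "0 \<le> B\<^sup>2" by simp
    fix t assume t: "t \<in> {0..T}"
    then obtain I where ito: "ito t T V I"
      and ae: "AE \<omega> in M. Y t \<omega> = c *\<^sub>R 1 + drift_integral A H U Y V t \<omega> - I \<omega>"
      using sol unfolding bsde_solution_def drift_def by blast
    have "ito t T v (\<lambda>\<omega>. Q *v I \<omega>)"
      unfolding v_def[abs_def]
      by (rule ito_matrix_mult[OF ito]) (use t in \<open>auto intro: measurable_pair_restrict_mono[OF L2_adapted_joint[OF V]]\<close>)
    moreover have "AE \<omega> in M. y t \<omega> + Q *v I \<omega> = (LINT s:{t..T}|lborel. f s \<omega>)"
      using ae drift_set_integrable[OF U Y V, of A H]
    proof eventually_elim
      case (elim \<omega>)
      \<comment> \<open>The terminal term \<open>c *\<^sub>R 1\<close> is removed by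
        \<open>Q\<close> because \<open>1 \<in> G\<close>; this makes the projected equation
        homogeneous.\<close>
      have "y t \<omega> + Q *v I \<omega> = Q *v drift_integral A H U Y V t \<omega>"
        unfolding y_def elim(1) using Q(1)[OF G(2)]
        by (simp add: matrix_vector_right_distrib matrix_vector_mult_diff_distrib linear_cmul[OF matrix_vector_mul_linear])
      also have "\<dots> = (LINT s:{t..T}|lborel. Q *v drift A H U Y V s \<omega>)"
        using elim(2) t unfolding set_lebesgue_integral_def set_integrable_def
        by (subst integral_bounded_linear[OF matrix_vector_mul_bounded_linear[of Q], symmetric])
           (auto simp: linear_cmul[OF matrix_vector_mul_linear])
      finally show ?case by (simp add: QR)
    qed
    ultimately show "\<exists>I. ito t T v I \<and> (AE \<omega> in M. y t \<omega> + I \<omega> = (LINT s:{t..T}|lborel. f s \<omega>))"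
      by blast
  qed
  with y0 have "AE \<omega> in M. Q *v y0 = 0"
    by eventually_elim (simp add: y_def)
  \<comment> \<open>The statement does not involve \<open>\<omega>\<close>, and a constant statement
    that holds almost surely on a probability space is true.\<close>
  then have "Q *v y0 = 0" by simp
  then show ?thesis using Q(2)[of y0] by simp
qed

end

section \<open>A measurable modification of the Brownian motion\<close>

lemma lint_eq_integral:
  fixes f :: "real \<Rightarrow> 'a::euclidean_space"
  assumes "continuous_on {a..b} f"
  shows "set_integrable lborel {a..b} f" "(LINT s:{a..b}|lborel. f s) = integral {a..b} f"
proof -
  show "set_integrable lborel {a..b} f" using assms by (rule borel_integrable_atLeastAtMost')
  then show "(LINT s:{a..b}|lborel. f s) = integral {a..b} f" by (rule set_borel_integral_eq_integral(2))
qed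

context brownian_motion
begin

text \<open>For \<open>t \<ge> 0\<close>, the largest multiple of \<open>2^-n\<close> not above
  \<open>t\<close>. Rounding down keeps the sampling times in the past of \<open>t\<close>; passing
  through \<open>nat\<close> leaves countably many of them.\<close>

definition dyadic_floor :: "nat \<Rightarrow> real \<Rightarrow> real" where
  "dyadic_floor n t = real (nat \<lfloor>2 ^ n * t\<rfloor>) / 2 ^ n"

lemma dyadic_floor_bounds:
  assumes "0 \<le> t" shows "0 \<le> dyadic_floor n t" "dyadic_floor n t \<le> t" "t - dyadic_floor n t \<le> (1/2) ^ n"
proof -
  have e: "real (nat \<lfloor>2 ^ n * t\<rfloor>) = of_int \<lfloor>2 ^ n * t\<rfloor>" using assms by simp
  show "0 \<le> dyadic_floor n t" by (simp add: dyadic_floor_def)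
  show "dyadic_floor n t \<le> t"
    unfolding dyadic_floor_def e using of_int_floor_le[of "2 ^ n * t"] by (simp add: field_simps)
  have "t < (of_int \<lfloor>2 ^ n * t\<rfloor> + 1) / 2 ^ n"
    using real_of_int_floor_add_one_gt[of "2 ^ n * t"] by (simp add: pos_less_divide_eq mult.commute)
  then show "t - dyadic_floor n t \<le> (1/2) ^ n"
    unfolding dyadic_floor_def e by (simp add: add_divide_distrib power_one_over)
qed

lemma dyadic_floor_tendsto:
  assumes "0 \<le> t" shows "(\<lambda>n. dyadic_floor n t) \<longlonglongrightarrow> t"
proof -
  have "(\<lambda>n. t - dyadic_floor n t) \<longlonglongrightarrow> 0"
  proof (rule tendsto_sandwich[OF _ _ tendsto_const])
    show "(\<lambda>n. (1/2 :: real) ^ n) \<longlonglongrightarrow> 0" by (rule LIMSEQ_power_zero) simp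
  qed (use dyadic_floor_bounds[OF assms] in auto)
  from tendsto_diff[OF tendsto_const[of t] this] show ?thesis by simp
qed

text \<open>\<open>Z\<close> need not be jointly measurable, since its paths are continuous only almost surely and
  \<open>M\<close> is not complete. \<open>Zmod\<close> is jointly measurable and still adapted to the raw filtration.\<close>

definition Zmod :: "real \<Rightarrow> 'w \<Rightarrow> real^'m" where
  "Zmod t \<omega> = lim (\<lambda>n. Z (min T (dyadic_floor n t)) \<omega>)"

abbreviation dZ where "dZ j s t \<omega> \<equiv> Zmod t \<omega> $ j - Zmod s \<omega> $ j"

lemma Zmod_eq: "AE \<omega> in M. \<forall>t\<in>{0..T}. Zmod t \<omega> = Z t \<omega>"
  using continuous_paths
proof eventually_elim
  case (elim \<omega>)
  show ?case
  proof
    fix t assume t: "t \<in> {0..T}"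
    have m: "min T (dyadic_floor n t) = dyadic_floor n t" "dyadic_floor n t \<in> {0..T}" for n
      using dyadic_floor_bounds[of t n] t by auto
    have "(\<lambda>n. Z (dyadic_floor n t) \<omega>) \<longlonglongrightarrow> Z t \<omega>"
      by (rule continuous_on_tendsto_compose[OF elim dyadic_floor_tendsto]) (use t m in auto)
    then show "Zmod t \<omega> = Z t \<omega>" unfolding Zmod_def m by (rule limI)
  qed
qed

text \<open>The sampling times never exceed \<open>t\<close>, so each approximant is known at time
  \<open>t\<close>, and \<open>lim\<close> preserves measurability even where paths have no
  limit.\<close>

lemma Zmod_F: assumes "t \<in> {0..T}" shows "Zmod t \<in> borel_measurable (F t)"
  unfolding Zmod_def[abs_def]
proof (rule borel_measurable_lim_metric)
  fix n show "Z (min T (dyadic_floor n t)) \<in> borel_measurable (F t)"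
    using dyadic_floor_bounds[of t n] assms by (intro Z_measurable_F) auto
qed

lemma Zmod_M: assumes "t \<in> {0..T}" shows "Zmod t \<in> borel_measurable M"
  using measurable_F_imp[OF Zmod_F[OF assms]] assms by simp

text \<open>For fixed \<open>n\<close> the sampling time takes countably many values, so joint
  measurability reduces to that of \<open>Z\<close> at each of them. The cap \<open>min T\<close>
  keeps these times where \<open>Z\<close> is known to be measurable, for every real
  \<open>t\<close>.\<close>

lemma Zmod_joint: assumes "0 \<le> T" shows "(\<lambda>(t,\<omega>). Zmod t \<omega>) \<in> borel_measurable (lborel \<Otimes>\<^sub>M M)"
  unfolding Zmod_def case_prod_unfold
proof (rule borel_measurable_lim_metric)
  fix n
  have 1: "(\<lambda>x. Z (min T (real k / 2 ^ n)) (snd x)) \<in> borel_measurable (lborel \<Otimes>\<^sub>M M)" for k :: nat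
    by (rule measurable_compose[OF measurable_snd random_variable_Z]) (use assms in auto)
  have 2: "(\<lambda>x. nat \<lfloor>(2::real) ^ n * fst x\<rfloor>) \<in> measurable (lborel \<Otimes>\<^sub>M M) (count_space UNIV)"
    by measurable
  show "(\<lambda>x. Z (min T (dyadic_floor n (fst x))) (snd x)) \<in> borel_measurable (lborel \<Otimes>\<^sub>M M)"
    unfolding dyadic_floor_def by (rule measurable_compose_countable[OF 1 2])
qed

lemma Zmod_increment_sq:
  fixes \<xi> :: "'w \<Rightarrow> real"
  assumes \<xi>: "\<xi> \<in> borel_measurable (F r)" "integrable M (\<lambda>\<omega>. (\<xi> \<omega>)\<^sup>2)" and rst: "0 \<le> r" "r \<le> s" "s \<le> t" "t \<le> T"
  shows "(\<integral>\<^sup>+\<omega>. ennreal ((\<xi> \<omega> * dZ j s t \<omega>)\<^sup>2) \<partial>M) = ennreal ((t - s) * expectation (\<lambda>\<omega>. (\<xi> \<omega>)\<^sup>2))"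
proof -
  have F: "(\<lambda>\<omega>. (\<xi> \<omega>)\<^sup>2) \<in> borel_measurable (F s)"
    using measurable_F_mono[OF \<xi>(1) rst(2)] by measurable
  have h: "has_bochner_integral M (\<lambda>\<omega>. (\<xi> \<omega>)\<^sup>2 * ((inc j s t \<omega>) * (inc j s t \<omega>))) ((t - s) * expectation (\<lambda>\<omega>. (\<xi> \<omega>)\<^sup>2))"
    using mult_increment(2)[OF F \<xi>(2), of t j j] rst by simp
  have "(\<integral>\<^sup>+\<omega>. ennreal ((\<xi> \<omega> * dZ j s t \<omega>)\<^sup>2) \<partial>M)
     = (\<integral>\<^sup>+\<omega>. ennreal ((\<xi> \<omega>)\<^sup>2 * ((inc j s t \<omega>) * (inc j s t \<omega>))) \<partial>M)"
    using Zmod_eq by (intro nn_integral_cong_AE, eventually_elim) (use rst in \<open>auto simp: power2_eq_square mult_ac\<close>)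
  also have "\<dots> = ennreal ((t - s) * expectation (\<lambda>\<omega>. (\<xi> \<omega>)\<^sup>2))"
    using h by (subst nn_integral_eq_integral) (auto simp: has_bochner_integral_iff)
  finally show ?thesis .
qed

text \<open>One shape serves all three processes of a steering block: \<open>g = y\<close>,
  \<open>h = w\<close> for the state, and \<open>h = 0\<close> for the control and the integrand.
  The interval is open at \<open>q\<close> because another solution takes over from there.\<close>

lemma block_process_L2_adapted:
  fixes g h :: "real \<Rightarrow> 'e::euclidean_space" and \<xi> :: "'w \<Rightarrow> real"
  assumes \<xi>: "\<xi> \<in> borel_measurable (F r)" "integrable M (\<lambda>\<omega>. (\<xi> \<omega>)\<^sup>2)" and r: "0 \<le> r" "r \<le> T" "q \<le> T"
    and g: "continuous_on UNIV g" and h: "continuous_on UNIV h"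
  shows "(\<lambda>s \<omega>. indicator {r..<q} s *\<^sub>R (\<xi> \<omega> *\<^sub>R (g s + dZ j r s \<omega> *\<^sub>R h s))) \<in> L2a"
proof -
  define X where "X s \<omega> = indicator {r..<q} s *\<^sub>R (\<xi> \<omega> *\<^sub>R (g s + dZ j r s \<omega> *\<^sub>R h s))" for s \<omega>
  let ?N = "strip {0..T}"
  have gm[measurable]: "g \<in> borel_measurable borel" and hm[measurable]: "h \<in> borel_measurable borel"
    using g h by (auto intro: borel_measurable_continuous_onI)
  have \<xi>M[measurable]: "\<xi> \<in> borel_measurable M" using measurable_F_imp[OF \<xi>(1)] r by simp
  have ZrM[measurable]: "Zmod r \<in> borel_measurable M" using Zmod_M[of r] r by simp
  have "0 \<le> T" using r by simp
  have j: "(\<lambda>x. case x of (s,\<omega>) \<Rightarrow> X s \<omega>) \<in> borel_measurable (lborel \<Otimes>\<^sub>M M)"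
    using Zmod_joint[OF \<open>0 \<le> T\<close>] unfolding X_def case_prod_unfold by measurable
  have "fst \<in> measurable ?N lborel"
    by (rule measurable_compose[OF measurable_fst]) (rule measurable_restrict_space1, simp)
  then have "(\<lambda>x. (fst x, snd x)) \<in> measurable ?N (lborel \<Otimes>\<^sub>M M)" by measurable
  from measurable_compose[OF this j] have j': "(\<lambda>(s,\<omega>). X s \<omega>) \<in> borel_measurable ?N" by simp
  have ad: "X t \<in> borel_measurable (F t)" if t: "t \<in> {0..T}" for t
  proof (cases "t \<in> {r..<q}")
    case True
    have "\<xi> \<in> borel_measurable (F t)" "Zmod r \<in> borel_measurable (F t)" "Zmod t \<in> borel_measurable (F t)"
      using measurable_F_mono[OF \<xi>(1), of t] measurable_F_mono[OF Zmod_F[of r], of t] Zmod_F[OF t] True r by auto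
    then show ?thesis unfolding X_def[abs_def] by measurable
  next
    case False
    then show ?thesis by (simp add: X_def[abs_def])
  qed
  have ec: "compact (g ` {0..T})" "compact (h ` {0..T})"
    by (rule compact_continuous_image[OF continuous_on_subset[OF g]] compact_continuous_image[OF continuous_on_subset[OF h]]; simp)+
  obtain G where "\<forall>x\<in>g ` {0..T}. norm x \<le> G" using compact_imp_bounded[OF ec(1)] unfolding bounded_iff by blast
  then have G: "norm (g s) \<le> G" if "s \<in> {0..T}" for s using that by blast
  obtain K where "\<forall>x\<in>h ` {0..T}. norm x \<le> K" using compact_imp_bounded[OF ec(2)] unfolding bounded_iff by blast
  then have K: "norm (h s) \<le> K" if "s \<in> {0..T}" for s using that by blast
  define e where "e = expectation (\<lambda>\<omega>. (\<xi> \<omega>)\<^sup>2)"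
  have e0: "0 \<le> e" by (simp add: e_def)
  have \<xi>e: "(\<integral>\<^sup>+\<omega>. ennreal ((\<xi> \<omega>)\<^sup>2) \<partial>M) = ennreal e" unfolding e_def by (rule nn_integral_eq_integral[OF \<xi>(2)]) auto
  \<comment> \<open>\<open>G\<close> and \<open>K\<close> bound \<open>g\<close> and
    \<open>h\<close> on \<open>{0..T}\<close>. The two factors 2 come from the square of a sum, and
    \<open>T * e\<close> bounds \<open>(s - r) * e\<close>, the second moment of
    \<open>\<xi>\<close> times the increment.\<close>
  have bd: "sqint M (X s) \<le> ennreal (2 * G\<^sup>2 * e + 2 * K\<^sup>2 * (T * e))" if s: "s \<in> {0..T}" for s
  proof (cases "s \<in> {r..<q}")
    case True
    have ZsM[measurable]: "Zmod s \<in> borel_measurable M" by (rule Zmod_M[OF s])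
    have "sqint M (X s) = sqint M (\<lambda>\<omega>. \<xi> \<omega> *\<^sub>R g s + (\<xi> \<omega> * dZ j r s \<omega>) *\<^sub>R h s)"
      using True by (simp add: X_def scaleR_add_right)
    also have "\<dots> \<le> 2 * sqint M (\<lambda>\<omega>. \<xi> \<omega> *\<^sub>R g s) + 2 * sqint M (\<lambda>\<omega>. (\<xi> \<omega> * dZ j r s \<omega>) *\<^sub>R h s)"
      by (rule nn_integral_norm_sq_add_le) measurable
    also have "sqint M (\<lambda>\<omega>. \<xi> \<omega> *\<^sub>R g s) = (\<integral>\<^sup>+\<omega>. ennreal ((norm (g s))\<^sup>2) * ennreal ((\<xi> \<omega>)\<^sup>2) \<partial>M)"
      by (simp add: power_mult_distrib ennreal_mult mult.commute)
    also have "\<dots> = ennreal ((norm (g s))\<^sup>2 * e)" using e0 by (simp add: nn_integral_cmult \<xi>e ennreal_mult)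
    also have "sqint M (\<lambda>\<omega>. (\<xi> \<omega> * dZ j r s \<omega>) *\<^sub>R h s)
       = (\<integral>\<^sup>+\<omega>. ennreal ((norm (h s))\<^sup>2) * ennreal ((\<xi> \<omega> * dZ j r s \<omega>)\<^sup>2) \<partial>M)"
      unfolding norm_scaleR real_norm_def power_mult_distrib[of "\<bar>_\<bar>" "norm _"] power2_abs
      by (intro nn_integral_cong) (subst mult.commute, rule ennreal_mult, auto)
    also have "\<dots> = ennreal ((norm (h s))\<^sup>2) * ennreal ((s - r) * e)"
      unfolding e_def using Zmod_increment_sq[OF \<xi>, of r s j] r s True
      by (subst nn_integral_cmult) auto
    also have "\<dots> = ennreal ((norm (h s))\<^sup>2 * ((s - r) * e))" using True e0 by (simp add: ennreal_mult)
    also have "2 * ennreal ((norm (g s))\<^sup>2 * e) + 2 * ennreal ((norm (h s))\<^sup>2 * ((s - r) * e))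
      = ennreal (2 * (norm (g s))\<^sup>2 * e + 2 * (norm (h s))\<^sup>2 * ((s - r) * e))"
      using True e0 by (simp add: ennreal_mult mult.assoc)
    also have "\<dots> \<le> ennreal (2 * G\<^sup>2 * e + 2 * K\<^sup>2 * (T * e))"
      using True e0 s r G[OF s] K[OF s] by (intro ennreal_leI add_mono mult_mono mult_left_mono power_mono) auto
    finally show ?thesis .
  next
    case False
    then show ?thesis by (simp add: X_def)
  qed
  have j2: "(\<lambda>(s,\<omega>). ennreal ((norm (X s \<omega>))\<^sup>2)) \<in> borel_measurable ?N"
    using j' unfolding case_prod_unfold by measurable
  have "sqint2 ?N X \<le> tint 0 T (\<lambda>s. ennreal (2 * G\<^sup>2 * e + 2 * K\<^sup>2 * (T * e)))"
    unfolding nn_integral_pair_restrict[OF j2, simplified]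
    by (intro nn_integral_mono) (use bd in \<open>auto simp: indicator_def\<close>)
  also have "\<dots> < \<infinity>" using \<open>0 \<le> T\<close> by (simp add: nn_integral_cmult ennreal_mult_less_top)
  finally have "integrable ?N (\<lambda>(s,\<omega>). (norm (X s \<omega>))\<^sup>2)"
    using j' by (simp add: integrable_iff_bounded case_prod_unfold)
  then show ?thesis using j' ad unfolding X_def[abs_def] by (simp add: L2_adapted_def)
qed

end

section \<open>Integration by parts\<close>

text \<open>The rank-one matrix \<open>x e_j^T\<close>: as an integrand it feeds the
  \<open>j\<close>-th noise component into the direction \<open>x\<close>.\<close>

definition column_matrix :: "'m::finite \<Rightarrow> real^'d \<Rightarrow> real^'m^'d" where
  "column_matrix j x = (\<chi> i k. if k = j then x $ i else 0)"

lemma column_matrix_mult_vector: "column_matrix j x *v z = z $ j *\<^sub>R x"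
proof -
  have "(\<Sum>k\<in>UNIV. (if k = j then x $ i else 0) * z $ k) = (\<Sum>k\<in>UNIV. if k = j then x $ i * z $ k else 0)" for i
    by (intro sum.cong) auto
  then show ?thesis by (simp add: column_matrix_def matrix_vector_mult_def vec_eq_iff)
qed

lemma norm_column_matrix: "norm (column_matrix j x) = norm x"
proof -
  have "(\<Sum>k\<in>UNIV. (if k = j then x $ i else 0)\<^sup>2) = (\<Sum>k\<in>UNIV. if k = j then (x $ i)\<^sup>2 else 0)" for i
    by (intro sum.cong) auto
  then have "(norm (column_matrix j x))\<^sup>2 = (norm x)\<^sup>2"
    by (simp add: column_matrix_def norm_matrix_sq norm_vec_def L2_set_def sum_nonneg)
  then show ?thesis by simp
qed

lemma linear_column_matrix: "linear (column_matrix j)"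
  by (rule linearI) (simp_all add: column_matrix_def vec_eq_iff)

lemma column_column_matrix: "column k (column_matrix j x) = (if k = j then x else 0)"
  by (simp add: column_def column_matrix_def vec_eq_iff)

lemma partition_cover:
  fixes p :: "nat \<Rightarrow> real"
  assumes "p 0 < s" "s \<le> p n"
  shows "\<exists>k<n. p k < s \<and> s \<le> p (Suc k)"
  using assms(2)
proof (induction n)
  case 0
  then show ?case using assms(1) by simp
next
  case (Suc n)
  then show ?case by (cases "s \<le> p n") (auto intro: less_SucI)
qed

text \<open>Abel summation: one step contributes \<open>e (p (Suc k)) *\<^sub>R w (p (Suc k)) - e (p
  k) *\<^sub>R w (p k)\<close> plus the integral of \<open>e dw\<close> over the step, and the sum
  telescopes. The integrals on the left are the errors of the left-point sum; each involves
  \<open>e\<close> only through its variation inside one step. The sign in \<open>w' = - dw\<close>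
  fits curves that run backwards, where \<open>dw = A w\<close>.\<close>

lemma summation_by_parts_integral:
  fixes w dw :: "real \<Rightarrow> 'a::euclidean_space" and e :: "real \<Rightarrow> real"
  assumes w: "\<And>s. (w has_vector_derivative - dw s) (at s)" and dw: "continuous_on UNIV dw"
    and p: "\<And>k. k < n \<Longrightarrow> p k \<le> p (Suc k)" and e: "continuous_on {p 0..p n} e"
  shows "(\<Sum>k<n. (e (p (Suc k)) - e (p k)) *\<^sub>R w (p k) + integral {p k..p (Suc k)} (\<lambda>s. (e s - e (p (Suc k))) *\<^sub>R dw s))
    = e (p n) *\<^sub>R w (p n) - e (p 0) *\<^sub>R w (p 0) + integral {p 0..p n} (\<lambda>s. e s *\<^sub>R dw s)"
  using p e
proof (induction n)
  case (Suc n)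
  have mono: "p 0 \<le> p k" if "k \<le> Suc n" for k
    using that by (induction k) (auto intro: order_trans[OF _ Suc(2)])
  have le: "p 0 \<le> p n" "p n \<le> p (Suc n)" using mono Suc(2) by auto
  have e1: "continuous_on {p n..p (Suc n)} e" and e2: "continuous_on {p 0..p n} e"
    using Suc(3) by (rule continuous_on_subset, use le in force)+
  have c: "continuous_on S dw" for S using dw by (rule continuous_on_subset) simp
  have i1: "(\<lambda>s. e s *\<^sub>R dw s) integrable_on {p n..p (Suc n)}" and i0: "(\<lambda>s. e s *\<^sub>R dw s) integrable_on {p 0..p (Suc n)}"
    by (intro integrable_continuous_real continuous_on_scaleR c e1 Suc(3))+
  have i2: "dw integrable_on {p n..p (Suc n)}" by (intro integrable_continuous_real c)
  have "((\<lambda>s. - dw s) has_integral (w (p (Suc n)) - w (p n))) {p n..p (Suc n)}"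
    by (rule fundamental_theorem_of_calculus[OF le(2)]) (rule has_vector_derivative_at_within[OF w])
  from has_integral_neg[OF this] have "integral {p n..p (Suc n)} dw = w (p n) - w (p (Suc n))"
    by (simp add: integral_unique)
  then have A: "integral {p n..p (Suc n)} (\<lambda>s. (e s - e (p (Suc n))) *\<^sub>R dw s)
    = integral {p n..p (Suc n)} (\<lambda>s. e s *\<^sub>R dw s) - e (p (Suc n)) *\<^sub>R (w (p n) - w (p (Suc n)))"
    using i1 i2 by (simp add: scaleR_diff_left integral_diff integrable_cmul)
  have B: "integral {p 0..p n} (\<lambda>s. e s *\<^sub>R dw s) + integral {p n..p (Suc n)} (\<lambda>s. e s *\<^sub>R dw s) = integral {p 0..p (Suc n)} (\<lambda>s. e s *\<^sub>R dw s)"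
    by (rule Henstock_Kurzweil_Integration.integral_combine[OF le i0])
  have IH: "(\<Sum>k<n. (e (p (Suc k)) - e (p k)) *\<^sub>R w (p k) + integral {p k..p (Suc k)} (\<lambda>s. (e s - e (p (Suc k))) *\<^sub>R dw s))
    = e (p n) *\<^sub>R w (p n) - e (p 0) *\<^sub>R w (p 0) + integral {p 0..p n} (\<lambda>s. e s *\<^sub>R dw s)"
    using Suc(2) e2 by (intro Suc(1)) auto
  show ?case
    unfolding sum.lessThan_Suc IH A B[symmetric] by (simp add: scaleR_diff_left scaleR_diff_right)
qed simp

context brownian_motion
begin

text \<open>Integration by parts without a bracket term, because \<open>w\<close> is deterministic
  and differentiable and \<open>\<xi>\<close> is already known at \<open>r\<close>. The right-hand
  side is defined path by path, and Abel summation on a uniform mesh shows that the left-point sums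
  converge to it in mean square.\<close>

lemma ito_block:
  fixes w dw :: "real \<Rightarrow> real^'d" and \<xi> :: "'w \<Rightarrow> real" and j :: 'm
  assumes \<xi>: "\<xi> \<in> borel_measurable (F r)" "integrable M (\<lambda>\<omega>. (\<xi> \<omega>)\<^sup>2)"
    and rt: "0 \<le> r" "r \<le> t" "t \<le> q" "q \<le> T"
    and w: "\<And>s. (w has_vector_derivative - dw s) (at s)" and dw: "continuous_on UNIV dw"
  defines "\<eta> \<equiv> \<lambda>s \<omega>. dZ j r s \<omega>"
  shows "ito t q (\<lambda>s \<omega>. \<xi> \<omega> *\<^sub>R column_matrix j (w s))
    (\<lambda>\<omega>. \<xi> \<omega> *\<^sub>R (\<eta> q \<omega> *\<^sub>R w q - \<eta> t \<omega> *\<^sub>R w t + (LINT s:{t..q}|lborel. \<eta> s \<omega> *\<^sub>R dw s)))"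
proof -
  let ?N = "strip {t..q}"
  define I where "I \<omega> = \<xi> \<omega> *\<^sub>R (\<eta> q \<omega> *\<^sub>R w q - \<eta> t \<omega> *\<^sub>R w t + (LINT s:{t..q}|lborel. \<eta> s \<omega> *\<^sub>R dw s))" for \<omega>
  have T0: "0 \<le> T" using rt by simp
  have wc: "continuous_on UNIV w"
    using w by (auto intro!: continuous_at_imp_continuous_on has_vector_derivative_continuous)
  have wm[measurable]: "w \<in> borel_measurable borel" and dwm[measurable]: "dw \<in> borel_measurable borel"
    using wc dw by (auto intro: borel_measurable_continuous_onI)
  have cm[measurable]: "column_matrix j \<in> borel_measurable borel" for j :: 'm
    by (intro borel_measurable_continuous_onI linear_continuous_on) (use linear_column_matrix in \<open>simp add: linear_conv_bounded_linear\<close>)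
  have \<xi>M[measurable]: "\<xi> \<in> borel_measurable M" using measurable_F_imp[OF \<xi>(1)] rt by simp
  have ZM[measurable]: "Zmod s \<in> borel_measurable M" if "s \<in> {0..T}" for s using Zmod_M that .
  have fst_m: "fst \<in> measurable (strip A) lborel" for A
    by (rule measurable_compose[OF measurable_fst]) (rule measurable_restrict_space1, simp)
  have "(\<lambda>x. (fst x, snd x)) \<in> measurable (strip A) (lborel \<Otimes>\<^sub>M M)" for A
    using fst_m by measurable
  from measurable_compose[OF this Zmod_joint[OF T0]]
  have Zj[measurable]: "(\<lambda>x. Zmod (fst x) (snd x)) \<in> borel_measurable (strip A)" for A by simp
  have fst_b[measurable]: "fst \<in> borel_measurable (strip A)" for A using fst_m[of A] by simp
  have rT: "r \<in> {0..T}" "t \<in> {0..T}" "q \<in> {0..T}" using rt by auto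
  have Im: "I \<in> borel_measurable M"
  proof -
    have "(\<lambda>(s,\<omega>). \<eta> s \<omega> *\<^sub>R dw s) \<in> borel_measurable ?N"
      unfolding \<eta>_def case_prod_unfold using ZM[OF rT(1)] by measurable
    from integral_process_measurable[OF this] have "(\<lambda>\<omega>. LINT s:{t..q}|lborel. \<eta> s \<omega> *\<^sub>R dw s) \<in> borel_measurable M" .
    then show ?thesis using ZM[OF rT(1)] ZM[OF rT(2)] ZM[OF rT(3)] unfolding I_def[abs_def] \<eta>_def by measurable
  qed
  have "compact (dw ` {0..T})"
    by (rule compact_continuous_image[OF continuous_on_subset[OF dw]]) simp_all
  then obtain D where "\<forall>x\<in>dw ` {0..T}. norm x \<le> D" using compact_imp_bounded[of "dw ` {0..T}"] unfolding bounded_iff by blast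
  then have D: "norm (dw s) \<le> D" if "s \<in> {0..T}" for s using that by blast
  have D0: "0 \<le> D" using D[OF rT(1)] norm_ge_zero order_trans by blast
  have lip: "norm (w s - w s') \<le> D * (s - s')" if "0 \<le> s'" "s' \<le> s" "s \<le> T" for s s'
  proof -
    have 1: "((\<lambda>s. - dw s) has_integral (w s - w s')) {s'..s}"
      by (rule fundamental_theorem_of_calculus[OF that(2)]) (rule has_vector_derivative_at_within[OF w])
    have "norm (w s - w s') \<le> D * measure lborel (cbox s' s)"
      by (rule has_integral_bound[OF D0]) (use 1 D that in auto)
    then show ?thesis using that by simp
  qed
  define e where "e = expectation (\<lambda>\<omega>. (\<xi> \<omega>)\<^sup>2)"
  have e0: "0 \<le> e" by (simp add: e_def)
  have \<xi>e: "(\<integral>\<^sup>+\<omega>. ennreal ((\<xi> \<omega>)\<^sup>2) \<partial>M) = ennreal e" unfolding e_def by (rule nn_integral_eq_integral[OF \<xi>(2)]) auto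
  \<comment> \<open>The \<open>i\<close>-th partition has \<open>Suc i\<close> equal steps, which
    excludes an empty partition.\<close>
  define h where "h i = (q - t) / real (Suc i)" for i :: nat
  define p where "p i k = t + h i * real k" for i k :: nat
  define \<zeta> where "\<zeta> i k \<omega> = \<xi> \<omega> *\<^sub>R column_matrix j (w (p i k))" for i k :: nat and \<omega>
  have h0: "0 \<le> h i" for i using rt by (simp add: h_def)
  have hn: "h i * real (Suc i) = q - t" for i by (simp add: h_def)
  have p0: "p i 0 = t" and pn: "p i (Suc i) = q" for i using hn[of i] by (simp_all add: p_def)
  have pS: "p i (Suc k) = p i k + h i" for i k by (simp add: p_def algebra_simps)
  have sd: "simple_data M Z t q (Suc i) (p i) (\<zeta> i)" for i
    unfolding simple_data_def
  proof (intro conjI allI impI)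
    fix k assume k: "k < Suc i"
    show "p i k \<le> p i (Suc k)" using h0[of i] by (simp add: pS)
    have "r \<le> p i k" using rt h0[of i] by (simp add: p_def add_increasing2)
    then have "\<xi> \<in> borel_measurable (F (p i k))" using \<xi>(1) measurable_F_mono by blast
    then show "\<zeta> i k \<in> borel_measurable (F (p i k))" unfolding \<zeta>_def[abs_def] by measurable
    show "sq_integrable (\<lambda>\<omega>. \<zeta> i k \<omega>)"
      using \<xi>(2) by (simp add: \<zeta>_def power_mult_distrib)
  qed (use p0 pn in auto)
  have pin: "p i k \<in> {0..T}" "r \<le> p i k" "t \<le> p i k" "p i k \<le> q" if "k \<le> Suc i" for i k
    using simple_data_bounds[OF sd that] rt by auto
  let ?\<delta> = "\<lambda>i s \<omega>. \<xi> \<omega> *\<^sub>R column_matrix j (w s) - simple_process (Suc i) (p i) (\<zeta> i) s \<omega>" and ?b = "\<lambda>i. 2 * (h i * (D\<^sup>2 * (h i * e) * h i))"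
  have E1: "sqint2 ?N (\<lambda>s \<omega>. ?\<delta> i s \<omega>)
    \<le> ennreal ((D * h i)\<^sup>2 * e * (q - t))" for i
  proof -
    have m: "(\<lambda>(s, \<omega>). ennreal ((norm (?\<delta> i s \<omega>))\<^sup>2)) \<in> borel_measurable ?N"
    proof -
      have "(\<lambda>s. column_matrix j (w s)) \<in> borel_measurable borel" by measurable
      from measurable_compose[OF fst_b this] have [measurable]: "(\<lambda>x. column_matrix j (w (fst x))) \<in> borel_measurable ?N" .
      have [measurable]: "(\<lambda>x. simple_process (Suc i) (p i) (\<zeta> i) (fst x) (snd x)) \<in> borel_measurable ?N"
        using simple_process_measurable[OF sd, of i "{t..q}"] rt by (simp add: case_prod_unfold)
      show ?thesis unfolding case_prod_unfold by measurable
    qed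
    \<comment> \<open>The point \<open>s = t\<close> is left out: the steps are open on the left, so
      the simple process is 0 there. It is a null set.\<close>
    have pt: "sqint M (\<lambda>\<omega>. ?\<delta> i s \<omega>)
        \<le> ennreal ((D * h i)\<^sup>2 * e)" if s: "t < s" "s \<le> q" for s
    proof -
      obtain k where k: "k < Suc i" "p i k < s" "s \<le> p i (Suc k)"
        using partition_cover[of "p i" s "Suc i"] s p0 pn by auto
      have sp: "simple_process (Suc i) (p i) (\<zeta> i) s \<omega> = \<zeta> i k \<omega>" for \<omega>
        by (rule simple_process_eq[OF sd]) (use k in auto)
      have "norm (w s - w (p i k)) \<le> D * (s - p i k)"
        using pin[of k i] k s rt by (intro lip) auto
      also have "\<dots> \<le> D * h i" using k pS[of i k] D0 by (intro mult_left_mono) auto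
      finally have "norm (w s - w (p i k)) \<le> D * h i" .
      then have l: "(norm (w s - w (p i k)))\<^sup>2 \<le> (D * h i)\<^sup>2" by (intro power_mono) auto
      have "sqint M (\<lambda>\<omega>. ?\<delta> i s \<omega>)
        \<le> (\<integral>\<^sup>+\<omega>. ennreal ((D * h i)\<^sup>2) * ennreal ((\<xi> \<omega>)\<^sup>2) \<partial>M)"
      proof (rule nn_integral_mono)
        fix \<omega>
        have "norm (?\<delta> i s \<omega>) = \<bar>\<xi> \<omega>\<bar> * norm (w s - w (p i k))"
          unfolding sp \<zeta>_def by (simp flip: scaleR_diff_right linear_diff[OF linear_column_matrix] add: norm_column_matrix)
        then have "(norm (?\<delta> i s \<omega>))\<^sup>2 \<le> (D * h i)\<^sup>2 * (\<xi> \<omega>)\<^sup>2"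
          using mult_right_mono[OF l, of "(\<xi> \<omega>)\<^sup>2"] by (simp add: power_mult_distrib mult.commute)
        from ennreal_leI[OF this]
        show "ennreal ((norm (?\<delta> i s \<omega>))\<^sup>2) \<le> ennreal ((D * h i)\<^sup>2) * ennreal ((\<xi> \<omega>)\<^sup>2)"
          by (subst ennreal_mult[symmetric]) auto
      qed
      also have "\<dots> = ennreal ((D * h i)\<^sup>2) * ennreal e" by (simp add: nn_integral_cmult \<xi>e)
      also have "\<dots> = ennreal ((D * h i)\<^sup>2 * e)" using e0 by (subst ennreal_mult) auto
      finally show ?thesis .
    qed
    have "sqint2 ?N (\<lambda>s \<omega>. ?\<delta> i s \<omega>)
      \<le> tint t q (\<lambda>s. ennreal ((D * h i)\<^sup>2 * e))"
      unfolding nn_integral_pair_restrict[OF m, simplified]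
      using AE_lborel_singleton[of t]
      by (intro nn_integral_mono_AE, eventually_elim) (use pt in \<open>auto simp: indicator_def\<close>)
    also have "\<dots> = ennreal ((D * h i)\<^sup>2 * e) * ennreal (q - t)" using rt by (simp add: nn_integral_cmult)
    also have "\<dots> = ennreal ((D * h i)\<^sup>2 * e * (q - t))" using rt e0 by (subst ennreal_mult) auto
    finally show ?thesis .
  qed
  \<comment> \<open>The error term of Abel summation on one step. The increment runs from the right
    end of the step back to \<open>s\<close>; only its square is estimated, so the sign is
    harmless.\<close>
  define R where "R i k \<omega> = (LINT s:{p i k..p i (Suc k)}|lborel. (\<xi> \<omega> * dZ j (p i (Suc k)) s \<omega>) *\<^sub>R dw s)" for i k \<omega>
  have Rm: "R i k \<in> borel_measurable M"
    and RE: "sqint M (R i k) \<le> ennreal (?b i)" if k: "k < Suc i" for i k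
  proof -
    have le: "p i k \<le> p i (Suc k)" using h0[of i] by (simp add: pS)
    have [measurable]: "Zmod (p i (Suc k)) \<in> borel_measurable M" using pin[of "Suc k" i] k by (intro Zmod_M) auto
    have fm: "(\<lambda>(s,\<omega>). (\<xi> \<omega> * dZ j (p i (Suc k)) s \<omega>) *\<^sub>R dw s) \<in> borel_measurable (strip {p i k..p i (Suc k)})"
      unfolding case_prod_unfold by measurable
    show "R i k \<in> borel_measurable M" unfolding R_def[abs_def] by (rule integral_process_measurable[OF fm])
    have b: "sqint M (\<lambda>\<omega>. (\<xi> \<omega> * dZ j (p i (Suc k)) s \<omega>) *\<^sub>R dw s) \<le> ennreal (D\<^sup>2 * (h i * e))"
      if s: "s \<in> {p i k..p i (Suc k)}" for s
    proof -
      have sT: "s \<in> {0..T}" "r \<le> s" using s pin[of k i] pin[of "Suc k" i] k by auto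
      have [measurable]: "Zmod s \<in> borel_measurable M" by (rule Zmod_M[OF sT(1)])
      have "sqint M (\<lambda>\<omega>. (\<xi> \<omega> * dZ j (p i (Suc k)) s \<omega>) *\<^sub>R dw s)
        = (\<integral>\<^sup>+\<omega>. ennreal ((norm (dw s))\<^sup>2) * ennreal ((\<xi> \<omega> * dZ j s (p i (Suc k)) \<omega>)\<^sup>2) \<partial>M)"
      proof (rule nn_integral_cong)
        fix \<omega>
        have "(norm ((\<xi> \<omega> * dZ j (p i (Suc k)) s \<omega>) *\<^sub>R dw s))\<^sup>2
           = (norm (dw s))\<^sup>2 * (\<xi> \<omega> * dZ j s (p i (Suc k)) \<omega>)\<^sup>2"
          by (simp add: power_mult_distrib power2_commute)
        then show "ennreal ((norm ((\<xi> \<omega> * dZ j (p i (Suc k)) s \<omega>) *\<^sub>R dw s))\<^sup>2)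
           = ennreal ((norm (dw s))\<^sup>2) * ennreal ((\<xi> \<omega> * dZ j s (p i (Suc k)) \<omega>)\<^sup>2)"
          by (simp only:) (rule ennreal_mult, auto)
      qed
      also have "\<dots> = ennreal ((norm (dw s))\<^sup>2) * ennreal ((p i (Suc k) - s) * e)"
        using Zmod_increment_sq[OF \<xi>, of s "p i (Suc k)" j] sT s pin[of "Suc k" i] k rt unfolding e_def
        by (subst nn_integral_cmult) auto
      also have "\<dots> \<le> ennreal (D\<^sup>2) * ennreal (h i * e)"
        using s e0 D[OF sT(1)] pS[of i k] by (intro mult_mono ennreal_leI power_mono mult_right_mono) auto
      also have "\<dots> = ennreal (D\<^sup>2 * (h i * e))" using h0[of i] e0 by (subst ennreal_mult) auto
      finally show ?thesis .
    qed
    \<comment> \<open>The bound for split time integrals is used with the cut at the right end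
      point: the second piece vanishes, and its factor 2 is the one in \<open>?b\<close>.\<close>
    have "sqint M (R i k) \<le> 2 * (ennreal (h i) *
      tint (p i k) (p i (Suc k)) (\<lambda>s. sqint M (\<lambda>\<omega>. (\<xi> \<omega> * dZ j (p i (Suc k)) s \<omega>) *\<^sub>R dw s)))"
      using integral_process_sq_le[OF fm le order_refl] unfolding R_def by (simp add: pS)
    also have "\<dots> \<le> 2 * (ennreal (h i) * tint (p i k) (p i (Suc k)) (\<lambda>s. ennreal (D\<^sup>2 * (h i * e))))"
      by (intro mult_left_mono nn_integral_mono) (use b in \<open>auto simp: indicator_def\<close>)
    also have "tint (p i k) (p i (Suc k)) (\<lambda>s. ennreal (D\<^sup>2 * (h i * e))) = ennreal (D\<^sup>2 * (h i * e)) * ennreal (h i)"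
      using h0[of i] by (simp add: nn_integral_cmult pS)
    also have "2 * (ennreal (h i) * (ennreal (D\<^sup>2 * (h i * e)) * ennreal (h i))) = ennreal (?b i)"
      using h0[of i] e0 by (simp add: ennreal_mult mult_nonneg_nonneg)
    finally show "sqint M (R i k) \<le> ennreal (?b i)" .
  qed
  \<comment> \<open>On almost every path \<open>Zmod\<close> agrees with \<open>Z\<close> and is
    continuous on \<open>{0..T}\<close>, so the deterministic summation by parts applies to it path
    by path.\<close>
  have IJ: "AE \<omega> in M. I \<omega> - simple_integral Z (Suc i) (p i) (\<zeta> i) \<omega> = (\<Sum>k<Suc i. R i k \<omega>)" for i
    using Zmod_eq continuous_paths
  proof eventually_elim
    case (elim \<omega>)
    let ?r = "\<lambda>k. integral {p i k..p i (Suc k)} (\<lambda>s. (\<eta> s \<omega> - \<eta> (p i (Suc k)) \<omega>) *\<^sub>R dw s)" and ?j = "\<lambda>k. (\<eta> (p i (Suc k)) \<omega> - \<eta> (p i k) \<omega>) *\<^sub>R w (p i k)"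
    have cZ: "continuous_on {0..T} (\<lambda>s. Zmod s \<omega>)"
      using elim by (subst continuous_on_cong[OF refl, of _ _ "\<lambda>s. Z s \<omega>"]) auto
    have ce: "continuous_on {0..T} (\<lambda>s. \<eta> s \<omega>)"
      unfolding \<eta>_def by (intro continuous_intros cZ)
    have ce': "continuous_on S (\<lambda>s. \<eta> s \<omega>)" if "S \<subseteq> {0..T}" for S using ce that by (rule continuous_on_subset)
    have cdw: "continuous_on S dw" for S using dw by (rule continuous_on_subset) simp
    have R: "R i k \<omega> = \<xi> \<omega> *\<^sub>R ?r k" if k: "k < Suc i" for k
    proof -
      have c: "continuous_on {p i k..p i (Suc k)} (\<lambda>s. (\<eta> s \<omega> - \<eta> (p i (Suc k)) \<omega>) *\<^sub>R dw s)"
        using pin[of k i] pin[of "Suc k" i] k by (intro continuous_intros ce' cdw) auto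
      have "R i k \<omega> = (LINT s:{p i k..p i (Suc k)}|lborel. \<xi> \<omega> *\<^sub>R ((\<eta> s \<omega> - \<eta> (p i (Suc k)) \<omega>) *\<^sub>R dw s))"
        unfolding R_def \<eta>_def by simp
      also have "\<dots> = \<xi> \<omega> *\<^sub>R (LINT s:{p i k..p i (Suc k)}|lborel. (\<eta> s \<omega> - \<eta> (p i (Suc k)) \<omega>) *\<^sub>R dw s)"
        by (rule set_integral_scaleR_right)
      finally show ?thesis using lint_eq_integral(2)[OF c] by simp
    qed
    have J: "simple_integral Z (Suc i) (p i) (\<zeta> i) \<omega> = \<xi> \<omega> *\<^sub>R (\<Sum>k<Suc i. ?j k)"
      unfolding simple_integral_def scaleR_sum_right
    proof (intro sum.cong refl)
      fix k assume "k \<in> {..<Suc i}"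
      then have "Zmod (p i k) \<omega> = Z (p i k) \<omega>" "Zmod (p i (Suc k)) \<omega> = Z (p i (Suc k)) \<omega>"
        using elim(1) pin[of k i] pin[of "Suc k" i] by auto
      then show "\<zeta> i k \<omega> *v (Z (p i (Suc k)) \<omega> - Z (p i k) \<omega>) = \<xi> \<omega> *\<^sub>R ?j k"
        by (simp add: \<zeta>_def \<eta>_def column_matrix_mult_vector flip: scaleR_matrix_vector_assoc)
    qed
    have "(\<Sum>k<Suc i. R i k \<omega>) = \<xi> \<omega> *\<^sub>R (\<Sum>k<Suc i. ?r k)"
      unfolding scaleR_sum_right using R by (intro sum.cong) auto
    then have "simple_integral Z (Suc i) (p i) (\<zeta> i) \<omega> + (\<Sum>k<Suc i. R i k \<omega>) = \<xi> \<omega> *\<^sub>R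
      (\<Sum>k<Suc i. ?j k + ?r k)"
      unfolding J sum.distrib scaleR_add_right by simp
    also have "\<dots> = \<xi> \<omega> *\<^sub>R (\<eta> q \<omega> *\<^sub>R w q - \<eta> t \<omega> *\<^sub>R w t + integral {t..q} (\<lambda>s. \<eta> s \<omega> *\<^sub>R dw s))"
      using summation_by_parts_integral[OF w dw, of "Suc i" "p i" "\<lambda>s. \<eta> s \<omega>"] rt h0[of i] ce'[of "{t..q}"]
      unfolding p0 pn by (simp add: pS)
    also have "integral {t..q} (\<lambda>s. \<eta> s \<omega> *\<^sub>R dw s) = (LINT s:{t..q}|lborel. \<eta> s \<omega> *\<^sub>R dw s)"
      by (rule lint_eq_integral(2)[symmetric]) (use rt in \<open>auto intro!: continuous_intros ce' cdw\<close>)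
    finally show ?case unfolding I_def by (simp add: algebra_simps)
  qed
  \<comment> \<open>The \<open>Suc i\<close> errors are summed crudely, at the cost of a factor
    \<open>Suc i\<close> in the square of the sum. Each has second moment of order
    \<open>h^3\<close>, so the total is still of order \<open>h\<close>.\<close>
  have E2: "sqint M (\<lambda>\<omega>. I \<omega> - simple_integral Z (Suc i) (p i) (\<zeta> i) \<omega>)
    \<le> ennreal (real (Suc i) * (real (Suc i) * (?b i)))" for i
  proof -
    have "sqint M (\<lambda>\<omega>. I \<omega> - simple_integral Z (Suc i) (p i) (\<zeta> i) \<omega>)
      \<le> (\<integral>\<^sup>+\<omega>. ennreal (real (Suc i)) * (\<Sum>k<Suc i. ennreal ((norm (R i k \<omega>))\<^sup>2)) \<partial>M)"
      using IJ[of i]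
    proof (intro nn_integral_mono_AE, eventually_elim)
      case (elim \<omega>)
      have "(norm (\<Sum>k<Suc i. R i k \<omega>))\<^sup>2 \<le> (\<Sum>k<Suc i. norm (R i k \<omega>))\<^sup>2"
        by (intro power_mono norm_sum) auto
      also have "\<dots> \<le> (\<Sum>k<Suc i. (norm (R i k \<omega>))\<^sup>2) * card {..<Suc i}"
        by (rule sum_squared_le_sum_of_squares)
      finally have "(norm (\<Sum>k<Suc i. R i k \<omega>))\<^sup>2 \<le> real (Suc i) * (\<Sum>k<Suc i. (norm (R i k \<omega>))\<^sup>2)"
        by (simp add: mult.commute del: sum.lessThan_Suc of_nat_Suc)
      then have "ennreal ((norm (\<Sum>k<Suc i. R i k \<omega>))\<^sup>2) \<le> ennreal (real (Suc i) * (\<Sum>k<Suc i. (norm (R i k \<omega>))\<^sup>2))"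
        by (rule ennreal_leI)
      also have "\<dots> = ennreal (real (Suc i)) * (\<Sum>k<Suc i. ennreal ((norm (R i k \<omega>))\<^sup>2))"
        by (subst ennreal_mult) (auto simp: sum_nonneg simp del: sum.lessThan_Suc of_nat_Suc)
      finally show ?case unfolding elim .
    qed
    also have "\<dots> = ennreal (real (Suc i)) * (\<Sum>k<Suc i. sqint M (R i k))"
    proof -
      have m: "(\<lambda>\<omega>. ennreal ((norm (R i k \<omega>))\<^sup>2)) \<in> borel_measurable M" if "k \<in> {..<Suc i}" for k
      proof -
        have [measurable]: "R i k \<in> borel_measurable M" using Rm that by simp
        show ?thesis by measurable
      qed
      show ?thesis
        by (subst nn_integral_cmult, intro borel_measurable_sum m, assumption)
           (subst nn_integral_sum[OF m], auto simp del: sum.lessThan_Suc of_nat_Suc)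
    qed
    also have "\<dots> \<le> ennreal (real (Suc i)) * (\<Sum>k<Suc i. ennreal (?b i))"
      by (intro mult_left_mono sum_mono RE) auto
    also have "\<dots> = ennreal (real (Suc i)) * ennreal (real (Suc i) * (?b i))"
      using h0[of i] e0 by (subst sum_ennreal) (auto simp del: sum.lessThan_Suc of_nat_Suc)
    also have "\<dots> = ennreal (real (Suc i) * (real (Suc i) * (?b i)))"
      using h0[of i] e0 by (subst ennreal_mult) auto
    finally show ?thesis .
  qed
  have ht: "h \<longlonglongrightarrow> 0"
    using tendsto_mult[OF tendsto_const[of "q - t"] LIMSEQ_inverse_real_of_nat] by (simp add: h_def[abs_def] divide_inverse)
  show ?thesis unfolding I_def[symmetric] has_ito_integral_def
  proof (intro conjI Im exI[of _ Suc] exI[of _ p] exI[of _ \<zeta>] allI sd)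
    show "(\<lambda>i. sqint2 ?N (\<lambda>s \<omega>. ?\<delta> i s \<omega>)) \<longlonglongrightarrow> 0"
    proof (rule tendsto_sandwich[OF _ _ tendsto_const])
      have "(\<lambda>i. (D * h i)\<^sup>2 * e * (q - t)) \<longlonglongrightarrow> (D * 0)\<^sup>2 * e * (q - t)" by (intro tendsto_intros ht)
      from tendsto_ennrealI[OF this] show "(\<lambda>i. ennreal ((D * h i)\<^sup>2 * e * (q - t))) \<longlonglongrightarrow> 0" by simp
    qed (use E1 in auto)
    show "(\<lambda>i. sqint M (\<lambda>\<omega>. I \<omega> - simple_integral Z (Suc i) (p i) (\<zeta> i) \<omega>)) \<longlonglongrightarrow> 0"
    proof (rule tendsto_sandwich[OF _ _ tendsto_const])
      have eq: "real (Suc i) * (real (Suc i) * (?b i)) = 2 * D\<^sup>2 * e * (q - t)\<^sup>2 * h i" for i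
        unfolding hn[of i, symmetric] by (simp add: power2_eq_square mult_ac del: of_nat_Suc)
      have "(\<lambda>i. 2 * D\<^sup>2 * e * (q - t)\<^sup>2 * h i) \<longlonglongrightarrow> 2 * D\<^sup>2 * e * (q - t)\<^sup>2 * 0" by (intro tendsto_intros ht)
      from tendsto_ennrealI[OF this]
      show "(\<lambda>i. ennreal (real (Suc i) * (real (Suc i) * (?b i)))) \<longlonglongrightarrow> 0"
        unfolding eq by simp
    qed (use E2 in auto)
  qed
qed

section \<open>Steering to zero\<close>

lemma drift_add:
  "drift A H (padd U U') (padd Y Y') (padd V V') s \<omega>
   = drift A H U Y V s \<omega> + drift A H U' Y' V' s \<omega>"
  by (simp add: drift_def matrix_vector_right_distrib linear_add[OF linear_column] sum.distrib)

lemma drift_zero: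
  assumes "U s \<omega> = 0" "Y s \<omega> = 0" "V s \<omega> = 0" shows "drift A H U Y V s \<omega> = 0"
  using assms by (simp add: drift_def linear_0[OF linear_column])

abbreviation solves_at where
  "solves_at A H U Y V t \<equiv> \<exists>I. ito t T V I \<and> (AE \<omega> in M. Y t \<omega> = drift_integral A H U Y V t \<omega> - I \<omega>)"

text \<open>A solution on \<open>{r..T}\<close> with terminal value 0, extended by 0 to the times
  before \<open>r\<close>. The extension turns pasting at \<open>r\<close> into addition of
  processes, and the case \<open>t = T\<close> of the equation contains the terminal
  condition.\<close>

definition null_solution ::
  "real^'d^'d \<Rightarrow> real^'m^'d \<Rightarrow> real \<Rightarrow> (real \<Rightarrow> 'w \<Rightarrow> real^'m) \<Rightarrow> (real \<Rightarrow> 'w \<Rightarrow> real^'d) \<Rightarrow> (real \<Rightarrow> 'w \<Rightarrow> real^'m^'d) \<Rightarrow> bool"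
  where "null_solution A H r U Y V \<longleftrightarrow>
    U \<in> L2a \<and> Y \<in> L2a \<and> V \<in> L2a \<and>
    (\<forall>t \<omega>. t < r \<longrightarrow> U t \<omega> = 0 \<and> Y t \<omega> = 0 \<and> V t \<omega> = 0) \<and>
    (\<forall>t\<in>{r..T}. solves_at A H U Y V t)"

text \<open>The coefficient \<open>\<xi>\<close> is square-integrable rather than bounded because
  the coefficients created by a block, \<open>\<xi>\<close> times a Gaussian increment, are in
  general unbounded. Independence keeps them square-integrable.\<close>

definition steerable :: "real^'d^'d \<Rightarrow> real^'m^'d \<Rightarrow> real \<Rightarrow> (real^'d) set" where
  "steerable A H r = {y. \<forall>\<xi>. \<xi> \<in> borel_measurable (F r) \<longrightarrow> integrable M (\<lambda>\<omega>. (\<xi> \<omega>)\<^sup>2) \<longrightarrow>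
     (\<exists>U Y V. null_solution A H r U Y V \<and> (AE \<omega> in M. Y r \<omega> = \<xi> \<omega> *\<^sub>R y))}"

lemma L2_adapted_joint_restrict:
  fixes X :: "real \<Rightarrow> 'w \<Rightarrow> 'e::euclidean_space"
  assumes "X \<in> L2a" "0 \<le> a" "b \<le> T"
  shows "joint {a..b} X"
  by (rule measurable_pair_restrict_mono[OF L2_adapted_joint[OF assms(1)]]) (use assms in auto)

lemma L2_adapted_const:
  fixes x :: "'e::euclidean_space"
  shows "(\<lambda>_ _. x) \<in> L2a"
proof -
  have "(\<integral>\<^sup>+(s,\<omega>). ennreal ((norm x)\<^sup>2) \<partial>(strip {0..T}))
      = (\<integral>\<^sup>+s. (\<integral>\<^sup>+\<omega>. ennreal ((norm x)\<^sup>2) \<partial>M) * indicator {0..T} s \<partial>lborel)"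
    by (rule nn_integral_pair_restrict) auto
  also have "\<dots> = ennreal ((norm x)\<^sup>2) * (\<integral>\<^sup>+s. indicator {0..T} s \<partial>lborel)"
    by (simp add: emeasure_space_1 nn_integral_cmult)
  also have "\<dots> < \<infinity>" by (simp add: ennreal_mult_less_top emeasure_lborel_Icc_eq)
  finally have "integrable (strip {0..T}) (\<lambda>(s,\<omega>). (norm x)\<^sup>2)"
    unfolding integrable_iff_bounded case_prod_unfold by simp
  then show ?thesis by (simp add: L2_adapted_def case_prod_unfold)
qed

lemma ito_zero: "t \<le> T \<Longrightarrow> ito t T (\<lambda>_ _. 0 :: real^'m^'d) (\<lambda>_. 0)"
  unfolding has_ito_integral_iff
  using simple_pair_zero[of t T] by (intro conjI exI[of _ "\<lambda>_ _ _. 0"] exI[of _ "\<lambda>_ _. 0"]) (auto simp: case_prod_unfold)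

lemma null_solution_add:
  assumes S: "null_solution A H r U Y V" and S': "null_solution A H r U' Y' V'" and r: "0 \<le> r"
  shows "null_solution A H r (padd U U') (padd Y Y') (padd V V')"
  unfolding null_solution_def
proof (intro conjI ballI)
  have L: "U \<in> L2a" "Y \<in> L2a" "V \<in> L2a"
    and L': "U' \<in> L2a" "Y' \<in> L2a" "V' \<in> L2a"
    using S S' by (auto simp: null_solution_def)
  show "(padd U U') \<in> L2a" "(padd Y Y') \<in> L2a"
    "(padd V V') \<in> L2a"
    by (intro L2_adapted_add L L')+
  show "\<forall>t \<omega>. t < r \<longrightarrow> U t \<omega> + U' t \<omega> = 0 \<and> Y t \<omega> + Y' t \<omega> = 0 \<and> V t \<omega> + V' t \<omega> = 0"
    using S S' by (simp add: null_solution_def)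
  fix t assume t: "t \<in> {r..T}"
  obtain I where I: "ito t T V I" "AE \<omega> in M. Y t \<omega> = drift_integral A H U Y V t \<omega> - I \<omega>"
    using S t unfolding null_solution_def by blast
  obtain I' where I': "ito t T V' I'" "AE \<omega> in M. Y' t \<omega> = drift_integral A H U' Y' V' t \<omega> - I' \<omega>"
    using S' t unfolding null_solution_def by blast
  have "ito t T (padd V V') (\<lambda>\<omega>. I \<omega> + I' \<omega>)"
    by (rule ito_add[OF I(1) L2_adapted_joint_restrict[OF L(3)] I'(1) L2_adapted_joint_restrict[OF L'(3)]]) (use t r in auto)
  moreover have "AE \<omega> in M. Y t \<omega> + Y' t \<omega> = (LINT s:{t..T}|lborel. drift A H (padd U U') (padd Y Y') (padd V V') s \<omega>) - (I \<omega> + I' \<omega>)"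
    using I(2) I'(2) drift_set_integrable[OF L, of A H] drift_set_integrable[OF L', of A H]
  proof eventually_elim
    case (elim \<omega>)
    then show ?case using t r by (simp add: drift_add set_integral_add(2))
  qed
  ultimately show "\<exists>I. ito t T (padd V V') I \<and>
      (AE \<omega> in M. Y t \<omega> + Y' t \<omega> = (LINT s:{t..T}|lborel. drift A H (padd U U') (padd Y Y') (padd V V') s \<omega>) - I \<omega>)"
    by blast
qed

lemma subspace_steerable: assumes "0 \<le> r" shows "subspace (steerable A H r)"
proof (rule subspaceI)
  have "null_solution A H r (\<lambda>_ _. 0) (\<lambda>_ _. 0) (\<lambda>_ _. 0)"
    unfolding null_solution_def
    by (auto simp: drift_zero set_lebesgue_integral_def intro!: exI[of _ "\<lambda>_. 0"] L2_adapted_const ito_zero)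
  then show "0 \<in> steerable A H r" unfolding steerable_def by auto
next
  fix x y assume x: "x \<in> steerable A H r" and y: "y \<in> steerable A H r"
  show "x + y \<in> steerable A H r" unfolding steerable_def
  proof (intro CollectI allI impI)
    fix \<xi> :: "'w \<Rightarrow> real" assume \<xi>: "\<xi> \<in> borel_measurable (F r)" "integrable M (\<lambda>\<omega>. (\<xi> \<omega>)\<^sup>2)"
    obtain U Y V where 1: "null_solution A H r U Y V" "AE \<omega> in M. Y r \<omega> = \<xi> \<omega> *\<^sub>R x"
      using x \<xi> unfolding steerable_def by blast
    obtain U' Y' V' where 2: "null_solution A H r U' Y' V'" "AE \<omega> in M. Y' r \<omega> = \<xi> \<omega> *\<^sub>R y"
      using y \<xi> unfolding steerable_def by blast
    have "AE \<omega> in M. Y r \<omega> + Y' r \<omega> = \<xi> \<omega> *\<^sub>R (x + y)"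
      using 1(2) 2(2) by eventually_elim (simp add: scaleR_add_right)
    with null_solution_add[OF 1(1) 2(1) assms]
    show "\<exists>U Y V. null_solution A H r U Y V \<and> (AE \<omega> in M. Y r \<omega> = \<xi> \<omega> *\<^sub>R (x + y))"
      by (intro exI conjI)
  qed
next
  fix c x assume x: "x \<in> steerable A H r"
  show "c *\<^sub>R x \<in> steerable A H r" unfolding steerable_def
  proof (intro CollectI allI impI)
    fix \<xi> :: "'w \<Rightarrow> real" assume \<xi>: "\<xi> \<in> borel_measurable (F r)" "integrable M (\<lambda>\<omega>. (\<xi> \<omega>)\<^sup>2)"
    \<comment> \<open>The scalar is absorbed into the random coefficient.\<close>
    have "(\<lambda>\<omega>. c * \<xi> \<omega>) \<in> borel_measurable (F r)" "integrable M (\<lambda>\<omega>. (c * \<xi> \<omega>)\<^sup>2)"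
      using \<xi> by (auto simp: power_mult_distrib)
    then obtain U Y V where "null_solution A H r U Y V" "AE \<omega> in M. Y r \<omega> = (c * \<xi> \<omega>) *\<^sub>R x"
      using x unfolding steerable_def by blast
    then show "\<exists>U Y V. null_solution A H r U Y V \<and> (AE \<omega> in M. Y r \<omega> = \<xi> \<omega> *\<^sub>R (c *\<^sub>R x))"
      by (intro exI conjI) (auto simp: mult.commute)
  qed
qed

text \<open>With \<open>\<eta> = Z^j - Z_r^j\<close>, the product rule gives \<open>-d(\<xi> (y +
  \<eta> w)) = \<xi> (A y + H u + H^j * w + \<eta> A w) dt - \<xi> w dZ^j\<close>, which is
  \<open>(A Y + H U + D_j V^j) dt - V dZ\<close> for the processes of the block. The value at
  \<open>q\<close> splits into \<open>y q\<close> with coefficient \<open>\<xi>\<close> and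
  \<open>w q\<close> with coefficient \<open>\<xi> \<eta>_q\<close>; each part is steered on
  separately and the results are added.\<close>

lemma steerable_block:
  fixes y w :: "real \<Rightarrow> real^'d" and u :: "real \<Rightarrow> real^'m"
  assumes r: "0 \<le> r" "r < q" "q \<le> T"
    and y: "\<And>s. (y has_vector_derivative - (A *v y s + H *v u s + column j H * w s)) (at s)"
    and w: "\<And>s. (w has_vector_derivative - (A *v w s)) (at s)"
    and u: "continuous_on UNIV u"
    and q: "y q \<in> steerable A H q" "w q \<in> steerable A H q"
  shows "y r \<in> steerable A H r"
  unfolding steerable_def
proof (intro CollectI allI impI)
  fix \<xi> :: "'w \<Rightarrow> real" assume \<xi>: "\<xi> \<in> borel_measurable (F r)" "integrable M (\<lambda>\<omega>. (\<xi> \<omega>)\<^sup>2)"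
  define \<eta> where "\<eta> s \<omega> = dZ j r s \<omega>" for s \<omega>
  have yc: "continuous_on UNIV y" and wc: "continuous_on UNIV w"
    using y w by (auto intro!: continuous_at_imp_continuous_on has_vector_derivative_continuous)
  have \<xi>q: "\<xi> \<in> borel_measurable (F q)" using \<xi>(1) r by (auto intro: measurable_F_mono)
  obtain U2 Y2 V2 where S2: "null_solution A H q U2 Y2 V2" "AE \<omega> in M. Y2 q \<omega> = \<xi> \<omega> *\<^sub>R y q"
    using q(1) \<xi>q \<xi>(2) unfolding steerable_def by blast
  have "(\<lambda>\<omega>. \<xi> \<omega> * \<eta> q \<omega>) \<in> borel_measurable (F q)"
  proof -
    have "Zmod q \<in> borel_measurable (F q)" "Zmod r \<in> borel_measurable (F q)"
      using Zmod_F[of q] measurable_F_mono[OF Zmod_F[of r], of q] r by auto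
    then show ?thesis using \<xi>q unfolding \<eta>_def by measurable
  qed
  moreover from measurable_F_imp[OF this] have "integrable M (\<lambda>\<omega>. (\<xi> \<omega> * \<eta> q \<omega>)\<^sup>2)"
    using Zmod_increment_sq[OF \<xi>, of r q j] r unfolding \<eta>_def by (simp add: integrable_iff_bounded)
  ultimately obtain U3 Y3 V3 where S3: "null_solution A H q U3 Y3 V3" "AE \<omega> in M. Y3 q \<omega> = (\<xi> \<omega> * \<eta> q \<omega>) *\<^sub>R w q"
    using q(2) unfolding steerable_def by blast
  define U' where "U' t \<omega> = U2 t \<omega> + U3 t \<omega>" for t \<omega>
  define Y' where "Y' t \<omega> = Y2 t \<omega> + Y3 t \<omega>" for t \<omega>
  define V' where "V' t \<omega> = V2 t \<omega> + V3 t \<omega>" for t \<omega>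
  have S': "null_solution A H q U' Y' V'"
    unfolding U'_def[abs_def] Y'_def[abs_def] V'_def[abs_def]
    by (rule null_solution_add[OF S2(1) S3(1)]) (use r in simp)
  have Y'q: "AE \<omega> in M. Y' q \<omega> = \<xi> \<omega> *\<^sub>R (y q + \<eta> q \<omega> *\<^sub>R w q)"
    using S2(2) S3(2) by eventually_elim (simp add: Y'_def scaleR_add_right)
  have L': "U' \<in> L2a" "Y' \<in> L2a" "V' \<in> L2a"
    and zero': "\<And>t \<omega>. t < q \<Longrightarrow> U' t \<omega> = 0" "\<And>t \<omega>. t < q \<Longrightarrow> Y' t \<omega> = 0" "\<And>t \<omega>. t < q \<Longrightarrow> V' t \<omega> = 0"
    using S' by (auto simp: null_solution_def)
  \<comment> \<open>The block is switched off at \<open>q\<close> itself, since the continuation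
    \<open>Y'\<close> already supplies the whole state there.\<close>
  define Ub where "Ub s \<omega> = indicator {r..<q} s *\<^sub>R (\<xi> \<omega> *\<^sub>R u s)" for s \<omega>
  define Yb where "Yb s \<omega> = indicator {r..<q} s *\<^sub>R (\<xi> \<omega> *\<^sub>R (y s + \<eta> s \<omega> *\<^sub>R w s))" for s \<omega>
  define Vb where "Vb s \<omega> = indicator {r..<q} s *\<^sub>R (\<xi> \<omega> *\<^sub>R column_matrix j (w s))" for s \<omega>
  have wc': "continuous_on UNIV (\<lambda>s. column_matrix j (w s))"
    by (rule bounded_linear.continuous_on[OF _ wc]) (use linear_column_matrix in \<open>simp add: linear_conv_bounded_linear\<close>)
  have rq: "0 \<le> r" "r \<le> T" "q \<le> T" using r by auto
  have Lb: "Ub \<in> L2a" "Yb \<in> L2a" "Vb \<in> L2a"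
    using block_process_L2_adapted[OF \<xi> rq u continuous_on_const[of UNIV 0], of j]
      block_process_L2_adapted[OF \<xi> rq yc wc, of j]
      block_process_L2_adapted[OF \<xi> rq wc' continuous_on_const[of UNIV 0], of j]
    by (simp_all add: Ub_def[abs_def] Yb_def[abs_def] Vb_def[abs_def] \<eta>_def)
  have zerob: "Ub s \<omega> = 0" "Yb s \<omega> = 0" "Vb s \<omega> = 0" if "s \<notin> {r..<q}" for s \<omega>
    using that by (auto simp: Ub_def Yb_def Vb_def)
  define U where "U t \<omega> = Ub t \<omega> + U' t \<omega>" for t \<omega>
  define Y where "Y t \<omega> = Yb t \<omega> + Y' t \<omega>" for t \<omega>
  define V where "V t \<omega> = Vb t \<omega> + V' t \<omega>" for t \<omega>
  have L: "U \<in> L2a" "Y \<in> L2a" "V \<in> L2a"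
    unfolding U_def[abs_def] Y_def[abs_def] V_def[abs_def] by (intro L2_adapted_add Lb L')+
  have dr: "drift A H U Y V s \<omega> = drift A H Ub Yb Vb s \<omega> + drift A H U' Y' V' s \<omega>" for s \<omega>
    unfolding U_def[abs_def] Y_def[abs_def] V_def[abs_def] by (rule drift_add)
  have late: "solves_at A H U Y V t"
    if t: "t \<in> {q..T}" for t
  proof -
    obtain I where I: "ito t T V' I" "AE \<omega> in M. Y' t \<omega> = drift_integral A H U' Y' V' t \<omega> - I \<omega>"
      using S' t unfolding null_solution_def by blast
    have "ito t T V I"
      by (rule ito_extend[OF I(1) L2_adapted_joint_restrict[OF L'(3)] L2_adapted_joint_restrict[OF L(3)]])
         (use t r in \<open>auto simp: V_def zerob\<close>)
    moreover have "drift_integral A H U Y V t \<omega> = drift_integral A H U' Y' V' t \<omega>" for \<omega>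
      by (rule set_lebesgue_integral_cong) (use t in \<open>auto simp: dr drift_zero zerob\<close>)
    moreover have "Y t \<omega> = Y' t \<omega>" for \<omega> using t by (simp add: Y_def zerob)
    ultimately show ?thesis using I(2) by auto
  qed
  \<comment> \<open>The integral over \<open>{t..T}\<close> is obtained by extending the block by
    zero beyond \<open>q\<close> and the continuation by zero before \<open>q\<close>, and adding
    the two.\<close>
  have early: "solves_at A H U Y V t"
    if t: "r \<le> t" "t < q" for t
  proof -
    obtain I' where I': "ito q T V' I'" "AE \<omega> in M. Y' q \<omega> = (LINT s:{q..T}|lborel. drift A H U' Y' V' s \<omega>) - I' \<omega>"
    proof -
      have "q \<in> {q..T}" using r by simp
      then show ?thesis using that S' unfolding null_solution_def by blast
    qed
    have cAw: "continuous_on UNIV (\<lambda>s. A *v w s)" by (rule bounded_linear.continuous_on[OF matrix_vector_mul_bounded_linear wc])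
    define Ib where "Ib \<omega> = \<xi> \<omega> *\<^sub>R (\<eta> q \<omega> *\<^sub>R w q - \<eta> t \<omega> *\<^sub>R w t + (LINT s:{t..q}|lborel. \<eta> s \<omega> *\<^sub>R (A *v w s)))" for \<omega>
    have b: "ito t q (\<lambda>s \<omega>. \<xi> \<omega> *\<^sub>R column_matrix j (w s)) Ib"
      unfolding Ib_def[abs_def] \<eta>_def by (rule ito_block[OF \<xi> _ _ _ _ w cAw]) (use r t in auto)
    have \<xi>M[measurable]: "\<xi> \<in> borel_measurable M" using measurable_F_imp[OF \<xi>(1)] r by simp
    have cm: "(\<lambda>s. column_matrix j (w s)) \<in> borel_measurable borel" by (rule borel_measurable_continuous_onI[OF wc'])
    have "fst \<in> borel_measurable (strip {t..q})"
      using measurable_compose[OF measurable_fst measurable_restrict_space1[of "\<lambda>x. x" lborel borel "{t..q}"]] by simp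
    from measurable_compose[OF this cm]
    have [measurable]: "(\<lambda>x. column_matrix j (w (fst x))) \<in> borel_measurable (strip {t..q})" .
    have bm: "(\<lambda>(s,\<omega>). \<xi> \<omega> *\<^sub>R column_matrix j (w s)) \<in> borel_measurable (strip {t..q})"
      unfolding case_prod_unfold by measurable
    have eb: "ito t T Vb Ib"
      by (rule ito_extend[OF b bm L2_adapted_joint_restrict[OF Lb(3)]]) (use r t in \<open>auto simp: Vb_def\<close>)
    have e': "ito t T V' I'"
      by (rule ito_extend[OF I'(1) L2_adapted_joint_restrict[OF L'(3)] L2_adapted_joint_restrict[OF L'(3)]])
         (use r t in \<open>auto simp: zero'\<close>)
    have ito: "ito t T V (\<lambda>\<omega>. Ib \<omega> + I' \<omega>)"
      unfolding V_def[abs_def]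
      by (rule ito_add[OF eb L2_adapted_joint_restrict[OF Lb(3)] e' L2_adapted_joint_restrict[OF L'(3)]]) (use r t in auto)
    have "AE \<omega> in M. Y t \<omega> = drift_integral A H U Y V t \<omega> - (Ib \<omega> + I' \<omega>)"
      using I'(2) Y'q drift_set_integrable[OF Lb, of A H] drift_set_integrable[OF L', of A H] Zmod_eq continuous_paths
    proof eventually_elim
      case (elim \<omega>)
      have c\<eta>: "continuous_on {t..q} (\<lambda>s. \<eta> s \<omega>)"
      proof -
        have "continuous_on {0..T} (\<lambda>s. Zmod s \<omega>)"
          using elim by (subst continuous_on_cong[OF refl, of _ _ "\<lambda>s. Z s \<omega>"]) auto
        then have "continuous_on {t..q} (\<lambda>s. Zmod s \<omega>)" by (rule continuous_on_subset) (use r t in auto)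
        then show ?thesis unfolding \<eta>_def by (intro continuous_intros)
      qed
      have c: "continuous_on {t..q} g" if "continuous_on UNIV g" for g :: "real \<Rightarrow> real^'d"
        using that by (rule continuous_on_subset) simp
      define G where "G s = A *v y s + H *v u s + column j H * w s" for s
      have Gc: "continuous_on UNIV G"
        unfolding G_def times_vec_def
        by (intro continuous_intros bounded_linear.continuous_on[OF matrix_vector_mul_bounded_linear] yc u wc)
      have G: "(LINT s:{t..q}|lborel. G s) = y t - y q"
      proof -
        have "((\<lambda>s. - G s) has_integral (y q - y t)) {t..q}"
          unfolding G_def by (rule fundamental_theorem_of_calculus[OF less_imp_le[OF t(2)]]) (rule has_vector_derivative_at_within[OF y])
        from has_integral_neg[OF this] have "integral {t..q} G = y t - y q" by (simp add: integral_unique)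
        then show ?thesis using lint_eq_integral(2)[OF c[OF Gc]] by simp
      qed
      have c2: "continuous_on {t..q} (\<lambda>s. \<eta> s \<omega> *\<^sub>R (A *v w s))" by (intro continuous_intros c\<eta> c[OF cAw])
      have pt: "drift A H Ub Yb Vb s \<omega> = \<xi> \<omega> *\<^sub>R (G s + \<eta> s \<omega> *\<^sub>R (A *v w s))" if "s \<in> {t..<q}" for s
      proof -
        have s: "indicator {r..<q} s = (1::real)" using that t by auto
        have "(\<Sum>k\<in>UNIV. diag (column k H) *v column k (Vb s \<omega>)) = (\<Sum>k\<in>UNIV. if k = j then \<xi> \<omega> *\<^sub>R (column j H * w s) else 0)"
          unfolding Vb_def s
          by (intro sum.cong) (auto simp: linear_cmul[OF linear_column] column_column_matrix diag_mult_vector)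
        then show ?thesis
          by (simp add: drift_def Ub_def Yb_def s G_def linear_cmul[OF matrix_vector_mul_linear] matrix_vector_right_distrib algebra_simps)
      qed
      \<comment> \<open>At \<open>s = q\<close> the two sides may differ, because the block is off
        there while the closed interval on the right contains \<open>q\<close>.\<close>
      have ae: "AE s in lborel. indicator {t..T} s *\<^sub>R drift A H Ub Yb Vb s \<omega> = indicator {t..q} s *\<^sub>R (\<xi> \<omega> *\<^sub>R (G s + \<eta> s \<omega> *\<^sub>R (A *v w s)))"
        using AE_lborel_singleton[of q]
      proof eventually_elim
        case (elim s)
        consider "s < t" | "t \<le> s \<and> s < q" | "q < s" using elim by linarith
        then show ?case
        proof cases
          case 3
          then show ?thesis using zerob[of s \<omega>] by (simp add: drift_zero)
        qed (use pt r in auto)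
      qed
      have "drift_integral A H Ub Yb Vb t \<omega> = (LINT s:{t..q}|lborel. \<xi> \<omega> *\<^sub>R (G s + \<eta> s \<omega> *\<^sub>R (A *v w s)))"
        unfolding set_lebesgue_integral_def
      proof (rule integral_cong_AE[OF _ _ ae])
        show "(\<lambda>s. indicator {t..T} s *\<^sub>R drift A H Ub Yb Vb s \<omega>) \<in> borel_measurable lborel"
        proof (rule borel_measurable_integrable)
          show "integrable lborel (\<lambda>s. indicator {t..T} s *\<^sub>R drift A H Ub Yb Vb s \<omega>)"
            using elim(3) r t unfolding set_integrable_def by simp
        qed
        have "set_integrable lborel {t..q} (\<lambda>s. \<xi> \<omega> *\<^sub>R (G s + \<eta> s \<omega> *\<^sub>R (A *v w s)))"
          by (rule lint_eq_integral(1)) (intro continuous_intros c[OF Gc] c2)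
        then show "(\<lambda>s. indicator {t..q} s *\<^sub>R \<xi> \<omega> *\<^sub>R (G s + \<eta> s \<omega> *\<^sub>R (A *v w s))) \<in> borel_measurable lborel"
          unfolding set_integrable_def by (rule borel_measurable_integrable)
      qed
      also have "\<dots> = \<xi> \<omega> *\<^sub>R (LINT s:{t..q}|lborel. G s + \<eta> s \<omega> *\<^sub>R (A *v w s))" by (rule set_integral_scaleR_right)
      also have "(LINT s:{t..q}|lborel. G s + \<eta> s \<omega> *\<^sub>R (A *v w s)) = y t - y q + (LINT s:{t..q}|lborel. \<eta> s \<omega> *\<^sub>R (A *v w s))"
        using set_integral_add(2)[OF lint_eq_integral(1)[OF c[OF Gc]] lint_eq_integral(1)[OF c2]] G by simp
      finally have 1: "drift_integral A H Ub Yb Vb t \<omega> = \<xi> \<omega> *\<^sub>R (y t - y q + (LINT s:{t..q}|lborel. \<eta> s \<omega> *\<^sub>R (A *v w s)))" .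
      have "indicator {t..T} s *\<^sub>R drift A H U' Y' V' s \<omega> = indicator {q..T} s *\<^sub>R drift A H U' Y' V' s \<omega>" for s
        using t by (cases "s < q") (auto simp: drift_zero[OF zero'] indicator_def)
      then have "drift_integral A H U' Y' V' t \<omega> = (LINT s:{q..T}|lborel. drift A H U' Y' V' s \<omega>)"
        unfolding set_lebesgue_integral_def by presburger
      then have 2: "drift_integral A H U' Y' V' t \<omega> = \<xi> \<omega> *\<^sub>R (y q + \<eta> q \<omega> *\<^sub>R w q) + I' \<omega>"
        using elim(1,2) by simp
      have "drift_integral A H U Y V t \<omega> = drift_integral A H Ub Yb Vb t \<omega> + drift_integral A H U' Y' V' t \<omega>"
        unfolding dr using elim(3,4) r t by (intro set_integral_add(2)) auto
      moreover have "Y t \<omega> = \<xi> \<omega> *\<^sub>R (y t + \<eta> t \<omega> *\<^sub>R w t)"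
        using t zero'(2)[of t \<omega>] by (simp add: Y_def Yb_def)
      ultimately show ?case unfolding 1 2 Ib_def by (simp add: algebra_simps)
    qed
    with ito show ?thesis by blast
  qed
  have "null_solution A H r U Y V"
    unfolding null_solution_def
  proof (intro conjI L ballI allI impI)
    fix t assume "t \<in> {r..T}"
    then show "solves_at A H U Y V t"
      using early[of t] late[of t] by (cases "t < q") auto
  qed (use r in \<open>auto simp: U_def Y_def V_def zerob zero'\<close>)
  \<comment> \<open>At \<open>r\<close> the increment \<open>\<eta> r\<close> is 0, so the start
    value is \<open>\<xi>\<close> times the fixed vector \<open>y r\<close>.\<close>
  moreover have "Y r \<omega> = \<xi> \<omega> *\<^sub>R y r" for \<omega>
    using r zero'(2)[of r \<omega>] by (simp add: Y_def Yb_def \<eta>_def)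
  ultimately show "\<exists>U Y V. null_solution A H r U Y V \<and> (AE \<omega> in M. Y r \<omega> = \<xi> \<omega> *\<^sub>R y r)"
    by (intro exI conjI AE_I2)
qed

section \<open>The controllable subspace\<close>

text \<open>The linear flow is started at \<open>(y, w, u)\<close> and run backwards from time
  \<open>q = r + h\<close>, with the control held constant. Its first component at time
  \<open>r\<close> is then steerable at \<open>r\<close>, as is \<open>y\<close>, so the difference
  quotient stays in the subspace \<open>steerable A H r\<close>, which is closed in finite
  dimension; the limit is the claimed vector. Since \<open>q\<close> varies, \<open>y\<close> and
  \<open>w\<close> are taken steerable at all times before \<open>T\<close>.\<close>

lemma steerable_derivative:
  fixes y w :: "real^'d" and u :: "real^'m"
  assumes r: "0 \<le> r" "r < T"
    and y: "\<And>s. 0 \<le> s \<Longrightarrow> s < T \<Longrightarrow> y \<in> steerable A H s"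
    and w: "\<And>s. 0 \<le> s \<Longrightarrow> s < T \<Longrightarrow> w \<in> steerable A H s"
  shows "A *v y + H *v u + column j H * w \<in> steerable A H r"
proof -
  define B where "B = (\<lambda>(y, w, u). (A *v y + H *v u + column j H * w, A *v w, 0 :: real^'m))"
  have "linear B"
    by (rule linearI)
       (auto simp: B_def matrix_vector_right_distrib linear_cmul[OF matrix_vector_mul_linear] distrib_left scaleR_add_right
             mult_scaleR_right[where 'a="real^'d"])
  then obtain z where z0: "z 0 = (y, w, u)" and z: "\<And>t. (z has_vector_derivative B (z t)) (at t)"
    using linear_flow_exists[of B "(y, w, u)"] by metis
  have zr: "((\<lambda>s. z (q - s)) has_vector_derivative - B (z (q - s))) (at s)" for q s
  proof -
    have "((\<lambda>s. q - s) has_vector_derivative - 1) (at s)" by (auto intro!: derivative_eq_intros)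
    from vector_diff_chain_at[OF this z] show ?thesis by (simp add: comp_def)
  qed
  \<comment> \<open>The bound \<open>h < T - r\<close> keeps \<open>q\<close> strictly before
    \<open>T\<close>, where the hypotheses on \<open>y\<close> and \<open>w\<close> apply.\<close>
  have mem: "fst (z h) \<in> steerable A H r" if h: "0 < h" "h < T - r" for h
  proof -
    define q where "q = r + h"
    have q: "r < q" "q \<le> T" "0 \<le> q" "q < T" using h r by (auto simp: q_def)
    have f: "((\<lambda>s. fst (z (q - s))) has_vector_derivative - fst (B (z (q - s)))) (at s)"
      and s: "((\<lambda>s. snd (z (q - s))) has_vector_derivative - snd (B (z (q - s)))) (at s)" for s
      using bounded_linear.has_vector_derivative[OF bounded_linear_fst zr, of q s]
        bounded_linear.has_vector_derivative[OF bounded_linear_snd zr, of q s] by simp_all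
    have sf: "((\<lambda>s. fst (snd (z (q - s)))) has_vector_derivative - fst (snd (B (z (q - s))))) (at s)"
      and ss: "((\<lambda>s. snd (snd (z (q - s)))) has_vector_derivative - snd (snd (B (z (q - s))))) (at s)" for s
      using bounded_linear.has_vector_derivative[OF bounded_linear_fst s, of s]
        bounded_linear.has_vector_derivative[OF bounded_linear_snd s, of s] by simp_all
    have B1: "fst (B p) = A *v fst p + H *v snd (snd p) + column j H * fst (snd p)"
      and B2: "fst (snd (B p)) = A *v fst (snd p)" for p
      by (simp_all add: B_def case_prod_unfold)
    have uc: "continuous_on UNIV (\<lambda>s. snd (snd (z (q - s))))"
      using ss by (auto intro!: continuous_at_imp_continuous_on has_vector_derivative_continuous)
    have "fst (z (q - r)) \<in> steerable A H r"
      by (rule steerable_block[where y="\<lambda>s. fst (z (q - s))" and w="\<lambda>s. fst (snd (z (q - s)))" and j=j,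
            OF r(1) q(1,2) f[unfolded B1] sf[unfolded B2] uc])
         (use y[OF q(3,4)] w[OF q(3,4)] z0 in auto)
    then show ?thesis by (simp add: q_def)
  qed
  have sub: "subspace (steerable A H r)" by (rule subspace_steerable[OF r(1)])
  define v where "v = A *v y + H *v u + column j H * w"
  have "(z has_vector_derivative B (z 0)) (at 0)" by (rule z)
  from bounded_linear.has_vector_derivative[OF bounded_linear_fst this]
  have "((\<lambda>h. fst (z h)) has_vector_derivative v) (at 0)" by (simp add: z0 B_def v_def)
  then have "((\<lambda>h. fst (z h)) has_vector_derivative v) (at 0 within {0<..})" by (rule has_vector_derivative_at_within)
  then have lim: "((\<lambda>h. (1 / norm (h - 0)) *\<^sub>R (fst (z h) - (fst (z 0) + (h - 0) *\<^sub>R v))) \<longlongrightarrow> 0) (at_right 0)"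
    unfolding has_vector_derivative_def has_derivative_within by blast
  have "\<forall>\<^sub>F h in at_right 0. h < T - r" using r by (intro eventually_at_rightI[of 0 "T - r"]) auto
  moreover have "\<forall>\<^sub>F h in at_right (0::real). 0 < h" by (simp add: eventually_at_filter)
  ultimately have "\<forall>\<^sub>F h in at_right 0. (1 / norm (h - 0)) *\<^sub>R (fst (z h) - (fst (z 0) + (h - 0) *\<^sub>R v)) + v \<in> steerable A H r"
  proof eventually_elim
    case (elim h)
    \<comment> \<open>For \<open>h > 0\<close> the remainder term of the derivative plus
      \<open>v\<close> is exactly the difference quotient; hence the limit is taken from the right
      only.\<close>
    have "(1 / norm (h - 0)) *\<^sub>R (fst (z h) - (fst (z 0) + (h - 0) *\<^sub>R v)) + v = (1 / h) *\<^sub>R (fst (z h) - fst (z 0))"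
      using elim by (simp add: scaleR_diff_right scaleR_add_right)
    then show ?case using mem[OF elim(2,1)] y[OF r] z0 sub by (auto intro!: subspace_scale subspace_diff)
  qed
  moreover have "((\<lambda>h. (1 / norm (h - 0)) *\<^sub>R (fst (z h) - (fst (z 0) + (h - 0) *\<^sub>R v)) + v) \<longlongrightarrow> 0 + v) (at_right 0)"
    by (intro tendsto_add lim tendsto_const)
  ultimately have "0 + v \<in> steerable A H r"
    by (intro Lim_in_closed_set[OF closed_subspace[OF sub]]) auto
  then show ?thesis by (simp add: v_def)
qed

text \<open>The vectors steerable at every time before \<open>T\<close> form a subspace
  \<open>K\<close> that is stable under \<open>A\<close> and all \<open>D_j\<close> and contains
  each column of \<open>H\<close>. Hence the sum of \<open>K\<close> and the line through
  \<open>1\<close> is stable too: \<open>A\<close> kills \<open>1\<close>, and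
  \<open>H^j * 1 = H^j\<close> lies in \<open>K\<close>.\<close>

lemma generated_subset_steerable:
  assumes "0 < T" and A1: "A *v (1 :: real^'d) = 0"
  shows "span (generated_vectors A H) \<subseteq> {c *\<^sub>R 1 + k |c k. k \<in> steerable A H 0}"
proof -
  define K where "K = {k. \<forall>s. 0 \<le> s \<longrightarrow> s < T \<longrightarrow> k \<in> steerable A H s}"
  have K: "subspace K"
    using subspace_steerable[of _ A H] unfolding K_def subspace_def by auto
  have step: "A *v y + H *v u + column j H * w \<in> K" if "y \<in> K" "w \<in> K" for y w u j
    using that unfolding K_def by (auto intro!: steerable_derivative)
  have z: "0 \<in> K" using K by (rule subspace_0)
  have KA: "A *v y \<in> K" if "y \<in> K" for y using step[OF that z, of 0] by simp
  have KH: "column j H * w \<in> K" if "w \<in> K" for w j using step[OF z that, of 0 j] by simp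
  \<comment> \<open>With \<open>y = w = 0\<close> the derivative is \<open>H *v u\<close>, and a
    unit control picks out one column.\<close>
  have Kc: "column j H \<in> K" for j
    using step[OF z z, of "axis j 1"] by (simp add: matrix_vector_mult_basis)
  let ?S = "{c *\<^sub>R 1 + k |c k. k \<in> K}"
  have "generated_vectors A H \<subseteq> ?S"
  proof
    fix g assume "g \<in> generated_vectors A H"
    then show "g \<in> ?S"
    proof induction
      case one
      show ?case using z by (intro CollectI exI[of _ 1] exI[of _ 0]) auto
    next
      case (apply_A g)
      then obtain c k where "g = c *\<^sub>R 1 + k" "k \<in> K" by blast
      then have "A *v g = 0 *\<^sub>R 1 + A *v k" using A1
        by (simp add: matrix_vector_right_distrib linear_cmul[OF matrix_vector_mul_linear])
      then show ?case using KA[OF \<open>k \<in> K\<close>] by blast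
    next
      case (mult_H g j)
      then obtain c k where g: "g = c *\<^sub>R 1 + k" "k \<in> K" by blast
      have "column j H * g = 0 *\<^sub>R 1 + (c *\<^sub>R column j H + column j H * k)"
        by (simp add: g(1) distrib_left vec_eq_iff)
      moreover have "c *\<^sub>R column j H + column j H * k \<in> K"
        using K by (intro subspace_add subspace_scale Kc KH g)
      ultimately show ?case by blast
    qed
  qed
  moreover have "subspace ?S"
  proof -
    have "?S = {x + y |x y. x \<in> span {1} \<and> y \<in> K}" unfolding span_singleton by blast
    then show ?thesis using subspace_sums[OF subspace_span K] by simp
  qed
  ultimately have "span (generated_vectors A H) \<subseteq> ?S" by (rule span_minimal)
  moreover have "K \<subseteq> steerable A H 0" using assms by (auto simp: K_def)
  ultimately show ?thesis by blast
qed

text \<open>Steering with coefficient \<open>\<xi> = 1\<close> gives a solution that ends in 0.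
  Adding the constant \<open>c *\<^sub>R 1\<close> shifts initial and terminal value alike and
  leaves the drift unchanged, because \<open>A *v 1 = 0\<close>.\<close>

lemma steerable_subset_controllable:
  assumes A1: "A *v (1 :: real^'d) = 0" and k: "k \<in> steerable A H 0"
  shows "c *\<^sub>R 1 + k \<in> controllable_subspace M Z T A H"
proof -
  have "(\<lambda>_. 1) \<in> borel_measurable (F 0)" "integrable M (\<lambda>_. (1::real)\<^sup>2)" by simp_all
  then obtain U Y V where S: "null_solution A H 0 U Y V" and Y0: "AE \<omega> in M. Y 0 \<omega> = 1 *\<^sub>R k"
    using k unfolding steerable_def by blast
  define Y' where "Y' t \<omega> = Y t \<omega> + c *\<^sub>R 1" for t \<omega>
  have L: "U \<in> L2a" "Y \<in> L2a" "V \<in> L2a"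
    using S by (auto simp: null_solution_def)
  have dr: "A *v Y' s \<omega> + H *v U s \<omega> + (\<Sum>j\<in>UNIV. diag (column j H) *v column j (V s \<omega>)) = drift A H U Y V s \<omega>" for s \<omega>
    using A1 by (simp add: drift_def Y'_def matrix_vector_right_distrib linear_cmul[OF matrix_vector_mul_linear])
  have "bsde_solution M Z T A H U c Y' V"
    unfolding bsde_solution_def dr
  proof (intro conjI ballI L)
    show "Y' \<in> L2a" unfolding Y'_def[abs_def] by (intro L2_adapted_add L L2_adapted_const)
    fix t assume "t \<in> {0..T}"
    then obtain I where I: "ito t T V I" "AE \<omega> in M. Y t \<omega> = drift_integral A H U Y V t \<omega> - I \<omega>"
      using S unfolding null_solution_def by blast
    from I(2) have "AE \<omega> in M. Y' t \<omega> = c *\<^sub>R 1 + drift_integral A H U Y V t \<omega> - I \<omega>"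
      by eventually_elim (simp add: Y'_def)
    with I(1) show "\<exists>I. ito t T V I \<and> (AE \<omega> in M. Y' t \<omega> = c *\<^sub>R 1 + drift_integral A H U Y V t \<omega> - I \<omega>)"
      by blast
  qed
  moreover have "AE \<omega> in M. Y' 0 \<omega> = c *\<^sub>R 1 + k"
    using Y0 by eventually_elim (simp add: Y'_def)
  ultimately show ?thesis unfolding controllable_subspace_def using L(1) by blast
qed

end

theorem mainTheorem7:
  fixes P :: "'w measure" and Z :: "real \<Rightarrow> 'w \<Rightarrow> real^'m" and T :: real
    and A :: "real^'d^'d" and H :: "real^'m^'d"
  assumes "brownian_motion P Z T"
    and "0 < T"
    and "rate_matrix A"
  shows "controllable_subspace P Z T A H = span (generated_vectors A H)"
proof -
  interpret brownian_motion P Z T by fact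
  have A1: "A *v 1 = 0"
    using assms(3) by (simp add: rate_matrix_def matrix_vector_mult_def vec_eq_iff)
  have inv_A: "A *v g \<in> span (generated_vectors A H)" if "g \<in> span (generated_vectors A H)" for g
    using that
  proof (induction rule: span_induct)
    case base
    show ?case
      by (rule subspaceI) (simp_all add: matrix_vector_right_distrib linear_cmul[OF matrix_vector_mul_linear] span_add span_scale span_zero)
  next
    case (step g)
    then show ?case by (intro span_base generated_vectors.apply_A)
  qed
  have inv_H: "column j H * g \<in> span (generated_vectors A H)" if "g \<in> span (generated_vectors A H)" for g j
    using that
  proof (induction rule: span_induct)
    case base
    have "column j H * (c *\<^sub>R x) = c *\<^sub>R (column j H * x)" for c x by (simp add: vec_eq_iff)
    then show ?case by (intro subspaceI) (simp_all add: distrib_left span_add span_scale span_zero)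
  next
    case (step g)
    then show ?case by (intro span_base generated_vectors.mult_H)
  qed
  show ?thesis
  proof (rule equalityI)
    show "controllable_subspace P Z T A H \<subseteq> span (generated_vectors A H)"
    proof
      fix y assume "y \<in> controllable_subspace P Z T A H"
      then obtain U c Y V where sol: "U \<in> L2_adapted P Z T" "bsde_solution P Z T A H U c Y V" "AE \<omega> in P. Y 0 \<omega> = y"
        unfolding controllable_subspace_def by blast
      show "y \<in> span (generated_vectors A H)"
        by (rule bsde_initial_value_in_invariant_subspace[OF less_imp_le[OF assms(2)] subspace_span
              span_base[OF generated_vectors.one] inv_A inv_H sol])
    qed
    show "span (generated_vectors A H) \<subseteq> controllable_subspace P Z T A H"
      using generated_subset_steerable[OF assms(2) A1] steerable_subset_controllable[OF A1] by blast
  qed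
qed

end
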